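(* Let $\mathcal H$ be a separable Hilbert space and let $(t,\alpha)\mapsto H_\alpha(t)$, $(t,\alpha)\in[0,1]\times[0,1]$, be a family of bounded self-adjoint operators on $\mathcal H$ satisfying the Regularity assumption and the Gap hypothesis stated in the context. Assume moreover that $\sigma_\alpha(t)=\{E_\alpha(t)\}$ for all $(t,\alpha)$, i.e. the isolated part of the spectrum consists of a single eigenvalue $E_\alpha(t)$ (of arbitrary, possibly infinite, multiplicity). Then, with $Q_\alpha$, $P_\alpha$, $W_\alpha$ as defined in the context, for any $(t,\alpha)\in[0,1]\times[0,1]$, as $\epsilon\to0$ (in operator norm), $$P_\alpha(0)\,Q_\alpha(t)\,P_\alpha(0)=P_\alpha(0)\left(\frac1\epsilon\int_0^t\partial_\alpha E_\alpha(s)\,ds+i\,W_\alpha(t)^{-1}\,\partial_\alpha W_\alpha(t)\right)P_\alpha(0)+O(\epsilon).$$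
   Context: Throughout, $\epsilon>0$ is a small parameter, a dot denotes $\partial_t$, $\mathbb I$ is the identity, and $[A,B]=AB-BA$. Regularity assumption: the map $(t,\alpha)\mapsto H_\alpha(t)$ is $C^3$ in the norm sense, as a bounded-operator-valued function on $[0,1]\times[0,1]$. Gap hypothesis: the spectrum of $H_\alpha(t)$ is a disjoint union $\sigma(H_\alpha(t))=\sigma_\alpha(t)\cup\overline{\sigma_\alpha}(t)$ with $\inf_{(t,\alpha)\in[0,1]^2}\mathrm{dist}(\sigma_\alpha(t),\overline{\sigma_\alpha}(t))=g>0$ (here $\overline{\sigma_\alpha}(t)$ denotes the other part of the spectrum, not a closure). The spectral projector of $H_\alpha(t)$ associated with $\sigma_\alpha(t)$ is $$P_\alpha(t)=-\frac1{2\pi i}\int_\gamma (H_\alpha(t)-z)^{-1}\,dz,$$ where $\gamma$ is a loop in the complex plane encircling $\sigma_\alpha(t)$ only, which can be chosen locally independent of $(t,\alpha)$. Evolution and charge operator: $U_\alpha(t)$ (depending on $\epsilon$) is the solution of $i\epsilon\,\dot U_\alpha(t)=H_\alpha(t)U_\alpha(t)$, $U_\alpha(0)=\mathbb I$, and $$Q_\alpha(t)=\frac1\epsilon\int_0^t U_\alpha(s)^{-1}\big(\partial_\alpha H_\alpha(s)\big)U_\alpha(s)\,ds .$$ Parallel transport: $W_\alpha(t)$ is the ($\epsilon$-independent) unitary solution of $i\dot W_\alpha(t)=K_\alpha(t)W_\alpha(t)$, $W_\alpha(0)=\mathbb I$, where $K_\alpha(t)=i[\dot P_\alpha(t),P_\alpha(t)]$.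 *)

theory Defs
  imports "HOL-Complex_Analysis.Complex_Analysis"
begin

section \<open>Complex Hilbert spaces and operators on them\<close>

text \<open>The class \<^class>\<open>banach\<close> supplies the real vector space, the norm and completeness; the
  parameters add a complex scalar multiplication extending the real one and an inner product
  (antilinear in the first argument) inducing the norm. The triangle inequality, which is part of
  \<^class>\<open>banach\<close>, also follows from the remaining axioms.\<close>

class complex_hilbert = banach +
  fixes scaleC :: "complex \<Rightarrow> 'a \<Rightarrow> 'a"  (infixr "*\<^sub>C" 75)
    and cinner :: "'a \<Rightarrow> 'a \<Rightarrow> complex"
  assumes scaleC_of_real: "complex_of_real r *\<^sub>C x = r *\<^sub>R x"
    and scaleC_add_left: "(a + b) *\<^sub>C x = a *\<^sub>C x + b *\<^sub>C x"
    and scaleC_add_right: "a *\<^sub>C (x + y) = a *\<^sub>C x + a *\<^sub>C y"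
    and scaleC_scaleC: "a *\<^sub>C (b *\<^sub>C x) = (a * b) *\<^sub>C x"
    and cinner_commute: "cinner x y = cnj (cinner y x)"
    and cinner_add_right: "cinner x (y + z) = cinner x y + cinner x z"
    and cinner_scaleC_right: "cinner x (a *\<^sub>C y) = a * cinner x y"
    and cinner_self: "cinner x x = complex_of_real ((norm x)\<^sup>2)"

instantiation complex :: complex_hilbert
begin

definition scaleC_complex :: "complex \<Rightarrow> complex \<Rightarrow> complex" where
  "scaleC_complex a x = a * x"

definition cinner_complex :: "complex \<Rightarrow> complex \<Rightarrow> complex" where
  "cinner_complex x y = cnj x * y"

instance
proof
  fix r :: real and a b x y z :: complex
  show "complex_of_real r *\<^sub>C x = r *\<^sub>R x"
    by (simp only: scaleC_complex_def scaleR_conv_of_real)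
  show "(a + b) *\<^sub>C x = a *\<^sub>C x + b *\<^sub>C x"
    by (simp only: scaleC_complex_def distrib_right)
  show "a *\<^sub>C (x + y) = a *\<^sub>C x + a *\<^sub>C y"
    by (simp only: scaleC_complex_def distrib_left)
  show "a *\<^sub>C (b *\<^sub>C x) = (a * b) *\<^sub>C x"
    by (simp only: scaleC_complex_def mult.assoc)
  show "cinner x y = cnj (cinner y x)"
    by (simp only: cinner_complex_def complex_cnj_mult complex_cnj_cnj mult.commute)
  show "cinner x (y + z) = cinner x y + cinner x z"
    by (simp only: cinner_complex_def distrib_left)
  show "cinner x (a *\<^sub>C y) = a * cinner x y"
    by (simp only: cinner_complex_def scaleC_complex_def mult.left_commute)
  show "cinner x x = complex_of_real ((norm x)\<^sup>2)"
    by (simp only: cinner_complex_def complex_norm_square mult.commute)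
qed

end

lemma norm_scaleC: "norm (a *\<^sub>C x) = cmod a * norm (x :: 'a::complex_hilbert)"
proof -
  have "cinner (a *\<^sub>C x) x = cnj a * cinner x x"
    using cinner_commute [of "a *\<^sub>C x" x] cinner_commute [of x x]
    by (metis cinner_scaleC_right complex_cnj_mult)
  then have "complex_of_real ((norm (a *\<^sub>C x))\<^sup>2) = a * cnj a * complex_of_real ((norm x)\<^sup>2)"
    by (metis cinner_scaleC_right cinner_self mult.assoc)
  then have "complex_of_real ((norm (a *\<^sub>C x))\<^sup>2) = complex_of_real ((cmod a * norm x)\<^sup>2)"
    by (simp only: complex_norm_square [symmetric] of_real_mult [symmetric] power_mult_distrib)
  then have "(norm (a *\<^sub>C x))\<^sup>2 = (cmod a * norm x)\<^sup>2"
    by (simp only: of_real_eq_iff)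
  then show ?thesis
    by (rule power2_eq_imp_eq) simp_all
qed

lemma bounded_linear_scaleC: "bounded_linear (\<lambda>x :: 'a::complex_hilbert. a *\<^sub>C x)"
proof (rule bounded_linear_intro)
  show "a *\<^sub>C (r *\<^sub>R x) = r *\<^sub>R (a *\<^sub>C x)" for r and x :: 'a
    by (simp add: scaleC_of_real [symmetric] scaleC_scaleC mult.commute)
  show "norm (a *\<^sub>C x) \<le> norm x * cmod a" for x :: 'a
    by (simp add: norm_scaleC)
qed (rule scaleC_add_right)

text \<open>Bounded operators are rendered by the real Banach space \<^typ>\<open>'a \<Rightarrow>\<^sub>L 'a\<close> with the
  operator norm; complex linearity is a separate property.\<close>

type_synonym 'a operator = "'a \<Rightarrow>\<^sub>L 'a"

lift_definition scale_op :: "complex \<Rightarrow> 'a::complex_hilbert operator \<Rightarrow> 'a operator"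
    (infixr "*\<^sub>O" 75)
  is "\<lambda>c A x. c *\<^sub>C A x"
  by (rule bounded_linear_compose [OF bounded_linear_scaleC])

definition complex_linear_op :: "'a::complex_hilbert operator \<Rightarrow> bool" where
  "complex_linear_op A \<longleftrightarrow> (\<forall>c x. blinfun_apply A (c *\<^sub>C x) = c *\<^sub>C blinfun_apply A x)"

definition selfadjoint_op :: "'a::complex_hilbert operator \<Rightarrow> bool" where
  "selfadjoint_op A \<longleftrightarrow> complex_linear_op A \<and>
     (\<forall>x y. cinner (blinfun_apply A x) y = cinner x (blinfun_apply A y))"

text \<open>A two-sided inverse of a complex linear operator is itself complex linear, so nothing
  is lost by looking for it among the real linear bounded operators.\<close>

definition is_inverse_op :: "'a::complex_hilbert operator \<Rightarrow> 'a operator \<Rightarrow> bool" where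
  "is_inverse_op A B \<longleftrightarrow> A o\<^sub>L B = id_blinfun \<and> B o\<^sub>L A = id_blinfun"

definition inverse_op :: "'a::complex_hilbert operator \<Rightarrow> 'a operator" where
  "inverse_op A = (THE B. is_inverse_op A B)"

definition commutator_op :: "'a::complex_hilbert operator \<Rightarrow> 'a operator \<Rightarrow> 'a operator" where
  "commutator_op A B = (A o\<^sub>L B) - (B o\<^sub>L A)"

definition op_spectrum :: "'a::complex_hilbert operator \<Rightarrow> complex set" where
  "op_spectrum A = {z. \<not> (\<exists>B. is_inverse_op (A - z *\<^sub>O id_blinfun) B)}"


section \<open>Spectral projectors\<close>

text \<open>\<open>encircles \<gamma> S T\<close>: the positively oriented loop \<open>\<gamma>\<close> encircles \<open>S\<close> but not \<open>T\<close>.\<close>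

definition encircles :: "(real \<Rightarrow> complex) \<Rightarrow> complex set \<Rightarrow> complex set \<Rightarrow> bool" where
  "encircles \<gamma> S T \<longleftrightarrow>
     valid_path \<gamma> \<and> pathfinish \<gamma> = pathstart \<gamma> \<and> path_image \<gamma> \<inter> (S \<union> T) = {} \<and>
     (\<forall>z\<in>S. winding_number \<gamma> z = 1) \<and> (\<forall>z\<in>T. winding_number \<gamma> z = 0)"

text \<open>The operator-valued analogue of \<^const>\<open>contour_integral\<close>, which is only available for
  complex-valued integrands.\<close>

definition contour_integral_op ::
    "(real \<Rightarrow> complex) \<Rightarrow> (complex \<Rightarrow> 'a::complex_hilbert operator) \<Rightarrow> 'a operator" where
  "contour_integral_op \<gamma> F =
     integral {0..1} (\<lambda>x. vector_derivative \<gamma> (at x within {0..1}) *\<^sub>O F (\<gamma> x))"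

text \<open>The integral does not depend on which loop around \<open>S\<close> is chosen.\<close>

definition spectral_projector :: "'a::complex_hilbert operator \<Rightarrow> complex set \<Rightarrow> 'a operator" where
  "spectral_projector A S =
     (let \<gamma> = (SOME \<gamma>. encircles \<gamma> S (op_spectrum A - S))
      in (- 1 / (2 * complex_of_real pi * \<i>)) *\<^sub>O
           contour_integral_op \<gamma> (\<lambda>z. inverse_op (A - z *\<^sub>O id_blinfun)))"


section \<open>Regularity and gap hypotheses\<close>

text \<open>\<open>Ck_on k f S\<close>: \<open>f\<close> is \<open>k\<close> times continuously Frechet differentiable on \<open>S\<close>, the
  derivative (a linear map on the plane) being encoded by the two partial derivatives. Derivatives
  are taken within \<open>S\<close>, so they are one-sided on the boundary of a closed square.\<close>

primrec Ck_on :: "nat \<Rightarrow> (real \<times> real \<Rightarrow> 'b::real_normed_vector) \<Rightarrow> (real \<times> real) set \<Rightarrow> bool" where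
  "Ck_on 0 f S \<longleftrightarrow> continuous_on S f"
| "Ck_on (Suc k) f S \<longleftrightarrow>
     (\<exists>f1 f2. (\<forall>p\<in>S. (f has_derivative (\<lambda>h. fst h *\<^sub>R f1 p + snd h *\<^sub>R f2 p)) (at p within S)) \<and>
        Ck_on k f1 S \<and> Ck_on k f2 S)"

text \<open>Infimum of the distances of \<open>\<sigma> t \<alpha>\<close> and \<open>\<sigma>' t \<alpha>\<close> over the unit square, the distance to the
  empty set being infinite (unlike for \<^const>\<open>setdist\<close>).\<close>

definition spectral_gap ::
    "(real \<Rightarrow> real \<Rightarrow> complex set) \<Rightarrow> (real \<Rightarrow> real \<Rightarrow> complex set) \<Rightarrow> ereal" where
  "spectral_gap \<sigma> \<sigma>' =
     (INF t\<in>{0..1}. INF \<alpha>\<in>{0..1}. INF z\<in>\<sigma> t \<alpha>. INF w\<in>\<sigma>' t \<alpha>. ereal (dist z w))"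

text \<open>Here \<open>\<sigma>'\<close> is the other part of the spectrum. The last conjunct says that the loop
  defining the spectral projector can be chosen locally independent of the parameters; it excludes
  that \<open>\<sigma>\<close> jumps from one part of the spectrum to another.\<close>

definition gap_hypothesis ::
    "(real \<Rightarrow> real \<Rightarrow> 'a::complex_hilbert operator) \<Rightarrow> (real \<Rightarrow> real \<Rightarrow> complex set) \<Rightarrow>
     (real \<Rightarrow> real \<Rightarrow> complex set) \<Rightarrow> bool" where
  "gap_hypothesis H \<sigma> \<sigma>' \<longleftrightarrow>
     (\<forall>t\<in>{0..1}. \<forall>\<alpha>\<in>{0..1}.
        op_spectrum (H t \<alpha>) = \<sigma> t \<alpha> \<union> \<sigma>' t \<alpha> \<and> \<sigma> t \<alpha> \<inter> \<sigma>' t \<alpha> = {}) \<and>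
     spectral_gap \<sigma> \<sigma>' > 0 \<and>
     (\<forall>p\<in>{0..1} \<times> {0..1}. \<exists>N \<gamma>. open N \<and> p \<in> N \<and>
        (\<forall>(t, \<alpha>) \<in> N \<inter> {0..1} \<times> {0..1}. encircles \<gamma> (\<sigma> t \<alpha>) (\<sigma>' t \<alpha>)))"


section \<open>Evolution, charge and parallel transport\<close>

text \<open>\<open>V\<close> solves \<open>\<i> c V' = A V\<close> on the unit interval with \<open>V 0\<close> the identity.\<close>

definition solves_evolution ::
    "real \<Rightarrow> (real \<Rightarrow> 'a::complex_hilbert operator) \<Rightarrow> (real \<Rightarrow> 'a operator) \<Rightarrow> bool" where
  "solves_evolution c A V \<longleftrightarrow> V 0 = id_blinfun \<and>
     (\<forall>t\<in>{0..1}. \<exists>V'. (V has_vector_derivative V') (at t within {0..1}) \<and>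
        (\<i> * complex_of_real c) *\<^sub>O V' = A t o\<^sub>L V t)"

text \<open>Partial derivatives on the unit square, one-sided at its boundary.\<close>

definition d_t :: "(real \<Rightarrow> real \<Rightarrow> 'b::real_normed_vector) \<Rightarrow> real \<Rightarrow> real \<Rightarrow> 'b" where
  "d_t F t \<alpha> = vector_derivative (\<lambda>s. F s \<alpha>) (at t within {0..1})"

definition d_alpha :: "(real \<Rightarrow> real \<Rightarrow> 'b::real_normed_vector) \<Rightarrow> real \<Rightarrow> real \<Rightarrow> 'b" where
  "d_alpha F t \<alpha> = vector_derivative (\<lambda>a. F t a) (at \<alpha> within {0..1})"

definition transport_generator ::
    "(real \<Rightarrow> real \<Rightarrow> 'a::complex_hilbert operator) \<Rightarrow> real \<Rightarrow> real \<Rightarrow> 'a operator" where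
  "transport_generator P t \<alpha> = \<i> *\<^sub>O commutator_op (d_t P t \<alpha>) (P t \<alpha>)"

definition charge_op ::
    "real \<Rightarrow> (real \<Rightarrow> real \<Rightarrow> 'a::complex_hilbert operator) \<Rightarrow> (real \<Rightarrow> real \<Rightarrow> 'a operator) \<Rightarrow>
     real \<Rightarrow> real \<Rightarrow> 'a operator" where
  "charge_op \<epsilon> H U t \<alpha> =
     (1 / \<epsilon>) *\<^sub>R integral {0..t} (\<lambda>s. inverse_op (U s \<alpha>) o\<^sub>L d_alpha H s \<alpha> o\<^sub>L U s \<alpha>)"

end

theory Submission
  imports Defs
begin

text \<open>
  Removing the dynamical phase replaces the generator by \<open>A = H - E\<close>, for which \<open>A P = 0\<close>, and leaves
  \<open>U\<^sup>-\<^sup>1 D U\<close> unchanged. Differentiating \<open>(H - E) P = 0\<close> in \<open>\<alpha>\<close> gives, for \<open>D = \<partial>\<^sub>\<alpha>(H - E)\<close> and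
  \<open>X = [P, \<partial>\<^sub>\<alpha>P]\<close>, the decomposition \<open>D = [A, X] + (1 - P) D (1 - P)\<close>. Between projectors
  \<open>P(0)\<close> the last term contributes \<open>O(\<epsilon>\<^sup>2)\<close> to the integral of \<open>U\<^sup>-\<^sup>1 D U\<close> by the adiabatic theorem
  \<open>U P(0) = W P(0) + O(\<epsilon>)\<close>, and integrating the commutator by parts leaves
  \<open>\<i>\<epsilon> \<integral> W\<^sup>-\<^sup>1 P [\<partial>\<^sub>tP, \<partial>\<^sub>\<alpha>P] P W\<close> up to \<open>O(\<epsilon>\<^sup>2)\<close>. By Duhamel's formula for the transport equation this is
  \<open>\<i>\<epsilon> P(0) W\<^sup>-\<^sup>1 \<partial>\<^sub>\<alpha>W P(0)\<close>.

  No continuous functional calculus is used: the projector \<open>P\<close> and the reduced resolvent \<open>S\<close> are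
  circle integrals of the resolvent, the bound \<open>|Im z| \<parallel>(H - z)\<^sup>-\<^sup>1\<parallel> \<le> 1\<close> rules out a nilpotent part
  and bounds \<open>S\<close> by the gap, and the smoothness of \<open>E\<close>, \<open>P\<close>, \<open>S\<close> follows from difference identities
  such as \<open>P' - P = - S \<Delta> P' - P \<Delta> S'\<close> for \<open>\<Delta> = (H' - E') - (H - E)\<close>.
\<close>

section \<open>Inner product and operator algebra\<close>

text \<open>The charge carries a factor 1/\<epsilon>, so the integral must be known up to
  O(\<epsilon>^2), one order better than the adiabatic theorem provides. The extra order has two
  sources: the block \<open>(1 - P) D (1 - P)\<close> meets a transition amplitude of order
  \<epsilon> on each side, and the boundary term of the integration by parts has a factor \<epsilon>
  in front while \<open>X\<close> is off-diagonal, so that its compression is again of order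
  \<epsilon>. The transport term appears because the compressions by \<open>P\<close> of the
  t-derivative of \<open>[P, P2]\<close> and of the \<alpha>-derivative of the generator
  \<open>[P1, P]\<close> coincide: both equal \<open>P [P1, P2] P\<close>, where \<open>P1\<close>
  and \<open>P2\<close> are the derivatives of \<open>P\<close> in t and \<alpha>. Two features of
  the setting shape the details. Operators are a priori only real linear, so complex linearity has
  to be established for each object before a phase or a factor \<open>\<i>\<close> may pass through
  it. The loop in the definition of the projector is an arbitrary chosen one, so the projector is
  first built on a circle and then shown to agree with the integral over any admissible
  loop.\<close>

lemma scaleC_scaleR: "c *\<^sub>C (r *\<^sub>R x) = r *\<^sub>R (c *\<^sub>C (x :: 'a::complex_hilbert))"
  by (metis scaleC_of_real scaleC_scaleC mult.commute)

lemma cinner_scaleC_left: "cinner (a *\<^sub>C x) y = cnj a * cinner x y"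
  by (metis cinner_commute cinner_scaleC_right complex_cnj_mult)

lemma cinner_add_left: "cinner (x + y) z = cinner x z + cinner y z"
  by (metis cinner_commute cinner_add_right complex_cnj_add)

lemma cinner_scaleR_right: "cinner x (r *\<^sub>R y) = r *\<^sub>R cinner x y"
  by (metis scaleC_of_real cinner_scaleC_right scaleR_conv_of_real)

lemma cinner_scaleR_left: "cinner (r *\<^sub>R x) y = r *\<^sub>R cinner x y"
  by (metis scaleC_of_real cinner_scaleC_left scaleR_conv_of_real complex_cnj_complex_of_real)

lemma cinner_minus_right: "cinner x (- y) = - cinner x y"
  using cinner_scaleR_right [of x "-1" y] by simp

lemma cinner_minus_left: "cinner (- x) y = - cinner x y"
  using cinner_scaleR_left [of "-1" x y] by simp

lemma cinner_diff_right: "cinner x (y - z) = cinner x y - cinner x z"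
  using cinner_add_right [of x y "- z"] by (simp add: cinner_minus_right)

lemma cinner_diff_left: "cinner (x - y) z = cinner x z - cinner y z"
  using cinner_add_left [of x "- y" z] by (simp add: cinner_minus_left)

lemma cinner_zero_right [simp]: "cinner x 0 = 0"
  using cinner_scaleR_right [of x 0 0] by simp

lemma cinner_zero_left [simp]: "cinner 0 x = 0"
  using cinner_scaleR_left [of 0 0 x] by simp

lemma cinner_Cauchy_Schwarz: "cmod (cinner x y) \<le> norm x * norm (y :: 'a::complex_hilbert)"
proof (cases "y = 0")
  case False
  \<comment> \<open>The coefficient of the projection of \<open>x\<close> onto \<open>y\<close>: it
    makes \<open>x - c *\<^sub>C y\<close> orthogonal to \<open>y\<close>, which is why the last
    bracket of the expansion vanishes.\<close>
  define c where "c = cinner y x / of_real ((norm y)\<^sup>2)"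
  define n where "n = (norm y)\<^sup>2"
  have n: "n > 0" using False by (simp add: n_def)
  have c: "c * of_real n = cinner y x" using False by (simp add: c_def n_def)
  have "of_real ((norm (x - c *\<^sub>C y))\<^sup>2) =
      cinner x x - cinner x y * c - cnj c * (cinner y x - c * cinner y y)"
    unfolding cinner_self [symmetric]
    by (simp add: cinner_diff_left cinner_diff_right cinner_scaleC_left cinner_scaleC_right
        algebra_simps)
  also have "cinner y x - c * cinner y y = 0"
    using c by (simp add: cinner_self n_def)
  also have "cinner x y * c = of_real ((cmod (cinner x y))\<^sup>2 / n)"
    using cinner_commute [of y x] by (simp add: c_def n_def complex_norm_square [symmetric])
  finally have "complex_of_real ((norm (x - c *\<^sub>C y))\<^sup>2)
      = complex_of_real ((norm x)\<^sup>2 - (cmod (cinner x y))\<^sup>2 / n)"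
    by (simp add: cinner_self)
  then have "(norm (x - c *\<^sub>C y))\<^sup>2 = (norm x)\<^sup>2 - (cmod (cinner x y))\<^sup>2 / n"
    by (simp only: of_real_eq_iff)
  then have "(cmod (cinner x y))\<^sup>2 / n \<le> (norm x)\<^sup>2"
    by (metis diff_ge_0_iff_ge zero_le_power2)
  then have "(cmod (cinner x y))\<^sup>2 \<le> (norm x * norm y)\<^sup>2"
    using n by (simp add: field_simps n_def)
  then show ?thesis
    by (rule power2_le_imp_le) simp
qed simp

lemma cinner_eqI: "(\<And>x. cinner x y = cinner x z) \<Longrightarrow> y = (z :: 'a::complex_hilbert)"
proof -
  assume "\<And>x. cinner x y = cinner x z"
  then have "cinner (y - z) (y - z) = 0" by (simp add: cinner_diff_right)
  then show "y = z" by (simp add: cinner_self)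
qed

lemma operator_eqI:
  fixes A B :: "'a::complex_hilbert operator"
  assumes "\<And>x y. cinner y (A x) = cinner y (B x)"
  shows "A = B"
  by (rule blinfun_eqI, rule cinner_eqI, rule assms)

text \<open>The test vector \<open>y = A x\<close> turns a bound on matrix elements into a norm
  bound. Contour integrals of operators are estimated in this way, through scalar integrals.\<close>

lemma operator_norm_leI:
  fixes A :: "'a::complex_hilbert operator"
  assumes "0 \<le> C" "\<And>x y. cmod (cinner y (A x)) \<le> C * norm x * norm y"
  shows "norm A \<le> C"
proof (rule norm_blinfun_bound [OF assms(1)])
  fix x
  show "norm (A x) \<le> C * norm x"
  proof (cases "A x = 0")
    case True then show ?thesis using assms(1) by simp
  next
    case False
    have "norm (A x) * norm (A x) = cmod (cinner (A x) (A x))"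
      by (simp add: cinner_self norm_mult norm_power power2_eq_square)
    also have "\<dots> \<le> (C * norm x) * norm (A x)" by (rule assms(2))
    finally show ?thesis using False by simp
  qed
qed

lemma bounded_bilinear_cinner:
  "bounded_bilinear (cinner :: 'a::complex_hilbert \<Rightarrow> 'a \<Rightarrow> complex)"
proof
  show "\<exists>K. \<forall>a b. cmod (cinner a b) \<le> norm a * norm (b :: 'a) * K"
    by (rule exI [of _ 1]) (simp add: cinner_Cauchy_Schwarz)
qed (simp_all add: cinner_add_left cinner_add_right cinner_scaleR_left cinner_scaleR_right)

section \<open>Complex multiples and products of operators\<close>

lemma scale_op_apply [simp]: "blinfun_apply (c *\<^sub>O A) x = c *\<^sub>C blinfun_apply A x"
  by transfer simp

lemma scaleC_one [simp]: "1 *\<^sub>C (x :: 'a::complex_hilbert) = x"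
  using scaleC_of_real [of 1 x] by simp

lemma scaleC_zero [simp]: "c *\<^sub>C (0 :: 'a::complex_hilbert) = 0" "0 *\<^sub>C (x :: 'a) = 0"
  using norm_scaleC [of c "0 :: 'a"] norm_scaleC [of 0 x] by simp_all

lemma bounded_bilinear_scale_op:
  "bounded_bilinear (scale_op :: complex \<Rightarrow> 'a::complex_hilbert operator \<Rightarrow> 'a operator)"
proof
  show "\<exists>K. \<forall>a b. norm (a *\<^sub>O (b :: 'a operator)) \<le> norm a * norm b * K"
  proof (intro exI [of _ 1] allI)
    fix a and b :: "'a operator"
    show "norm (a *\<^sub>O b) \<le> norm a * norm b * 1"
    proof (rule norm_blinfun_bound)
      fix x
      show "norm ((a *\<^sub>O b) x) \<le> norm a * norm b * 1 * norm x"
        using mult_left_mono [OF norm_blinfun [of b x], of "cmod a"]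
        by (simp add: norm_scaleC mult.assoc)
    qed simp
  qed
  show "(r *\<^sub>R a) *\<^sub>O b = r *\<^sub>R (a *\<^sub>O b)" for r a and b :: "'a operator"
    by (rule blinfun_eqI) (simp add: blinfun.bilinear_simps scaleR_conv_of_real
        scaleC_scaleC [symmetric] scaleC_of_real)
  show "a *\<^sub>O (r *\<^sub>R b) = r *\<^sub>R (a *\<^sub>O b)" for r a and b :: "'a operator"
    by (rule blinfun_eqI) (simp add: blinfun.bilinear_simps scaleC_scaleR)
qed (auto intro!: blinfun_eqI simp: blinfun.bilinear_simps scaleC_add_left scaleC_add_right)

lemmas scale_op_simps =
  bounded_bilinear.add_left [OF bounded_bilinear_scale_op]
  bounded_bilinear.add_right [OF bounded_bilinear_scale_op]
  bounded_bilinear.diff_left [OF bounded_bilinear_scale_op]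
  bounded_bilinear.diff_right [OF bounded_bilinear_scale_op]
  bounded_bilinear.minus_left [OF bounded_bilinear_scale_op]
  bounded_bilinear.minus_right [OF bounded_bilinear_scale_op]
  bounded_bilinear.zero_left [OF bounded_bilinear_scale_op]
  bounded_bilinear.zero_right [OF bounded_bilinear_scale_op]
  bounded_bilinear.scaleR_left [OF bounded_bilinear_scale_op]
  bounded_bilinear.scaleR_right [OF bounded_bilinear_scale_op]

lemma scale_op_scale_op: "a *\<^sub>O b *\<^sub>O A = (a * b) *\<^sub>O A"
  by (rule blinfun_eqI) (simp add: scaleC_scaleC)

lemma scale_op_of_real: "complex_of_real r *\<^sub>O A = r *\<^sub>R A"
  by (rule blinfun_eqI) (simp add: scaleC_of_real blinfun.bilinear_simps)

lemma scale_op_one [simp]: "1 *\<^sub>O A = A"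
  by (rule blinfun_eqI) simp

lemma norm_scale_op: "norm (c *\<^sub>O A) = cmod c * norm A"
proof -
  have le: "norm (c *\<^sub>O A) \<le> cmod c * norm A" for c and A :: "'a operator"
  proof (rule norm_blinfun_bound)
    fix x
    show "norm ((c *\<^sub>O A) x) \<le> cmod c * norm A * norm x"
      using mult_left_mono [OF norm_blinfun [of A x], of "cmod c"]
      by (simp add: norm_scaleC mult.assoc)
  qed simp
  show ?thesis
  proof (cases "c = 0")
    case False
    have "norm A = norm (inverse c *\<^sub>O c *\<^sub>O A)" using False by (simp add: scale_op_scale_op)
    also have "\<dots> \<le> cmod (inverse c) * norm (c *\<^sub>O A)" by (rule le)
    finally have "cmod c * norm A \<le> norm (c *\<^sub>O A)"
      using False by (simp add: norm_inverse norm_divide field_simps)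
    then show ?thesis using le [of c A] by simp
  qed (simp add: scale_op_simps)
qed

lemma compose_assoc: "(A o\<^sub>L B) o\<^sub>L C = A o\<^sub>L (B o\<^sub>L C)"
  by (rule blinfun_eqI) simp

lemma compose_id [simp]: "A o\<^sub>L id_blinfun = A" "id_blinfun o\<^sub>L A = A"
  by (auto intro: blinfun_eqI)

lemmas compose_distribs =
  bounded_bilinear.add_left [OF bounded_bilinear_blinfun_compose]
  bounded_bilinear.add_right [OF bounded_bilinear_blinfun_compose]
  bounded_bilinear.diff_left [OF bounded_bilinear_blinfun_compose]
  bounded_bilinear.diff_right [OF bounded_bilinear_blinfun_compose]
  bounded_bilinear.minus_left [OF bounded_bilinear_blinfun_compose]
  bounded_bilinear.minus_right [OF bounded_bilinear_blinfun_compose]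
  bounded_bilinear.scaleR_left [OF bounded_bilinear_blinfun_compose]
  bounded_bilinear.scaleR_right [OF bounded_bilinear_blinfun_compose]

lemma compose_scale_op_left: "(c *\<^sub>O A) o\<^sub>L B = c *\<^sub>O (A o\<^sub>L B)"
  by (rule blinfun_eqI) simp

lemma compose_scale_op_right: "complex_linear_op A \<Longrightarrow> A o\<^sub>L (c *\<^sub>O B) = c *\<^sub>O (A o\<^sub>L B)"
  by (rule blinfun_eqI) (simp add: complex_linear_op_def)

text \<open>Normal form: sums of right-nested products with scalars in front. Moving a complex
  scalar out of a right factor is left out, because it needs a complex linear left factor.\<close>

lemmas op_simps = compose_assoc compose_distribs compose_scale_op_left scale_op_simps
  scale_op_scale_op

lemma norm_compose_le:
  assumes "norm A \<le> a" "norm B \<le> b"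
  shows "norm (A o\<^sub>L B) \<le> a * b"
  using norm_blinfun_compose [of A B] mult_mono' [OF assms] by simp

lemma has_vector_derivative_compose_op:
  assumes "(f has_vector_derivative f') (at x within S)" "(g has_vector_derivative g')
      (at x within S)"
  shows "((\<lambda>x. f x o\<^sub>L g x) has_vector_derivative (f x o\<^sub>L g') + (f' o\<^sub>L g x)) (at x within S)"
  using bounded_bilinear.has_vector_derivative [OF bounded_bilinear_blinfun_compose assms] .

lemmas continuous_on_compose_op [continuous_intros] =
  bounded_bilinear.continuous_on [OF bounded_bilinear_blinfun_compose]

lemmas continuous_on_scale_op [continuous_intros] =
  bounded_bilinear.continuous_on [OF bounded_bilinear_scale_op]

lemmas tendsto_compose_op = bounded_bilinear.tendsto [OF bounded_bilinear_blinfun_compose]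

section \<open>Complex linearity and adjoints\<close>

lemma complex_linear_op_intros:
  fixes A B :: "'a::complex_hilbert operator"
  shows "complex_linear_op (id_blinfun :: 'a operator)" "complex_linear_op (0 :: 'a operator)"
  and
  "complex_linear_op A \<Longrightarrow> complex_linear_op B \<Longrightarrow> complex_linear_op (A + B)"
  "complex_linear_op A \<Longrightarrow> complex_linear_op B \<Longrightarrow> complex_linear_op (A - B)"
  "complex_linear_op A \<Longrightarrow> complex_linear_op (- A)"
  "complex_linear_op A \<Longrightarrow> complex_linear_op (r *\<^sub>R A)"
  "complex_linear_op A \<Longrightarrow> complex_linear_op (c *\<^sub>O A)"
  "complex_linear_op A \<Longrightarrow> complex_linear_op B \<Longrightarrow> complex_linear_op (A o\<^sub>L B)"
proof -
  have *: "c *\<^sub>C (- x) = - (c *\<^sub>C x)" for c and x :: 'a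
    using scaleC_add_right [of c "- x" x] by (simp add: eq_neg_iff_add_eq_0)
  have **: "c *\<^sub>C (x - y) = c *\<^sub>C x - c *\<^sub>C y" for c and x y :: 'a
    using scaleC_add_right [of c x "- y"] by (simp add: *)
  show
    "complex_linear_op (id_blinfun :: 'a operator)" "complex_linear_op (0 :: 'a operator)"
    "complex_linear_op A \<Longrightarrow> complex_linear_op B \<Longrightarrow> complex_linear_op (A + B)"
    "complex_linear_op A \<Longrightarrow> complex_linear_op B \<Longrightarrow> complex_linear_op (A - B)"
    "complex_linear_op A \<Longrightarrow> complex_linear_op (- A)"
    "complex_linear_op A \<Longrightarrow> complex_linear_op (r *\<^sub>R A)"
    "complex_linear_op A \<Longrightarrow> complex_linear_op (c *\<^sub>O A)"
    "complex_linear_op A \<Longrightarrow> complex_linear_op B \<Longrightarrow> complex_linear_op (A o\<^sub>L B)"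
    by (simp_all add: complex_linear_op_def blinfun.bilinear_simps scaleC_add_right * **
        scaleC_scaleR scaleC_scaleC mult.commute)
qed

text \<open>Adjointness is kept as a relation because the adjoints that occur are all explicit: a
  projector is its own adjoint, and a unitary has its inverse.\<close>

definition adjoint_pair :: "'a::complex_hilbert operator \<Rightarrow> 'a operator \<Rightarrow> bool" where
  "adjoint_pair A B \<longleftrightarrow> (\<forall>x y. cinner (blinfun_apply A x) y = cinner x (blinfun_apply B y))"

lemma adjoint_pair_intros:
  "adjoint_pair id_blinfun id_blinfun"
  "adjoint_pair A A' \<Longrightarrow> adjoint_pair B B' \<Longrightarrow> adjoint_pair (A + B) (A' + B')"
  "adjoint_pair A A' \<Longrightarrow> adjoint_pair B B' \<Longrightarrow> adjoint_pair (A - B) (A' - B')"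
  "adjoint_pair A A' \<Longrightarrow> adjoint_pair (r *\<^sub>R A) (r *\<^sub>R A')"
  "adjoint_pair A A' \<Longrightarrow> adjoint_pair B B' \<Longrightarrow> adjoint_pair (A o\<^sub>L B) (B' o\<^sub>L A')"
  by (simp_all add: adjoint_pair_def blinfun.bilinear_simps cinner_add_left cinner_add_right
      cinner_diff_left cinner_diff_right cinner_scaleR_left cinner_scaleR_right)

text \<open>Carries the adiabatic estimate for \<open>V s o\<^sub>L P 0\<close> over to
  \<open>P 0 o\<^sub>L inverse_op (V s)\<close>.\<close>

lemma adjoint_pair_norm:
  assumes "adjoint_pair A B"
  shows "norm B \<le> norm A"
proof (rule operator_norm_leI)
  fix x y
  have "cmod (cinner y (B x)) = cmod (cinner (A y) x)"
    using assms by (simp add: adjoint_pair_def)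
  also have "\<dots> \<le> norm (A y) * norm x" by (rule cinner_Cauchy_Schwarz)
  also have "\<dots> \<le> (norm A * norm y) * norm x" by (intro mult_right_mono norm_blinfun) simp
  finally show "cmod (cinner y (B x)) \<le> norm A * norm x * norm y" by (simp add: mult_ac)
qed simp

section \<open>Inverses\<close>

lemma is_inverse_op_unique:
  assumes "is_inverse_op A B" "is_inverse_op A C"
  shows "B = C"
proof -
  have "B o\<^sub>L (A o\<^sub>L C) = (B o\<^sub>L A) o\<^sub>L C" by (simp only: compose_assoc)
  then show ?thesis using assms by (simp add: is_inverse_op_def)
qed

lemma inverse_op_eq: "is_inverse_op A B \<Longrightarrow> inverse_op A = B"
  unfolding inverse_op_def by (rule the_equality) (auto dest: is_inverse_op_unique)

lemma is_inverse_op_inverse_op: "is_inverse_op A B \<Longrightarrow> is_inverse_op A (inverse_op A)"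
  by (simp add: inverse_op_eq)

lemma is_inverse_op_complex_linear:
  assumes "is_inverse_op A B" "complex_linear_op A"
  shows "complex_linear_op B"
  unfolding complex_linear_op_def
proof (intro allI)
  fix c x
  have 1: "A (B y) = y" "B (A y) = y" for y
    using assms(1) unfolding is_inverse_op_def
    by (metis blinfun_apply_blinfun_compose blinfun_apply_id_blinfun)+
  have "B (c *\<^sub>C x) = B (A (c *\<^sub>C B x))"
    using assms(2) by (simp add: complex_linear_op_def 1)
  then show "B (c *\<^sub>C x) = c *\<^sub>C B x" by (simp add: 1)
qed

text \<open>Expand the middle factor. The continuity and differentiability of inverses below all
  rest on this identity.\<close>

lemma inverse_difference:
  assumes "is_inverse_op A A'" "is_inverse_op B B'"
  shows "A' - B' = A' o\<^sub>L (B - A) o\<^sub>L B'"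
proof -
  have "A' o\<^sub>L (B - A) o\<^sub>L B' = (A' o\<^sub>L (B o\<^sub>L B')) - ((A' o\<^sub>L A) o\<^sub>L B')"
    by (simp only: op_simps)
  then show ?thesis using assms by (simp add: is_inverse_op_def)
qed

text \<open>Banach's fixed point theorem in place of the Neumann series.\<close>

lemma is_inverse_op_near_id:
  fixes C :: "'a::complex_hilbert operator"
  assumes "norm C < 1"
  shows "\<exists>B. is_inverse_op (id_blinfun - C) B"
proof -
  have "\<exists>!B. id_blinfun + (C o\<^sub>L B) = B"
  proof (rule banach_fix_type [OF _ assms])
    show "\<forall>B B'. dist (id_blinfun + (C o\<^sub>L B)) (id_blinfun + (C o\<^sub>L B')) \<le> norm C * dist B B'"
    proof (intro allI)
      fix B B'
      show "dist (id_blinfun + (C o\<^sub>L B)) (id_blinfun + (C o\<^sub>L B')) \<le> norm C * dist B B'"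
        using norm_blinfun_compose [of C "B - B'"] by (simp add: dist_norm op_simps)
    qed
  qed simp
  then obtain B where B: "id_blinfun + (C o\<^sub>L B) = B" by auto
  have right: "(id_blinfun - C) o\<^sub>L B = id_blinfun"
    using B by (simp add: op_simps algebra_simps)
  \<comment> \<open>\<open>D\<close> measures the failure of the right inverse \<open>B\<close> to
    be a left inverse. It satisfies \<open>D = C D\<close> with a strict contraction
    \<open>C\<close>, so it vanishes.\<close>
  define D where "D = (B o\<^sub>L (id_blinfun - C)) - id_blinfun"
  have "(id_blinfun - C) o\<^sub>L D = 0"
    unfolding D_def by (simp add: compose_distribs(4) compose_assoc [symmetric] right)
  then have "D = C o\<^sub>L D" by (simp add: op_simps)
  then have "norm D \<le> norm C * norm D" by (metis norm_blinfun_compose)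
  then have "(1 - norm C) * norm D \<le> 0" by (simp add: algebra_simps)
  then have "D = 0" using assms by (simp add: mult_le_0_iff)
  then show ?thesis using right by (auto simp: is_inverse_op_def D_def)
qed

text \<open>Factor \<open>A - C\<close> as \<open>(1 - C B) A\<close>; the first factor is close to
  the identity.\<close>

lemma is_inverse_op_perturb:
  fixes A :: "'a::complex_hilbert operator"
  assumes "is_inverse_op A B" "norm C * norm B < 1"
  shows "\<exists>B'. is_inverse_op (A - C) B'"
proof -
  have "norm (C o\<^sub>L B) < 1" using norm_blinfun_compose [of C B] assms(2) by linarith
  then obtain D where D: "is_inverse_op (id_blinfun - (C o\<^sub>L B)) D"
    using is_inverse_op_near_id by blast
  have eq: "A - C = (id_blinfun - (C o\<^sub>L B)) o\<^sub>L A"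
    using assms(1) by (simp add: is_inverse_op_def op_simps)
  have "is_inverse_op (A - C) (B o\<^sub>L D)"
    unfolding is_inverse_op_def
  proof
    have "(A - C) o\<^sub>L (B o\<^sub>L D) = (id_blinfun - (C o\<^sub>L B)) o\<^sub>L ((A o\<^sub>L B) o\<^sub>L D)"
      unfolding eq by (simp only: compose_assoc)
    then show "(A - C) o\<^sub>L (B o\<^sub>L D) = id_blinfun"
      using assms(1) D by (simp add: is_inverse_op_def)
    have "(B o\<^sub>L D) o\<^sub>L (A - C) = B o\<^sub>L ((D o\<^sub>L (id_blinfun - (C o\<^sub>L B))) o\<^sub>L A)"
      unfolding eq by (simp only: compose_assoc)
    then show "(B o\<^sub>L D) o\<^sub>L (A - C) = id_blinfun"
      using assms(1) D by (simp add: is_inverse_op_def)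
  qed
  then show ?thesis by blast
qed

text \<open>In \<open>B' = B + B' C B\<close> the last term is at most half of
  \<open>norm B'\<close> and can be absorbed on the left. The bound does not involve the perturbed
  inverse, which makes it usable along a limit.\<close>

lemma is_inverse_op_perturb_norm:
  fixes A :: "'a::complex_hilbert operator"
  assumes "is_inverse_op A B" "norm C * norm B \<le> 1/2" "is_inverse_op (A - C) B'"
  shows "norm B' \<le> 2 * norm B"
proof -
  have "B' = B + (B' o\<^sub>L C o\<^sub>L B)"
    using inverse_difference [OF assms(3,1)] by (simp add: algebra_simps)
  then have "norm B' \<le> norm B + norm (B' o\<^sub>L C o\<^sub>L B)" by (metis norm_triangle_ineq)
  also have "norm (B' o\<^sub>L C o\<^sub>L B) \<le> norm B' * norm C * norm B"
    by (intro norm_compose_le norm_blinfun_compose order_refl)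
  also have "\<dots> = norm B' * (norm C * norm B)" by simp
  also have "\<dots> \<le> norm B' * (1/2)" by (intro mult_left_mono assms) simp
  finally show ?thesis by simp
qed

lemma inverse_tendsto:
  fixes A :: "'b \<Rightarrow> 'a::complex_hilbert operator"
  assumes inv: "\<forall>\<^sub>F q in F. is_inverse_op (A q) (B q)" and inv0: "is_inverse_op A0 B0"
    and lim: "(A \<longlongrightarrow> A0) F"
  shows "(B \<longlongrightarrow> B0) F"
proof -
  have "((\<lambda>q. norm (A0 - A q) * norm B0) \<longlongrightarrow> norm (A0 - A0) * norm B0) F"
    by (intro tendsto_intros lim)
  then have small: "\<forall>\<^sub>F q in F. norm (A0 - A q) * norm B0 < 1/2"
    by (rule order_tendstoD) simp
  have "\<forall>\<^sub>F q in F. norm (B q - B0) \<le> norm (A0 - A q) * (2 * norm B0 * norm B0)"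
    using inv small
  proof eventually_elim
    case (elim q)
    have n: "norm (B q) \<le> 2 * norm B0"
      by (rule is_inverse_op_perturb_norm [OF inv0, of "A0 - A q"]) (use elim in auto)
    have "norm (B q - B0) \<le> (2 * norm B0) * norm (A0 - A q) * norm B0"
      unfolding inverse_difference [OF elim(1) inv0]
      by (intro norm_compose_le n order_refl)
    then show ?case by (simp add: mult_ac)
  qed
  moreover have "((\<lambda>q. norm (A0 - A q) * (2 * norm B0 * norm B0)) \<longlongrightarrow> norm (A0 - A0) *
      (2 * norm B0 * norm B0)) F"
    by (intro tendsto_intros lim)
  then have "((\<lambda>q. norm (A0 - A q) * (2 * norm B0 * norm B0)) \<longlongrightarrow> 0) F" by simp
  ultimately have "((\<lambda>q. B q - B0) \<longlongrightarrow> 0) F"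
    by (rule Lim_null_comparison)
  then show ?thesis by (rule LIM_zero_cancel)
qed

text \<open>The factor \<open>g\<close> need not be differentiable because \<open>f\<close> vanishes at the point.\<close>

lemma has_derivative_vanishing_bilinear:
  assumes "bounded_bilinear pr"
    and f: "(f has_derivative f') (at p within S)" and fp: "f p = 0"
    and g: "(g \<longlongrightarrow> g0) (at p within S)"
  shows "((\<lambda>q. pr (f q) (g q)) has_derivative (\<lambda>h. pr (f' h) g0)) (at p within S)"
proof -
  interpret bounded_bilinear pr by fact
  have bl: "bounded_linear f'" using f by (rule has_derivative_bounded_linear)
  obtain M where M: "M > 0" "\<And>a b. norm (pr a b) \<le> norm a * norm b * M"
    using pos_bounded by blast
  obtain K where K: "K > 0" "\<And>h. norm (f' h) \<le> norm h * K"
    using bounded_linear.pos_bounded [OF bl] by blast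
  have lip: "\<forall>\<^sub>F q in at p within S. norm (f q) \<le> (K + 1) * norm (q - p)"
  proof -
    have "\<forall>\<^sub>F q in at p within S. norm (f q - f p - f' (q - p)) \<le> 1 * norm (q - p)"
      using f unfolding has_derivative_within_alt2 by (metis zero_less_one)
    then show ?thesis
    proof eventually_elim
      case (elim q)
      have "norm (f q) \<le> norm (f q - f' (q - p)) + norm (f' (q - p))"
        by (metis diff_add_cancel norm_triangle_ineq)
      then show ?case using elim fp K(2) [of "q - p"] by (simp add: algebra_simps)
    qed
  qed
  have "((\<lambda>q. pr (f q) g0) has_derivative (\<lambda>h. pr (f' h) g0)) (at p within S)"
    by (rule bounded_linear.has_derivative [OF bounded_linear_left f])
  \<comment> \<open>Split \<open>g\<close> as \<open>g0 + (g - g0)\<close>. The second part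
    contributes no derivative: \<open>f\<close> is at most linear in the distance to
    \<open>p\<close>, and \<open>g - g0\<close> tends to 0.\<close>
  moreover have "((\<lambda>q. pr (f q) (g q - g0)) has_derivative (\<lambda>h. 0)) (at p within S)"
    unfolding has_derivative_within_alt2
  proof (intro conjI allI impI)
    fix e :: real assume e: "e > 0"
    \<comment> \<open>The divisor compensates the bound \<open>M\<close> of \<open>pr\<close> and
      the Lipschitz constant \<open>K + 1\<close> of \<open>f\<close> at \<open>p\<close>.\<close>
    have "\<forall>\<^sub>F q in at p within S. dist (g q) g0 < e / (M * (K + 1))"
      using g e M(1) K(1) by (intro tendstoD) auto
    with lip show "\<forall>\<^sub>F q in at p within S. norm (pr (f q) (g q - g0) - pr (f p) (g p - g0) - 0) \<le>
        e * norm (q - p)"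
    proof eventually_elim
      case (elim q)
      have "norm (pr (f q) (g q - g0)) \<le> norm (f q) * norm (g q - g0) * M" by (rule M)
      also have "\<dots> \<le> ((K + 1) * norm (q - p)) * (e / (M * (K + 1))) * M"
        using elim M(1) K(1) e by (intro mult_mono mult_right_mono) (auto simp: dist_norm)
      also have "\<dots> = e * norm (q - p) * (M * (K + 1)) / (M * (K + 1))" by simp
      also have "\<dots> = e * norm (q - p)" using M(1) K(1) by (intro nonzero_mult_div_cancel_right) auto
      finally show ?case by (simp add: fp zero_left)
    qed
  qed simp
  ultimately have "((\<lambda>q. pr (f q) g0 + pr (f q) (g q - g0)) has_derivative (\<lambda>h. pr (f' h) g0 + 0))
      (at p within S)"
    by (rule has_derivative_add)
  then show ?thesis by (simp add: add_right [symmetric])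
qed

lemmas has_derivative_vanishing_compose_left =
  has_derivative_vanishing_bilinear [OF bounded_bilinear_blinfun_compose]

lemmas has_derivative_vanishing_compose_right =
  has_derivative_vanishing_bilinear
    [OF bounded_bilinear.flip [OF bounded_bilinear_blinfun_compose]]

text \<open>In the exact formula \<open>B r = B r0 + B r (A r0 - A r) B r0\<close> the middle factor
  vanishes at \<open>r0\<close>, so continuity of \<open>B\<close> alone yields its
  derivative.\<close>

lemma inverse_has_vector_derivative:
  fixes A B :: "real \<Rightarrow> 'a::complex_hilbert operator"
  assumes inv: "\<And>r. r \<in> T \<Longrightarrow> is_inverse_op (A r) (B r)" and r0: "r0 \<in> T"
    and A: "(A has_vector_derivative A') (at r0 within T)"
  shows "(B has_vector_derivative - (B r0 o\<^sub>L A' o\<^sub>L B r0)) (at r0 within T)"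
proof -
  let ?F = "at r0 within T"
  have "(A \<longlongrightarrow> A r0) ?F"
    using has_vector_derivative_continuous [OF A] by (simp add: continuous_within)
  then have B: "(B \<longlongrightarrow> B r0) ?F"
    by (rule inverse_tendsto [OF _ inv [OF r0], rotated]) (simp add: eventually_at_filter inv)
  have "((\<lambda>r. A r0 - A r) has_derivative (\<lambda>k. 0 - k *\<^sub>R A')) ?F"
    using A by (intro has_derivative_diff has_derivative_const)
        (simp add: has_vector_derivative_def)
  then have "((\<lambda>r. B r o\<^sub>L (A r0 - A r)) has_derivative (\<lambda>k. B r0 o\<^sub>L (0 - k *\<^sub>R A'))) ?F"
    by (rule has_derivative_vanishing_compose_right) (auto intro: B)
  then have "((\<lambda>r. B r0 + (B r o\<^sub>L (A r0 - A r) o\<^sub>L B r0)) has_derivative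
      (\<lambda>k. 0 + (B r0 o\<^sub>L (0 - k *\<^sub>R A') o\<^sub>L B r0))) ?F"
    by (intro has_derivative_add has_derivative_const bounded_linear.has_derivative
        [OF bounded_bilinear.bounded_linear_left [OF bounded_bilinear_blinfun_compose]])
  moreover have "B r0 o\<^sub>L (0 - k *\<^sub>R A') o\<^sub>L B r0 = k *\<^sub>R (- (B r0 o\<^sub>L A' o\<^sub>L B r0))" for k
    by (simp only: diff_0 compose_distribs scaleR_minus_right)
  ultimately have "((\<lambda>r. B r0 + (B r o\<^sub>L (A r0 - A r) o\<^sub>L B r0)) has_derivative
      (\<lambda>k. k *\<^sub>R (- (B r0 o\<^sub>L A' o\<^sub>L B r0)))) ?F"
    by (simp only: add_0_left)
  then show ?thesis
    unfolding has_vector_derivative_def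
  proof (rule has_derivative_transform_within [OF _ zero_less_one r0])
    fix r assume "r \<in> T"
    from inverse_difference [OF inv [OF this] inv [OF r0]]
    show "B r0 + (B r o\<^sub>L (A r0 - A r) o\<^sub>L B r0) = B r" by (simp add: algebra_simps)
  qed
qed

section \<open>The resolvent\<close>

abbreviation resolvent :: "'a::complex_hilbert operator \<Rightarrow> complex \<Rightarrow> 'a operator" where
  "resolvent A z \<equiv> inverse_op (A - z *\<^sub>O id_blinfun)"

lemma is_inverse_op_resolvent:
  "z \<notin> op_spectrum A \<Longrightarrow> is_inverse_op (A - z *\<^sub>O id_blinfun) (resolvent A z)"
  by (auto simp: op_spectrum_def intro: is_inverse_op_inverse_op)

lemma open_resolvent_set:
  fixes A :: "'a::complex_hilbert operator"
  shows "open (- op_spectrum A)"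
  unfolding open_dist
proof (intro ballI)
  fix z assume "z \<in> - op_spectrum A"
  then have inv: "is_inverse_op (A - z *\<^sub>O id_blinfun) (resolvent A z)"
    by (simp add: is_inverse_op_resolvent)
  \<comment> \<open>The added 1 gives a positive radius even if the resolvent is 0, as on the zero
    space, and makes the final inequality strict.\<close>
  let ?m = "norm (resolvent A z) + 1"
  have m: "?m > 0" by (simp add: add_nonneg_pos)
  show "\<exists>e>0. \<forall>w. dist w z < e \<longrightarrow> w \<in> - op_spectrum A"
  proof (intro exI [of _ "1 / ?m"] conjI allI impI)
    fix w assume w: "dist w z < 1 / ?m"
    have "norm ((w - z) *\<^sub>O (id_blinfun :: 'a operator)) \<le> cmod (w - z) * 1"
      unfolding norm_scale_op by (intro mult_left_mono norm_blinfun_id_le) simp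
    then have "norm ((w - z) *\<^sub>O (id_blinfun :: 'a operator)) * norm (resolvent A z) \<le>
        (1 / ?m) * norm (resolvent A z)"
      using w by (intro mult_right_mono) (auto simp: dist_norm)
    also have "\<dots> < 1" using m by (simp add: field_simps)
    finally obtain B' where "is_inverse_op (A - z *\<^sub>O id_blinfun - (w - z) *\<^sub>O id_blinfun) B'"
      using is_inverse_op_perturb [OF inv] by blast
    then show "w \<in> - op_spectrum A"
      by (auto simp: op_spectrum_def scale_op_simps)
  qed (use m in auto)
qed

lemma resolvent_identity:
  assumes "complex_linear_op A" "z \<notin> op_spectrum A" "w \<notin> op_spectrum A"
  shows "resolvent A w - resolvent A z = (w - z) *\<^sub>O (resolvent A w o\<^sub>L resolvent A z)"
proof -
  have iw: "is_inverse_op (A - w *\<^sub>O id_blinfun) (resolvent A w)"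
    by (rule is_inverse_op_resolvent) fact
  have lin: "complex_linear_op (resolvent A w)"
    by (rule is_inverse_op_complex_linear [OF iw]) (intro complex_linear_op_intros assms)
  show ?thesis
    unfolding inverse_difference [OF iw is_inverse_op_resolvent [OF assms(2)]]
    by (simp add: op_simps compose_scale_op_right [OF lin])
qed

lemma resolvent_tendsto:
  assumes "z \<notin> op_spectrum A"
  shows "(resolvent A \<longlongrightarrow> resolvent A z) (at z)"
proof (rule inverse_tendsto)
  show "\<forall>\<^sub>F w in at z. is_inverse_op (A - w *\<^sub>O id_blinfun) (resolvent A w)"
    using eventually_at_in_open' [OF open_resolvent_set [of A], of z] assms
    by (auto elim!: eventually_mono intro: is_inverse_op_resolvent)
  show "is_inverse_op (A - z *\<^sub>O id_blinfun) (resolvent A z)"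
    by (rule is_inverse_op_resolvent) fact
  show "((\<lambda>w. A - w *\<^sub>O id_blinfun) \<longlongrightarrow> A - z *\<^sub>O id_blinfun) (at z)"
    by (intro tendsto_intros bounded_bilinear.tendsto [OF bounded_bilinear_scale_op])
qed

lemma continuous_on_resolvent: "continuous_on (- op_spectrum A) (resolvent A)"
  by (rule continuous_at_imp_continuous_on) (auto simp: continuous_at intro: resolvent_tendsto)

text \<open>The resolvent identity has the vanishing factor \<open>w - z\<close>, so continuity of
  the resolvent suffices. The derivative multiplies by a complex scalar; this makes the matrix
  elements holomorphic.\<close>

lemma resolvent_has_derivative:
  assumes "complex_linear_op A" "z \<notin> op_spectrum A"
  shows "(resolvent A has_derivative (\<lambda>h. h *\<^sub>O (resolvent A z o\<^sub>L resolvent A z))) (at z)"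
proof -
  have "((\<lambda>w. (w - z) *\<^sub>O (resolvent A w o\<^sub>L resolvent A z)) has_derivative
      (\<lambda>h. h *\<^sub>O (resolvent A z o\<^sub>L resolvent A z))) (at z)"
    by (rule has_derivative_vanishing_bilinear [OF bounded_bilinear_scale_op])
      (auto intro!: derivative_eq_intros tendsto_compose_op resolvent_tendsto assms)
  then have "((\<lambda>w. resolvent A z + (w - z) *\<^sub>O (resolvent A w o\<^sub>L resolvent A z)) has_derivative
      (\<lambda>h. 0 + h *\<^sub>O (resolvent A z o\<^sub>L resolvent A z))) (at z)"
    by (intro has_derivative_add has_derivative_const)
  then have "((\<lambda>w. resolvent A z + (w - z) *\<^sub>O (resolvent A w o\<^sub>L resolvent A z)) has_derivative
      (\<lambda>h. h *\<^sub>O (resolvent A z o\<^sub>L resolvent A z))) (at z)"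
    by simp
  then show ?thesis
  proof (rule has_derivative_transform_within_open [OF _ open_resolvent_set [of A]])
    show "z \<in> - op_spectrum A" using assms by simp
    show "resolvent A z + (w - z) *\<^sub>O (resolvent A w o\<^sub>L resolvent A z) = resolvent A w"
      if "w \<in> - op_spectrum A" for w
      using resolvent_identity [OF assms(1,2), of w] that by (simp add: algebra_simps)
  qed
qed

text \<open>Operators form a real Banach space here, so compatibility with complex multiples is
  demanded separately. These functionals transfer scalar complex analysis to operator-valued
  functions.\<close>

definition complex_functional :: "('a::complex_hilbert operator \<Rightarrow> complex) \<Rightarrow> bool" where
  "complex_functional l \<longleftrightarrow> bounded_linear l \<and> (\<forall>c A. l (c *\<^sub>O A) = c * l A)"

lemma complex_functional_matrix_element:
  "complex_functional (\<lambda>B. cinner y (blinfun_apply B x))"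
  "complex_linear_op C \<Longrightarrow> complex_functional (\<lambda>B. cinner y ((C o\<^sub>L B) x))"
  "complex_functional (\<lambda>B. cinner y ((B o\<^sub>L C) x))"
proof -
  have *: "bounded_linear (\<lambda>B. cinner y (blinfun_apply B x))" for x y :: 'a
    by (rule bounded_linear_compose [OF bounded_bilinear.bounded_linear_right
        [OF bounded_bilinear_cinner]])
      (rule blinfun.bounded_linear_left)
  show "complex_functional (\<lambda>B. cinner y (blinfun_apply B x))"
    using * by (simp add: complex_functional_def cinner_scaleC_right)
  show "complex_functional (\<lambda>B. cinner y ((B o\<^sub>L C) x))"
    using * by (simp add: complex_functional_def cinner_scaleC_right)
  have "bounded_linear (\<lambda>B. cinner y ((C o\<^sub>L B) x))"
    by (rule bounded_linear_compose [OF *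
          bounded_bilinear.bounded_linear_right [OF bounded_bilinear_blinfun_compose]])
  then show "complex_linear_op C \<Longrightarrow> complex_functional (\<lambda>B. cinner y ((C o\<^sub>L B) x))"
    by (simp add: complex_functional_def cinner_scaleC_right compose_scale_op_right
        del: blinfun_apply_blinfun_compose)
qed

lemma complex_functional_has_field_derivative:
  assumes "complex_functional l" "(F has_derivative (\<lambda>h. h *\<^sub>O D)) (at z)"
  shows "((\<lambda>z. l (F z)) has_field_derivative l D) (at z)"
  unfolding has_field_derivative_def
proof -
  have "((\<lambda>z. l (F z)) has_derivative (\<lambda>h. l (h *\<^sub>O D))) (at z)"
    by (rule bounded_linear.has_derivative [OF _ assms(2)])
      (use assms(1) in \<open>simp add: complex_functional_def\<close>)
  moreover have "(\<lambda>h. l (h *\<^sub>O D)) = (*) (l D)"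
    using assms(1) by (auto simp: complex_functional_def mult.commute)
  ultimately show "((\<lambda>z. l (F z)) has_derivative (*) (l D)) (at z)" by simp
qed

lemma resolvent_holomorphic:
  assumes "complex_linear_op A" "complex_functional l"
  shows "(\<lambda>z. l (resolvent A z)) holomorphic_on (- op_spectrum A)"
  unfolding holomorphic_on_open [OF open_resolvent_set]
  using complex_functional_has_field_derivative [OF assms(2) resolvent_has_derivative [OF assms(1)]]
  by auto

section \<open>Contour integrals of operator-valued functions\<close>

text \<open>The primitive is the integral of \<open>F\<close> along the segment from the centre to
  \<open>z\<close>. Differentiating under the integral gives the integrand \<open>M z u\<close>,
  which is at the same time the \<open>u\<close>-derivative of \<open>u F(p z u)\<close> and
  therefore integrates to \<open>F z\<close>.\<close>

lemma operator_primitive_on_ball: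
  fixes F F' :: "complex \<Rightarrow> 'a::complex_hilbert operator"
  assumes F: "\<And>z. z \<in> ball c r \<Longrightarrow> (F has_derivative (\<lambda>h. h *\<^sub>O F' z)) (at z)"
    and F': "continuous_on (ball c r) F'"
  shows "\<exists>\<Phi>. \<forall>z\<in>ball c r. (\<Phi> has_derivative (\<lambda>h. h *\<^sub>O F z)) (at z)"
proof -
  \<comment> \<open>\<open>?L B\<close> is the map \<open>h \<mapsto> h *\<^sub>O B\<close> as a
    bounded linear function, the form in which the Leibniz rule expects derivatives.\<close>
  let ?L = "bounded_bilinear.prod_left (scale_op :: complex \<Rightarrow> 'a operator \<Rightarrow> 'a operator)"
  have L: "blinfun_apply (?L B) h = h *\<^sub>O B" for B h
    by (rule bounded_bilinear.prod_left.rep_eq [OF bounded_bilinear_scale_op, THEN fun_cong])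
  have blL: "bounded_linear ?L"
    by (rule bounded_bilinear.bounded_linear_prod_left [OF bounded_bilinear_scale_op])
  define p where "p z u = c + complex_of_real u * (z - c)" for z u
  define \<Phi> where "\<Phi> z = integral (cbox 0 1) (\<lambda>u. (z - c) *\<^sub>O F (p z u))" for z
  define M where "M z u = F (p z u) + (of_real u * (z - c)) *\<^sub>O F' (p z u)" for z u
  have p_in: "p z u \<in> ball c r" if "z \<in> ball c r" "u \<in> {0..1}" for z u
  proof -
    have "dist c (p z u) = u * dist c z"
      using that by (simp add: p_def dist_norm norm_mult norm_minus_commute)
    also have "\<dots> \<le> 1 * dist c z" using that by (intro mult_right_mono) auto
    finally show ?thesis using that by simp
  qed
  have contF: "continuous_on (ball c r) F"
    by (rule has_derivative_continuous_on) (blast intro: has_derivative_at_withinI F)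
  have cp: "continuous_on S (\<lambda>q. p (fst q) (snd q))" for S
    unfolding p_def by (intro continuous_intros)
  have comp: "continuous_on (ball c r \<times> {0..1}) (\<lambda>q. G (p (fst q) (snd q)))"
    if "continuous_on (ball c r) G" for G :: "complex \<Rightarrow> 'a operator"
    by (rule continuous_on_compose2 [OF that cp]) (use p_in in auto)
  have contM: "continuous_on (ball c r \<times> {0..1}) (\<lambda>q. M (fst q) (snd q))"
    unfolding M_def by (intro continuous_intros comp contF F')
  have intM: "(M z has_integral F z) {0..1}" if z: "z \<in> ball c r" for z
  proof -
    have "((\<lambda>u. u *\<^sub>R F (p z u)) has_vector_derivative M z u) (at u within {0..1})"
      if u: "u \<in> {0..1}" for u
    proof -
      have "(p z has_derivative (\<lambda>h. of_real h * (z - c))) (at u within {0..1})"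
        unfolding p_def by (auto intro!: derivative_eq_intros)
      then have "((\<lambda>u. F (p z u)) has_derivative (\<lambda>h. (of_real h * (z - c)) *\<^sub>O F' (p z u)))
          (at u within {0..1})"
        by (rule has_derivative_compose) (rule F [OF p_in [OF z u]])
      then have "((\<lambda>u. F (p z u)) has_vector_derivative (z - c) *\<^sub>O F' (p z u))
          (at u within {0..1})"
        by (simp add: has_vector_derivative_def scale_op_of_real [symmetric] scale_op_scale_op)
      then have "((\<lambda>u. u *\<^sub>R F (p z u)) has_vector_derivative
          u *\<^sub>R ((z - c) *\<^sub>O F' (p z u)) + 1 *\<^sub>R F (p z u)) (at u within {0..1})"
        by (intro has_vector_derivative_scaleR) (auto intro!: derivative_eq_intros)
      then show ?thesis
        by (simp add: M_def scale_op_of_real [symmetric] scale_op_scale_op add.commute)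
    qed
    then have "(M z has_integral (1 *\<^sub>R F (p z 1) - 0 *\<^sub>R F (p z 0))) {0..1}"
      by (intro fundamental_theorem_of_calculus) auto
    then show ?thesis by (simp add: p_def)
  qed
  have "(\<Phi> has_derivative (\<lambda>h. h *\<^sub>O F z)) (at z)" if z: "z \<in> ball c r" for z
  proof -
    have "(\<Phi> has_derivative integral (cbox 0 1) (\<lambda>u. ?L (M z u))) (at z within ball c r)"
      unfolding \<Phi>_def
    proof (rule leibniz_rule)
      fix z u assume zu: "z \<in> ball c r" "u \<in> cbox 0 (1 :: real)"
      have "((\<lambda>z. p z u) has_derivative (\<lambda>h. of_real u * h)) (at z)"
        unfolding p_def by (auto intro!: derivative_eq_intros)
      then have "((\<lambda>z. F (p z u)) has_derivative (\<lambda>h. (of_real u * h) *\<^sub>O F' (p z u))) (at z)"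
        by (rule has_derivative_compose) (rule F, use p_in zu in auto)
      then have "((\<lambda>z. (z - c) *\<^sub>O F (p z u)) has_derivative
          (\<lambda>h. (z - c) *\<^sub>O ((of_real u * h) *\<^sub>O F' (p z u)) + (h - 0) *\<^sub>O F (p z u))) (at z)"
        by (intro bounded_bilinear.FDERIV [OF bounded_bilinear_scale_op] derivative_intros)
      moreover have "(\<lambda>h. (z - c) *\<^sub>O ((of_real u * h) *\<^sub>O F' (p z u)) + (h - 0) *\<^sub>O F (p z u)) =
          ?L (M z u)"
        by (rule ext) (simp add: L M_def scale_op_simps scale_op_scale_op mult_ac)
      ultimately show "((\<lambda>z. (z - c) *\<^sub>O F (p z u)) has_derivative ?L (M z u))
          (at z within ball c r)"
        by (simp add: has_derivative_at_withinI)
    next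
      fix z assume z: "z \<in> ball c r"
      have "continuous_on {0..1} (\<lambda>u. F (p z u))"
        by (rule continuous_on_compose2 [OF contF])
            (use p_in z in \<open>auto simp: p_def intro!: continuous_intros\<close>)
      then show "(\<lambda>u. (z - c) *\<^sub>O F (p z u)) integrable_on cbox 0 1"
        by (intro integrable_continuous) (auto intro!: continuous_intros)
    next
      show "continuous_on (ball c r \<times> cbox 0 1) (\<lambda>(z, u). ?L (M z u))"
        using bounded_linear.continuous_on [OF blL contM] by (simp add: case_prod_beta')
    qed (use z in auto)
    moreover have "integral (cbox 0 1) (\<lambda>u. ?L (M z u)) = ?L (F z)"
      using has_integral_linear [OF intM [OF z] blL] by (simp add: o_def integral_unique)
    moreover have "blinfun_apply (?L (F z)) = (\<lambda>h. h *\<^sub>O F z)" by (rule ext) (rule L)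
    ultimately have "(\<Phi> has_derivative (\<lambda>h. h *\<^sub>O F z)) (at z within ball c r)" by (simp only:)
    then show ?thesis unfolding at_within_open [OF z open_ball] .
  qed
  then show ?thesis by (intro exI [of _ \<Phi>] ballI)
qed

text \<open>A valid path may have an unbounded derivative, so integrability rests on local primitives
  rather than on continuity of the integrand.\<close>

lemma operator_contour_integrable:
  fixes F F' :: "complex \<Rightarrow> 'a::complex_hilbert operator"
  assumes U: "open U" and F: "\<And>z. z \<in> U \<Longrightarrow> (F has_derivative (\<lambda>h. h *\<^sub>O F' z)) (at z)"
    and F': "continuous_on U F'" and \<gamma>: "valid_path \<gamma>" "path_image \<gamma> \<subseteq> U"
  shows "(\<lambda>x. vector_derivative \<gamma> (at x within {0..1}) *\<^sub>O F (\<gamma> x)) integrable_on {0..1}"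
proof -
  obtain K where K: "finite K" "\<gamma> C1_differentiable_on ({0..1} - K)"
      and cont: "continuous_on {0..1} \<gamma>"
    using \<gamma>(1) by (auto simp: valid_path_def piecewise_C1_differentiable_on_def)
  have vd: "(\<gamma> has_vector_derivative vector_derivative \<gamma> (at x within {0..1})) (at x)"
    if "x \<in> {0<..<1} - K" for x
  proof -
    have "\<gamma> differentiable at x"
      using K(2) that by (auto simp: C1_differentiable_on_eq)
    moreover have "at x within {0..1} = at x"
      using that by (intro at_within_interior) (simp add: interior_atLeastAtMost_real)
    ultimately show ?thesis
      by (simp add: vector_derivative_works [symmetric])
  qed
  have "(\<lambda>x. vector_derivative \<gamma> (at x within {0..1}) *\<^sub>O F (\<gamma> x)) integrable_on cbox 0 (1::real)"
  proof (rule integrable_on_little_subintervals, intro ballI)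
    fix x :: real assume x: "x \<in> cbox 0 1"
    then have "\<gamma> x \<in> U" using \<gamma>(2) by (auto simp: path_image_def)
    then obtain r where r: "r > 0" "ball (\<gamma> x) r \<subseteq> U" using U openE by blast
    have "\<exists>\<Phi>. \<forall>z\<in>ball (\<gamma> x) r. (\<Phi> has_derivative (\<lambda>h. h *\<^sub>O F z)) (at z)"
      using r(2) by (intro operator_primitive_on_ball [of _ _ F F'] F continuous_on_subset [OF F'])
          auto
    then obtain \<Phi> where \<Phi>: "\<And>z. z \<in> ball (\<gamma> x) r \<Longrightarrow> (\<Phi> has_derivative (\<lambda>h. h *\<^sub>O F z)) (at z)"
      by blast
    \<comment> \<open>On a subinterval of this length around \<open>x\<close> the path stays in the
      ball carrying the primitive \<Phi>, so the integral there is an increment of \<Phi> along the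
      path.\<close>
    obtain d where d: "d > 0" "\<And>u. u \<in> {0..1} \<Longrightarrow> dist u x < d \<Longrightarrow> dist (\<gamma> u) (\<gamma> x) < r"
      using cont x r(1) unfolding continuous_on_iff by (metis cbox_interval)
    show "\<exists>d>0. \<forall>u v. x \<in> cbox u v \<and> cbox u v \<subseteq> ball x d \<and> cbox u v \<subseteq> cbox 0 1 \<longrightarrow>
        (\<lambda>x. vector_derivative \<gamma> (at x within {0..1}) *\<^sub>O F (\<gamma> x)) integrable_on cbox u v"
    proof (intro exI [of _ d] conjI allI impI)
      fix u v assume uv: "x \<in> cbox u v \<and> cbox u v \<subseteq> ball x d \<and> cbox u v \<subseteq> cbox 0 1"
      have le: "u \<le> v" "{u..v} \<subseteq> {0..1}" using uv by auto
      then have le': "0 \<le> u" "v \<le> 1" by auto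
      have in_ball: "\<gamma> w \<in> ball (\<gamma> x) r" if "w \<in> {u..v}" for w
      proof -
        have "w \<in> ball x d" "w \<in> {0..1}" using uv that by auto
        then show ?thesis using d(2) [of w] by (simp add: dist_commute)
      qed
      have "((\<lambda>x. vector_derivative \<gamma> (at x within {0..1}) *\<^sub>O F (\<gamma> x)) has_integral
          (\<Phi> (\<gamma> v) - \<Phi> (\<gamma> u))) {u..v}"
      proof (rule fundamental_theorem_of_calculus_interior_strong [OF K(1) le(1)])
        fix w assume w: "w \<in> {u<..<v} - K"
        have "(\<gamma> has_derivative (\<lambda>h. h *\<^sub>R vector_derivative \<gamma> (at w within {0..1}))) (at w)"
          using vd [of w] w le' by (simp add: has_vector_derivative_def)
        then have "((\<lambda>w. \<Phi> (\<gamma> w)) has_derivative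
            (\<lambda>h. (h *\<^sub>R vector_derivative \<gamma> (at w within {0..1})) *\<^sub>O F (\<gamma> w))) (at w)"
          by (rule has_derivative_compose) (rule \<Phi>, rule in_ball, use w in auto)
        then show "((\<lambda>w. \<Phi> (\<gamma> w)) has_vector_derivative
            vector_derivative \<gamma> (at w within {0..1}) *\<^sub>O F (\<gamma> w)) (at w)"
          by (simp add: has_vector_derivative_def scale_op_simps)
      next
        have "continuous_on (ball (\<gamma> x) r) \<Phi>"
          by (rule has_derivative_continuous_on) (blast intro: has_derivative_at_withinI \<Phi>)
        then show "continuous_on {u..v} (\<lambda>w. \<Phi> (\<gamma> w))"
          by (rule continuous_on_compose2) (use in_ball cont le in \<open>auto
              intro: continuous_on_subset\<close>)
      qed
      then show "(\<lambda>x. vector_derivative \<gamma> (at x within {0..1}) *\<^sub>O F (\<gamma> x)) integrable_on cbox u v"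
        by (auto simp: integrable_on_def)
    qed (rule d)
  qed
  then show ?thesis by simp
qed

text \<open>The bridge to the scalar Cauchy theory: operator identities between contour integrals
  are checked on matrix elements.\<close>

lemma complex_functional_contour_integral_op:
  assumes l: "complex_functional l"
    and int: "(\<lambda>x. vector_derivative \<gamma> (at x within {0..1}) *\<^sub>O F (\<gamma> x)) integrable_on {0..1}"
  shows "((\<lambda>z. l (F z)) has_contour_integral l (contour_integral_op \<gamma> F)) \<gamma>"
  unfolding has_contour_integral_def contour_integral_op_def
  using has_integral_linear [OF integrable_integral [OF int], of l] l
  by (simp add: complex_functional_def o_def mult.commute)

text \<open>A circle has a continuous derivative, so continuity of the integrand is enough. This
  covers the resolvent divided by \<open>z - e\<close>, the integrand defining
  \<open>S\<close>.\<close>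

lemma operator_circlepath_integrable:
  fixes F :: "complex \<Rightarrow> 'a::complex_hilbert operator"
  assumes "0 < r" "continuous_on (sphere c r) F"
  shows "(\<lambda>x. vector_derivative (circlepath c r)
      (at x within {0..1}) *\<^sub>O F (circlepath c r x)) integrable_on {0..1}"
proof -
  have "continuous_on {0..1} (\<lambda>x. F (circlepath c r x))"
    by (rule continuous_on_compose2 [OF assms(2)])
      (use assms(1) in \<open>auto simp: circlepath dist_norm norm_mult intro!: continuous_intros\<close>)
  then have "continuous_on {0..1} (\<lambda>x. (2 * pi * \<i> * r * exp (2 * of_real pi * \<i> * x))
      *\<^sub>O F (circlepath c r x))"
    by (intro continuous_intros)
  then have "(\<lambda>x. (2 * pi * \<i> * r * exp (2 * of_real pi * \<i> * x)) *\<^sub>O F (circlepath c r x))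
      integrable_on {0..1}"
    by (rule integrable_continuous_interval)
  then show ?thesis
    by (rule integrable_eq) (simp add: vector_derivative_circlepath01)
qed

section \<open>Isolated points of the spectrum\<close>

lemma selfadjoint_Im_quadratic_form:
  assumes "selfadjoint_op A"
  shows "Im (cinner u (blinfun_apply A u)) = 0"
proof -
  have "cinner u (A u) = cnj (cinner u (A u))"
    using assms unfolding selfadjoint_op_def by (metis cinner_commute)
  then show ?thesis by (metis Reals_cnj_iff complex_is_Real_iff)
qed

text \<open>For \<open>x = (A - z) u\<close> the number \<open>cinner u (A u)\<close> is real, so
  the imaginary part of \<open>cinner u x\<close> is \<open>- Im z * (norm u)\<^sup>2\<close>;
  Cauchy-Schwarz finishes.\<close>

lemma resolvent_norm_bound:
  assumes A: "selfadjoint_op A" and z: "z \<notin> op_spectrum A"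
  shows "\<bar>Im z\<bar> * norm (resolvent A z) \<le> 1"
proof (cases "Im z = 0")
  case False
  have "norm (resolvent A z) \<le> 1 / \<bar>Im z\<bar>"
  proof (rule norm_blinfun_bound)
    fix x
    define u where "u = resolvent A z x"
    have "((A - z *\<^sub>O id_blinfun) o\<^sub>L resolvent A z) x = x"
      using is_inverse_op_resolvent [OF z] by (simp add: is_inverse_op_def)
    then have x: "x = A u - z *\<^sub>C u" by (simp add: u_def blinfun.bilinear_simps)
    have "Im (cinner u x) = - Im z * (norm u)\<^sup>2"
      using selfadjoint_Im_quadratic_form [OF A, of u]
      by (simp add: x cinner_diff_right cinner_scaleC_right cinner_self del: of_real_power)
    then have "\<bar>Im z\<bar> * (norm u)\<^sup>2 = \<bar>Im (cinner u x)\<bar>" by (simp add: abs_mult)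
    also have "\<dots> \<le> norm u * norm x"
      using abs_Im_le_cmod cinner_Cauchy_Schwarz order_trans by blast
    finally have "norm u * (\<bar>Im z\<bar> * norm u) \<le> norm u * norm x"
      by (simp add: power2_eq_square mult_ac)
    then have "\<bar>Im z\<bar> * norm u \<le> norm x"
      by (metis mult_left_le_imp_le norm_ge_zero less_eq_real_def mult_zero_right)
    then show "norm (resolvent A z x) \<le> 1 / \<bar>Im z\<bar> * norm x"
      using False by (simp add: u_def field_simps)
  qed simp
  then show ?thesis using False by (simp add: field_simps)
qed simp

text \<open>On the circle of radius \<open>r\<close> about the real point \<open>e\<close> one has
  \<open>|(z - e)\<^sup>2 - r\<^sup>2| = 2 r |Im z|\<close>, which compensates the growth of \<open>f\<close> near the real axis. The
  Laurent coefficients \<open>c\<^sub>-\<^sub>2\<close> and \<open>c\<^sub>0\<close> of \<open>f\<close> thus satisfy \<open>|c\<^sub>-\<^sub>2 - r\<^sup>2 c\<^sub>0| \<le> 2 C r\<close>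
  for all \<open>r < g\<close>.\<close>

lemma Laurent_coefficients_bound:
  fixes f :: "complex \<Rightarrow> complex" and e g C :: real
  assumes hol: "f holomorphic_on ball e g - {complex_of_real e}"
    and bound: "\<And>z. z \<in> ball e g - {complex_of_real e} \<Longrightarrow> \<bar>Im z\<bar> * cmod (f z) \<le> C"
    and r: "0 < r" "r < g"
  shows "((\<lambda>z. (z - e) * f z) has_contour_integral 0) (circlepath e r)"
    and "cmod (contour_integral (circlepath e r) (\<lambda>z. 1 / (z - e) * f z)) \<le> 4 * pi * C / g"
    and "(\<lambda>z. 1 / (z - e) * f z) contour_integrable_on circlepath e r"
proof -
  \<comment> \<open>\<open>c2\<close> and \<open>c0\<close> are the Laurent coefficients of
    \<open>f\<close> of orders -2 and 0, which do not depend on the radius.\<close>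
  define c2 where "c2 = residue (\<lambda>z. (z - e) * f z) e"
  define c0 where "c0 = residue (\<lambda>z. 1 / (z - e) * f z) e"
  have h2: "((\<lambda>z. (z - e) * f z) has_contour_integral 2 * pi * \<i> * c2) (circlepath e r)"
    if "0 < r" "r < g" for r
    unfolding c2_def by (rule base_residue [of "ball e g"])
      (use that in \<open>auto intro!: holomorphic_intros hol\<close>)
  have h0: "((\<lambda>z. 1 / (z - e) * f z) has_contour_integral 2 * pi * \<i> * c0) (circlepath e r)"
    if "0 < r" "r < g" for r
    unfolding c0_def by (rule base_residue [of "ball e g"])
      (use that in \<open>auto intro!: holomorphic_intros hol\<close>)
  have "0 \<le> \<bar>Im (e + r)\<bar> * cmod (f (e + r))" by simp
  also have "\<dots> \<le> C" using r bound [of "complex_of_real e + complex_of_real r"]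
    by (auto simp: dist_norm)
  finally have C: "0 \<le> C" .
  have key: "cmod (c2 - (complex_of_real r)\<^sup>2 * c0) \<le> 2 * C * r" if r: "0 < r" "r < g" for r
  proof -
    have "((\<lambda>z. (z - e) * f z - (complex_of_real r)\<^sup>2 * (1 / (z - e) * f z)) has_contour_integral
        (2 * pi * \<i> * c2 - (complex_of_real r)\<^sup>2 * (2 * pi * \<i> * c0))) (circlepath e r)"
      by (intro has_contour_integral_diff has_contour_integral_lmul h2 h0 r)
    then have "norm (2 * pi * \<i> * c2 - (complex_of_real r)\<^sup>2 * (2 * pi * \<i> * c0)) \<le>
        (2 * C) * (2 * pi * r)"
    proof (rule has_contour_integral_bound_circlepath)
      fix z assume z: "norm (z - complex_of_real e) = r"
      define w where "w = z - complex_of_real e"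
      have w: "cmod w = r" "w \<noteq> 0" "Im w = Im z" using z r by (auto simp: w_def)
      \<comment> \<open>On the circle \<open>r\<^sup>2\<close> equals
        \<open>w * cnj w\<close>.\<close>
      have "w\<^sup>2 - (complex_of_real r)\<^sup>2 = w * (w - cnj w)"
        using w(1) complex_norm_square [of w] by (simp add: algebra_simps power2_eq_square)
      also have "w - cnj w = 2 * \<i> * Im w" by (simp add: complex_eq_iff)
      finally have sq: "cmod (w\<^sup>2 - (complex_of_real r)\<^sup>2) = 2 * r * \<bar>Im w\<bar>"
        using w by (simp add: norm_mult)
      have "(z - e) * f z - (complex_of_real r)\<^sup>2 * (1 / (z - e) * f z) =
          (w\<^sup>2 - (complex_of_real r)\<^sup>2) / w * f z"
        using w(2) by (simp add: w_def [symmetric] field_simps power2_eq_square)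
      then have "norm ((z - e) * f z - (complex_of_real r)\<^sup>2 * (1 / (z - e) * f z)) =
          2 * (\<bar>Im z\<bar> * cmod (f z))"
        using w r(1) by (simp add: norm_mult norm_divide sq)
      also have "\<dots> \<le> 2 * C"
        using bound [of z] z r by (auto simp: dist_norm norm_minus_commute)
      finally show "norm ((z - e) * f z - (complex_of_real r)\<^sup>2 * (1 / (z - e) * f z)) \<le> 2 * C" .
    qed (use C r in auto)
    moreover have "2 * pi * \<i> * c2 - (complex_of_real r)\<^sup>2 * (2 * pi * \<i> * c0) =
        2 * pi * \<i> * (c2 - (complex_of_real r)\<^sup>2 * c0)"
      by (simp add: algebra_simps)
    moreover have "norm (2 * pi * \<i> * w) = 2 * pi * norm w" for w
      by (simp add: norm_mult)
    ultimately have "2 * pi * cmod (c2 - (complex_of_real r)\<^sup>2 * c0) \<le> 2 * C * (2 * pi * r)"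
      by (simp only:)
    also have "\<dots> = 2 * pi * (2 * C * r)" by simp
    finally have "2 * pi * cmod (c2 - (complex_of_real r)\<^sup>2 * c0) \<le> 2 * pi * (2 * C * r)" .
    then show ?thesis by (rule mult_left_le_imp_le) simp
  qed
  have g: "0 < g" using r by simp
  have ev: "\<forall>\<^sub>F r in at_right 0. 0 < r \<and> r < g"
    using eventually_at_right_less [of 0] eventually_at_right_field g
      by (auto simp: eventually_at_right_field)
  \<comment> \<open>The limit r to 0 of the bound \<open>key\<close> forces
    \<open>c2 = 0\<close>.\<close>
  have "((\<lambda>r. 2 * C * r - cmod (c2 - (complex_of_real r)\<^sup>2 * c0)) \<longlongrightarrow> 2 * C * 0 -
      cmod (c2 - (complex_of_real 0)\<^sup>2 * c0)) (at_right 0)"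
    by (intro tendsto_intros)
  then have "0 \<le> 2 * C * 0 - cmod (c2 - (complex_of_real 0)\<^sup>2 * c0)"
    by (rule tendsto_lowerbound) (use ev key in \<open>auto elim!: eventually_mono\<close>)
  then have c2: "c2 = 0" by simp
  show "((\<lambda>z. (z - e) * f z) has_contour_integral 0) (circlepath e r)"
    using h2 [OF r] c2 by simp
  have ev': "\<forall>\<^sub>F r in at_left g. 0 < r \<and> r < g"
    using g by (auto simp: eventually_at_left_field)
  \<comment> \<open>With \<open>c2 = 0\<close> the bound \<open>key\<close> reads
    \<open>r * cmod c0 \<le> 2 * C\<close>. Letting r tend to \<open>g\<close> gives the constant in
    the statement, up to the factor \<open>2 * pi\<close> of the residue formula.\<close>
  have "((\<lambda>r. 2 * C - r * cmod c0) \<longlongrightarrow> 2 * C - g * cmod c0) (at_left g)"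
    by (intro tendsto_intros)
  then have "0 \<le> 2 * C - g * cmod c0"
  proof (rule tendsto_lowerbound)
    show "\<forall>\<^sub>F r in at_left g. 0 \<le> 2 * C - r * cmod c0"
      using ev'
    proof eventually_elim
      case (elim r)
      then have "r * (r * cmod c0) \<le> r * (2 * C)"
        using key [of r] by (simp add: c2 norm_mult norm_power power2_eq_square mult_ac)
      then show ?case using elim by simp
    qed
  qed simp
  then have "cmod c0 \<le> 2 * C / g" using g by (simp add: field_simps)
  then have "2 * pi * cmod c0 \<le> 2 * pi * (2 * C / g)" by (intro mult_left_mono) auto
  then show "cmod (contour_integral (circlepath e r) (\<lambda>z. 1 / (z - e) * f z)) \<le> 4 * pi * C / g"
    unfolding contour_integral_unique [OF h0 [OF r]] by (simp add: norm_mult)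
  show "(\<lambda>z. 1 / (z - e) * f z) contour_integrable_on circlepath e r"
    using h0 [OF r] by (auto simp: contour_integrable_on_def)
qed

text \<open>\<open>P\<close> is the spectral projector and \<open>S\<close> the reduced resolvent of \<open>A\<close> at the isolated
  spectral value \<open>e\<close>.\<close>

definition spectral_splitting ::
    "'a::complex_hilbert operator \<Rightarrow> real \<Rightarrow> 'a operator \<Rightarrow> 'a operator \<Rightarrow> bool" where
  "spectral_splitting A e P S \<longleftrightarrow> selfadjoint_op A \<and>
     (A - e *\<^sub>R id_blinfun) o\<^sub>L P = 0 \<and> P o\<^sub>L (A - e *\<^sub>R id_blinfun) = 0 \<and>
     (A - e *\<^sub>R id_blinfun) o\<^sub>L S = id_blinfun - P \<and>
     S o\<^sub>L (A - e *\<^sub>R id_blinfun) = id_blinfun - P \<and> P o\<^sub>L S = 0 \<and> S o\<^sub>L P = 0"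

lemma selfadjoint_op_shift: "selfadjoint_op A \<Longrightarrow> selfadjoint_op (A - e *\<^sub>R id_blinfun)"
  by (simp add: selfadjoint_op_def complex_linear_op_intros blinfun.bilinear_simps cinner_diff_left
      cinner_diff_right cinner_scaleR_left cinner_scaleR_right)

text \<open>\<open>1 - P\<close> has the form \<open>A S\<close>, so \<open>P A = 0\<close> gives
  \<open>P (1 - P) = 0\<close>. Symmetry of \<open>A\<close> together with \<open>A P = 0\<close>
  makes the ranges of \<open>P\<close> and \<open>1 - P\<close> orthogonal; hence \<open>P\<close>
  is an orthogonal projection.\<close>

lemma generalized_inverse_projection:
  fixes A P S :: "'a::complex_hilbert operator"
  assumes A: "selfadjoint_op A" and AP: "A o\<^sub>L P = 0" "P o\<^sub>L A = 0"
    and AS: "A o\<^sub>L S = id_blinfun - P" "S o\<^sub>L A = id_blinfun - P"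
  shows "P o\<^sub>L P = P" and "adjoint_pair P P" and "complex_linear_op P"
    and "norm P \<le> 1" and "norm (id_blinfun - P) \<le> 1"
proof -
  have "P o\<^sub>L (id_blinfun - P) = (P o\<^sub>L A) o\<^sub>L S" by (simp only: AS(1) [symmetric] compose_assoc)
  then show PP: "P o\<^sub>L P = P" by (simp add: AP op_simps)
  have *: "cinner (P x) y = cinner (P x) (P y)" for x y
  proof -
    have "cinner (P x) ((id_blinfun - P) y) = cinner (P x) (A (S y))"
      by (simp add: AS(1) [symmetric])
    also have "\<dots> = cinner ((A o\<^sub>L P) x) (S y)"
      using A by (simp add: selfadjoint_op_def)
    finally show ?thesis by (simp add: AP blinfun.bilinear_simps cinner_diff_right)
  qed
  show adj: "adjoint_pair P P"
    unfolding adjoint_pair_def by (metis * cinner_commute)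
  show "complex_linear_op P"
    unfolding complex_linear_op_def
  proof (intro allI)
    fix c x
    have Ac: "A (c *\<^sub>C y) = c *\<^sub>C A y" for y using A
      by (simp add: selfadjoint_op_def complex_linear_op_def)
    \<comment> \<open>Decompose \<open>x = A (S x) + P x\<close>. After scaling by \<open>c\<close>
      the first part still lies in the range of \<open>A\<close>, which \<open>P\<close>
      annihilates; the second still lies in the kernel of \<open>A\<close>, where \<open>P\<close>
      is the identity because \<open>S A = 1 - P\<close>.\<close>
    have "P (c *\<^sub>C (A (S x))) = 0"
      using blinfun_apply_blinfun_compose [of P A "c *\<^sub>C S x"] by (simp add: AP Ac)
    moreover have "A (S x) = x - P x"
      using blinfun_apply_blinfun_compose [of A S x] by (simp add: AS blinfun.bilinear_simps)
    moreover have "c *\<^sub>C P x - P (c *\<^sub>C P x) = 0"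
    proof -
      have "A (c *\<^sub>C P x) = 0"
        using blinfun_apply_blinfun_compose [of A P x] by (simp add: AP Ac)
      then show ?thesis
        using blinfun_apply_blinfun_compose [of S A "c *\<^sub>C P x"]
          by (simp add: AS blinfun.bilinear_simps)
    qed
    moreover have "c *\<^sub>C x = c *\<^sub>C (x - P x) + c *\<^sub>C P x"
      by (simp add: scaleC_add_right [symmetric])
    ultimately show "P (c *\<^sub>C x) = c *\<^sub>C P x"
      by (simp add: blinfun.bilinear_simps)
  qed
  have le: "norm Q \<le> 1" if "adjoint_pair Q Q" "Q o\<^sub>L Q = Q" for Q :: "'a operator"
  proof (rule norm_blinfun_bound)
    fix x
    have "complex_of_real ((norm (Q x))\<^sup>2) = cinner x ((Q o\<^sub>L Q) x)"
      using that(1) unfolding cinner_self [symmetric] by (simp add: adjoint_pair_def)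
    then have "(norm (Q x))\<^sup>2 = cmod (cinner x (Q x))"
      unfolding that(2) by (metis abs_of_nonneg norm_of_real zero_le_power2)
    also have "\<dots> \<le> norm x * norm (Q x)" by (rule cinner_Cauchy_Schwarz)
    finally show "norm (Q x) \<le> 1 * norm x"
      by (cases "Q x = 0") (auto simp: power2_eq_square)
  qed simp
  show "norm P \<le> 1" by (rule le [OF adj PP])
  show "norm (id_blinfun - P) \<le> 1"
    by (rule le) (auto intro!: adjoint_pair_intros adj simp: op_simps PP)
qed

lemma spectral_splitting_projection:
  assumes "spectral_splitting A e P S"
  shows "P o\<^sub>L P = P" and "adjoint_pair P P" and "complex_linear_op P"
    and "norm P \<le> 1" and "norm (id_blinfun - P) \<le> 1"
  using generalized_inverse_projection [OF selfadjoint_op_shift, of A e P S] assms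
  by (auto simp: spectral_splitting_def)

text \<open>Expresses \<open>S\<close> through a genuine inverse, so that the continuity and
  differentiability results for inverses apply to it.\<close>

lemma spectral_splitting_inverse:
  assumes "spectral_splitting A e P S"
  shows "is_inverse_op (A - e *\<^sub>R id_blinfun + P) (S + P)"
proof -
  have "P o\<^sub>L P = P" by (rule spectral_splitting_projection [OF assms])
  then show ?thesis
    using assms unfolding spectral_splitting_def is_inverse_op_def
    by (simp only: bounded_bilinear.add_left [OF bounded_bilinear_blinfun_compose]
      bounded_bilinear.add_right [OF bounded_bilinear_blinfun_compose]) simp
qed

text \<open>With \<open>A' = A - e\<close> the resolvent satisfies
  \<open>A' R(z) = 1 + (z - e) R(z)\<close>. Its integral over the circle vanishes because the
  Laurent coefficient of order -2 does, which gives \<open>A' P = 0\<close>. Dividing by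
  \<open>z - e\<close> before integrating gives \<open>A' S = 1 - P\<close>.\<close>

lemma isolated_point_splitting:
  fixes A :: "'a::complex_hilbert operator"
  assumes A: "selfadjoint_op A" and g: "0 < g"
    and gap: "\<And>w. w \<in> op_spectrum A - {complex_of_real e} \<Longrightarrow> g \<le> dist (complex_of_real e) w"
  shows "\<exists>P S. spectral_splitting A e P S \<and> norm S \<le> 2 / g"
proof -
  define r where "r = g / 2"
  have r: "0 < r" "r < g" using g by (auto simp: r_def)
  have lin: "complex_linear_op A" using A by (simp add: selfadjoint_op_def)
  define A' where "A' = A - e *\<^sub>R id_blinfun"
  have A': "selfadjoint_op A'" unfolding A'_def by (rule selfadjoint_op_shift [OF A])
  then have A'_lin: "complex_linear_op A'" by (simp add: selfadjoint_op_def)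
  let ?D = "ball (complex_of_real e) g - {complex_of_real e}"
  have D: "?D \<subseteq> - op_spectrum A" using gap by fastforce
  have sph: "sphere (complex_of_real e) r \<subseteq> ?D" using r by auto
  have invA: "A' o\<^sub>L resolvent A z = id_blinfun + (z - complex_of_real e) *\<^sub>O resolvent A z"
    "resolvent A z o\<^sub>L A' = id_blinfun + (z - complex_of_real e) *\<^sub>O resolvent A z" if "z \<in> ?D"
      for z
  proof -
    have inv: "is_inverse_op (A - z *\<^sub>O id_blinfun) (resolvent A z)"
      using that D by (intro is_inverse_op_resolvent) auto
    have eq: "A' = (A - z *\<^sub>O id_blinfun) + (z - complex_of_real e) *\<^sub>O id_blinfun"
      by (simp add: A'_def scale_op_simps scale_op_of_real)
    have R: "complex_linear_op (resolvent A z)"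
      by (rule is_inverse_op_complex_linear [OF inv]) (intro complex_linear_op_intros lin)
    show "A' o\<^sub>L resolvent A z = id_blinfun + (z - complex_of_real e) *\<^sub>O resolvent A z"
      "resolvent A z o\<^sub>L A' = id_blinfun + (z - complex_of_real e) *\<^sub>O resolvent A z"
      using inv unfolding eq
      by (simp_all only: is_inverse_op_def
          bounded_bilinear.add_left [OF bounded_bilinear_blinfun_compose]
        bounded_bilinear.add_right [OF bounded_bilinear_blinfun_compose] compose_scale_op_left
        compose_scale_op_right [OF R] compose_id)
  qed
  define c where "c = circlepath (complex_of_real e) r"
  have cpath: "path_image c = sphere (complex_of_real e) r" "valid_path c"
    using r by (auto simp: c_def)
  have contR: "continuous_on (sphere (complex_of_real e) r) (resolvent A)"
    by (rule continuous_on_subset [OF continuous_on_resolvent]) (use sph D in auto)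
  have contS: "continuous_on (sphere (complex_of_real e) r)
      (\<lambda>z. (1 / (z - complex_of_real e)) *\<^sub>O resolvent A z)"
    by (intro continuous_intros contR) (use r in auto)
  define I where "I = contour_integral_op c (resolvent A)"
  define I' where "I' = contour_integral_op c (\<lambda>z. (1 / (z - complex_of_real e)) *\<^sub>O resolvent A z)"
  have I: "((\<lambda>z. l (resolvent A z)) has_contour_integral l I) c" if "complex_functional l" for l
    unfolding I_def c_def
    by (rule complex_functional_contour_integral_op [OF that operator_circlepath_integrable [OF r(1)
        contR]])
  have I': "((\<lambda>z. 1 / (z - complex_of_real e) * l (resolvent A z)) has_contour_integral l I') c"
    if "complex_functional l" for l
    using complex_functional_contour_integral_op [OF that operator_circlepath_integrable [OF r(1)
        contS]] that
    unfolding I'_def c_def by (simp add: complex_functional_def)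
  have f_hol: "(\<lambda>z. cinner y (resolvent A z x)) holomorphic_on ?D" for x y
    by (rule holomorphic_on_subset [OF resolvent_holomorphic [OF lin
        complex_functional_matrix_element(1)] D])
  have f_bound: "\<bar>Im z\<bar> * cmod (cinner y (resolvent A z x)) \<le> norm x * norm y" if "z \<in> ?D" for x y z
  proof -
    have "cmod (cinner y (resolvent A z x)) \<le> norm y * norm (resolvent A z x)"
      by (rule cinner_Cauchy_Schwarz)
    also have "\<dots> \<le> norm y * (norm (resolvent A z) * norm x)"
      by (intro mult_left_mono norm_blinfun) simp
    finally have "\<bar>Im z\<bar> * cmod (cinner y (resolvent A z x)) \<le>
        \<bar>Im z\<bar> * (norm y * (norm (resolvent A z) * norm x))"
      by (intro mult_left_mono) auto
    also have "\<dots> = (\<bar>Im z\<bar> * norm (resolvent A z)) * (norm x * norm y)" by (simp add: mult_ac)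
    also have "\<dots> \<le> 1 * (norm x * norm y)"
      using that D by (intro mult_right_mono resolvent_norm_bound A) auto
    finally show ?thesis by simp
  qed
  note Laurent = Laurent_coefficients_bound [OF f_hol f_bound r, folded c_def]
  have const0: "((\<lambda>z. k) has_contour_integral 0) c" for k
    unfolding c_def by (rule Cauchy_theorem_convex_simple [of _ UNIV])
        (auto intro!: holomorphic_intros)
  have const1: "((\<lambda>z. 1 / (z - complex_of_real e) * k) has_contour_integral
      2 * complex_of_real pi * \<i> * k) c" for k
    using Cauchy_integral_circlepath_simple [of "\<lambda>z. k" "complex_of_real e" r "complex_of_real e"] r
    by (simp add: c_def)
  \<comment> \<open>\<open>zero\<close> and \<open>one\<close> integrate the resolvent relation with
    the weights 1 and \<open>1 / (z - e)\<close>. The hypothesis \<open>lR\<close> has the same form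
    for \<open>A' R\<close> and \<open>R A'\<close>, so both orders of multiplication are
    covered.\<close>
  have zero: "l I = 0" if l: "complex_functional l"
      and lR: "\<And>z. z \<in> ?D \<Longrightarrow> l (resolvent A z) =
          cinner y x + (z - complex_of_real e) * cinner y (resolvent A z x)"
    for l x y
  proof (rule has_contour_integral_unique [OF I [OF l]])
    have "((\<lambda>z. cinner y x + (z - complex_of_real e) * cinner y (resolvent A z x))
        has_contour_integral 0 + 0) c"
      by (intro has_contour_integral_add const0 Laurent(1))
    then show "((\<lambda>z. l (resolvent A z)) has_contour_integral 0) c"
      unfolding add_0_left
    proof (rule has_contour_integral_eq)
      fix z assume "z \<in> path_image c"
      then have "z \<in> ?D" using sph cpath(1) by blast
      then show "cinner y x + (z - complex_of_real e) * cinner y (resolvent A z x) =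
          l (resolvent A z)"
        by (simp only: lR)
    qed
  qed
  have one: "l I' = 2 * complex_of_real pi * \<i> * cinner y x + cinner y (I x)"
    if l: "complex_functional l"
      and lR: "\<And>z. z \<in> ?D \<Longrightarrow> l (resolvent A z) =
          cinner y x + (z - complex_of_real e) * cinner y (resolvent A z x)"
    for l x y
  proof (rule has_contour_integral_unique [OF I' [OF l]])
    have "((\<lambda>z. 1 / (z - complex_of_real e) * cinner y x + cinner y (resolvent A z x))
        has_contour_integral
        2 * complex_of_real pi * \<i> * cinner y x + cinner y (I x)) c"
      by (intro has_contour_integral_add const1 I complex_functional_matrix_element)
    then show "((\<lambda>z. 1 / (z - complex_of_real e) * l (resolvent A z)) has_contour_integral
        2 * complex_of_real pi * \<i> * cinner y x + cinner y (I x)) c"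
    proof (rule has_contour_integral_eq)
      fix z assume "z \<in> path_image c"
      then have z: "z \<in> ?D" using sph cpath(1) by blast
      then show "1 / (z - complex_of_real e) * cinner y x + cinner y (resolvent A z x) =
          1 / (z - complex_of_real e) * l (resolvent A z)"
        by (simp add: lR [OF z] field_simps)
    qed
  qed
  have l1: "complex_functional (\<lambda>B. cinner y ((A' o\<^sub>L B) x))"
    "complex_functional (\<lambda>B. cinner y ((B o\<^sub>L A') x))" for x y
    by (intro complex_functional_matrix_element A'_lin)+
  have l1R: "cinner y ((A' o\<^sub>L resolvent A z) x) =
      cinner y x + (z - complex_of_real e) * cinner y (resolvent A z x)"
    "cinner y ((resolvent A z o\<^sub>L A') x) =
        cinner y x + (z - complex_of_real e) * cinner y (resolvent A z x)"
    if "z \<in> ?D" for x y z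
    unfolding invA [OF that]
    by (simp_all add: blinfun.bilinear_simps cinner_add_right cinner_scaleC_right)
  define k where "k = 1 / (2 * complex_of_real pi * \<i>)"
  have k: "k * (2 * complex_of_real pi * \<i>) = 1" by (simp add: k_def)
  define P where "P = (- k) *\<^sub>O I"
  define S where "S = k *\<^sub>O I'"
  have AP: "A' o\<^sub>L P = 0" "P o\<^sub>L A' = 0"
    using zero [OF l1(1) l1R(1)] zero [OF l1(2) l1R(2)]
    by (auto intro!: operator_eqI simp: P_def compose_scale_op_left
        compose_scale_op_right [OF A'_lin]
        cinner_scaleC_right)
  have AS: "A' o\<^sub>L S = id_blinfun - P" "S o\<^sub>L A' = id_blinfun - P"
    using one [OF l1(1) l1R(1)] one [OF l1(2) l1R(2)] k
    by (auto intro!: operator_eqI simp: S_def P_def compose_scale_op_left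
        compose_scale_op_right [OF A'_lin]
        cinner_scaleC_right blinfun.bilinear_simps cinner_diff_right scale_op_simps cinner_add_right
        distrib_left mult.assoc [symmetric] cinner_minus_right)
  \<comment> \<open>The coefficient bound \<open>4 * pi / g\<close> divided by the
    \<open>2 * pi\<close> in \<open>k\<close>.\<close>
  have nS: "norm S \<le> 2 / g"
  proof (rule operator_norm_leI)
    fix x y
    have "cinner y (I' x) = contour_integral c (\<lambda>z. 1 / (z - complex_of_real e) *
        cinner y (resolvent A z x))"
      by (rule contour_integral_unique [symmetric], rule I', rule complex_functional_matrix_element)
    then have "cmod (cinner y (I' x)) \<le> 4 * pi * (norm x * norm y) / g"
      using Laurent(2) by simp
    then show "cmod (cinner y (S x)) \<le> 2 / g * norm x * norm y"
      by (simp add: S_def cinner_scaleC_right norm_mult k_def norm_divide field_simps)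
  qed (use g in simp)
  note Pr = generalized_inverse_projection [OF A' AP AS]
  define Q where "Q = id_blinfun - P"
  have Q: "Q o\<^sub>L Q = Q" "A' o\<^sub>L Q = A'" "Q o\<^sub>L A' = A'" "P o\<^sub>L Q = 0" "Q o\<^sub>L P = 0" "norm Q \<le> 1"
    using Pr AP by (auto simp: Q_def op_simps)
  \<comment> \<open>Compressing by \<open>Q\<close> enforces \<open>P S' = S' P = 0\<close>. The
    relations with \<open>A'\<close> survive since \<open>A' Q = Q A' = A'\<close>, and the norm
    does not grow.\<close>
  define S' where "S' = Q o\<^sub>L S o\<^sub>L Q"
  have "A' o\<^sub>L S' = ((A' o\<^sub>L Q) o\<^sub>L S) o\<^sub>L Q" "S' o\<^sub>L A' = Q o\<^sub>L (S o\<^sub>L (Q o\<^sub>L A'))"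
    "P o\<^sub>L S' = ((P o\<^sub>L Q) o\<^sub>L S) o\<^sub>L Q" "S' o\<^sub>L P = Q o\<^sub>L (S o\<^sub>L (Q o\<^sub>L P))"
    by (simp_all only: S'_def compose_assoc)
  then have "spectral_splitting A e P S'"
    using A AP AS Q by (simp add: spectral_splitting_def A'_def [symmetric])
        (simp add: Q_def [symmetric] Q)
  moreover have "norm S' \<le> 1 * (2 / g) * 1"
    unfolding S'_def by (intro norm_compose_le Q nS)
  ultimately show ?thesis by auto
qed

text \<open>The regular part \<open>R(z) (1 - P)\<close> of the resolvent extends over \<open>e\<close> as the resolvent of
  \<open>A + P\<close>, so only the principal part contributes to the integral over an arbitrary loop.\<close>

lemma spectral_projector_eq:
  fixes A :: "'a::complex_hilbert operator"
  assumes split: "spectral_splitting A e P S" and e: "complex_of_real e \<in> op_spectrum A"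
    and g: "0 < g"
    and gap: "\<And>w. w \<in> op_spectrum A - {complex_of_real e} \<Longrightarrow> g \<le> dist (complex_of_real e) w"
    and \<gamma>: "encircles \<gamma> {complex_of_real e} (op_spectrum A - {complex_of_real e})"
  shows "spectral_projector A {complex_of_real e} = P"
proof -
  \<comment> \<open>The loop selected by the definition of the projector; nothing is known of it
    beyond the winding conditions.\<close>
  define \<gamma>' where "\<gamma>' = (SOME \<gamma>. encircles \<gamma> {complex_of_real e}
      (op_spectrum A - {complex_of_real e}))"
  have "encircles \<gamma>' {complex_of_real e} (op_spectrum A - {complex_of_real e})"
    unfolding \<gamma>'_def by (rule someI [of _ \<gamma>]) (rule \<gamma>)
  then have vp: "valid_path \<gamma>'" and loop: "pathfinish \<gamma>' = pathstart \<gamma>'"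
    and img: "path_image \<gamma>' \<subseteq> - op_spectrum A"
    and wind1: "winding_number \<gamma>' (complex_of_real e) = 1"
    and wind0: "\<And>w. w \<in> op_spectrum A - {complex_of_real e} \<Longrightarrow> winding_number \<gamma>' w = 0"
    using e by (auto simp: encircles_def)
  have lin: "complex_linear_op A" using split
    by (simp add: spectral_splitting_def selfadjoint_op_def)
  note Pr = spectral_splitting_projection [OF split]
  define Q where "Q = id_blinfun - P"
  have PQ: "P o\<^sub>L Q = 0" "Q o\<^sub>L P = 0" using Pr by (auto simp: Q_def op_simps)
  have comm: "A o\<^sub>L P = e *\<^sub>R P" "P o\<^sub>L A = e *\<^sub>R P"
    using split by (auto simp: spectral_splitting_def op_simps)
  have AQ: "A o\<^sub>L Q = Q o\<^sub>L A" using comm by (simp add: Q_def op_simps)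
  define B where "B = A + P"
  have B_lin: "complex_linear_op B" unfolding B_def by (intro complex_linear_op_intros lin Pr)
  have eB: "complex_of_real e \<notin> op_spectrum B"
    using spectral_splitting_inverse [OF split]
    by (auto simp: op_spectrum_def B_def scale_op_of_real algebra_simps)
  \<comment> \<open>\<open>A - z\<close> and \<open>B - z\<close> agree after composition with
    \<open>Q\<close>, and \<open>Q\<close> commutes with \<open>B - z\<close>; multiplying by the
    resolvents transfers this to them.\<close>
  have RQ: "resolvent A z o\<^sub>L Q = resolvent B z o\<^sub>L Q" if "z \<notin> op_spectrum A" "z \<notin> op_spectrum B"
    for z
  proof -
    note iA = is_inverse_op_resolvent [OF that(1)] and iB = is_inverse_op_resolvent [OF that(2)]
    have "(A - z *\<^sub>O id_blinfun) o\<^sub>L Q = (B - z *\<^sub>O id_blinfun) o\<^sub>L Q"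
      using PQ by (simp add: B_def op_simps)
    also have "\<dots> = Q o\<^sub>L (B - z *\<^sub>O id_blinfun)"
      using PQ AQ Pr(3) by (simp add: B_def op_simps compose_scale_op_right complex_linear_op_intros
          Q_def)
    finally have "resolvent A z o\<^sub>L ((A - z *\<^sub>O id_blinfun) o\<^sub>L Q) o\<^sub>L resolvent B z
        = resolvent A z o\<^sub>L (Q o\<^sub>L (B - z *\<^sub>O id_blinfun)) o\<^sub>L resolvent B z" by simp
    then have "(resolvent A z o\<^sub>L (A - z *\<^sub>O id_blinfun)) o\<^sub>L (Q o\<^sub>L resolvent B z)
        = (resolvent A z o\<^sub>L Q) o\<^sub>L ((B - z *\<^sub>O id_blinfun) o\<^sub>L resolvent B z)"
      by (simp only: compose_assoc)
    then have 1: "Q o\<^sub>L resolvent B z = resolvent A z o\<^sub>L Q"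
      using iA iB by (simp add: is_inverse_op_def)
    have "(B - z *\<^sub>O id_blinfun) o\<^sub>L Q = Q o\<^sub>L (B - z *\<^sub>O id_blinfun)" by fact
    then have "resolvent B z o\<^sub>L ((B - z *\<^sub>O id_blinfun) o\<^sub>L Q) o\<^sub>L resolvent B z
        = resolvent B z o\<^sub>L (Q o\<^sub>L (B - z *\<^sub>O id_blinfun)) o\<^sub>L resolvent B z" by simp
    then have "(resolvent B z o\<^sub>L (B - z *\<^sub>O id_blinfun)) o\<^sub>L (Q o\<^sub>L resolvent B z)
        = (resolvent B z o\<^sub>L Q) o\<^sub>L ((B - z *\<^sub>O id_blinfun) o\<^sub>L resolvent B z)"
      by (simp only: compose_assoc)
    then have "Q o\<^sub>L resolvent B z = resolvent B z o\<^sub>L Q"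
      using iB by (simp add: is_inverse_op_def)
    then show ?thesis using 1 by simp
  qed
  \<comment> \<open>\<open>A\<close> acts on the range of \<open>P\<close> as the scalar
    \<open>e\<close>, so this is the whole principal part.\<close>
  have RP: "resolvent A z o\<^sub>L P = (- (1 / (z - complex_of_real e))) *\<^sub>O P" if z: "z \<notin> op_spectrum A"
    for z
  proof -
    have ze: "z \<noteq> e" using e z by auto
    have "(A - z *\<^sub>O id_blinfun) o\<^sub>L P = (e - z) *\<^sub>O P"
      by (simp add: op_simps comm scale_op_of_real)
    then have "resolvent A z o\<^sub>L ((e - z) *\<^sub>O P) = (resolvent A z o\<^sub>L (A - z *\<^sub>O id_blinfun)) o\<^sub>L P"
      by (simp only: compose_assoc)
    then have *: "resolvent A z o\<^sub>L ((e - z) *\<^sub>O P) = P"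
      using is_inverse_op_resolvent [OF z] by (simp add: is_inverse_op_def)
    have "complex_linear_op (resolvent A z)"
      by (rule is_inverse_op_complex_linear [OF is_inverse_op_resolvent [OF z]])
        (intro complex_linear_op_intros lin)
    then have "(e - z) *\<^sub>O (resolvent A z o\<^sub>L P) = P" using * by (simp add: compose_scale_op_right)
    then have "(- (1 / (z - complex_of_real e))) *\<^sub>O ((e - z) *\<^sub>O (resolvent A z o\<^sub>L P)) =
        (- (1 / (z - complex_of_real e))) *\<^sub>O P" by simp
    moreover have "(- (1 / (z - complex_of_real e))) * (e - z) = 1" using ze
      by (simp add: divide_simps)
    ultimately show ?thesis by (simp only: scale_op_scale_op scale_op_one)
  qed
  have "(\<lambda>x. vector_derivative \<gamma>' (at x within {0..1}) *\<^sub>O resolvent A (\<gamma>' x)) integrable_on {0..1}"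
  proof (rule operator_contour_integrable [OF open_resolvent_set [of A] _ _ vp img])
    show "(resolvent A has_derivative (\<lambda>h. h *\<^sub>O (resolvent A z o\<^sub>L resolvent A z))) (at z)"
      if "z \<in> - op_spectrum A" for z
      using that by (intro resolvent_has_derivative lin) simp
    show "continuous_on (- op_spectrum A) (\<lambda>z. resolvent A z o\<^sub>L resolvent A z)"
      by (intro continuous_intros continuous_on_resolvent)
  qed
  note I = complex_functional_contour_integral_op [OF complex_functional_matrix_element(1) this]
  have "cinner y (contour_integral_op \<gamma>' (resolvent A) x) =
      - (2 * complex_of_real pi * \<i>) * cinner y (P x)" for x y
  proof -
    \<comment> \<open>The matrix element of the regular part, with \<open>B\<close> supplying its
      value at the removable singularity \<open>e\<close>.\<close>
    define h where "h z = cinner y ((resolvent (if z = complex_of_real e then B else A) z o\<^sub>L Q) x)"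
      for z
    define D where "D = ball (complex_of_real e) g \<inter> - op_spectrum B"
    have D: "open D" "complex_of_real e \<in> D" "D - {complex_of_real e} \<subseteq> - op_spectrum A"
      unfolding D_def using g eB gap by (auto intro!: open_Int open_resolvent_set) fastforce
    have hA: "h z = cinner y ((resolvent A z o\<^sub>L Q) x)" if "z \<in> - op_spectrum A" for z
      using that e by (auto simp: h_def)
    have "h holomorphic_on - op_spectrum A"
      using resolvent_holomorphic [OF lin complex_functional_matrix_element(3)]
      by (rule holomorphic_transform) (simp only: hA)
    moreover have "h holomorphic_on D"
    proof (rule holomorphic_transform)
      show "(\<lambda>z. cinner y ((resolvent B z o\<^sub>L Q) x)) holomorphic_on D"
        by (rule holomorphic_on_subset [OF resolvent_holomorphic [OF B_lin
            complex_functional_matrix_element(3)]])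
          (simp add: D_def)
      show "cinner y ((resolvent B z o\<^sub>L Q) x) = h z" if "z \<in> D" for z
      proof (cases "z = complex_of_real e")
        case False
        then have "z \<notin> op_spectrum A" "z \<notin> op_spectrum B" using that D(3) by (auto simp: D_def)
        then show ?thesis using RQ [of z] False by (simp add: h_def)
      qed (simp add: h_def)
    qed
    ultimately have "h holomorphic_on (- op_spectrum A \<union> D)"
      by (intro holomorphic_on_Un open_resolvent_set D)
    \<comment> \<open>The points left out of the enlarged domain are spectral points other than
      \<open>e\<close>, around which the loop has winding number 0.\<close>
    then have "(h has_contour_integral 0) \<gamma>'"
      by (rule Cauchy_theorem_global [OF open_Un [OF open_resolvent_set D(1)] _ vp loop])
        (use D img wind0 in auto)
    moreover have "((\<lambda>z. 1 / (z - complex_of_real e)) has_contour_integral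
        2 * complex_of_real pi * \<i> * winding_number \<gamma>' (complex_of_real e)) \<gamma>'"
      using has_contour_integral_winding_number [OF vp, of "complex_of_real e"] img e by auto
    ultimately have "((\<lambda>z. h z - 1 / (z - complex_of_real e) * cinner y (P x)) has_contour_integral
        0 - 2 * complex_of_real pi * \<i> * winding_number \<gamma>' (complex_of_real e) * cinner y (P x)) \<gamma>'"
      by (intro has_contour_integral_diff has_contour_integral_rmul)
    then have "((\<lambda>z. cinner y (resolvent A z x)) has_contour_integral
        0 - 2 * complex_of_real pi * \<i> * winding_number \<gamma>' (complex_of_real e) * cinner y (P x)) \<gamma>'"
    proof (rule has_contour_integral_eq)
      fix z assume "z \<in> path_image \<gamma>'"
      then have z: "z \<in> - op_spectrum A" using img by auto
      have "resolvent A z = (resolvent A z o\<^sub>L Q) + (resolvent A z o\<^sub>L P)"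
        by (simp add: Q_def op_simps)
      then have "cinner y (resolvent A z x) =
          cinner y (((resolvent A z o\<^sub>L Q) + (resolvent A z o\<^sub>L P)) x)"
        by simp
      also have "\<dots> = h z + cinner y (((- (1 / (z - complex_of_real e))) *\<^sub>O P) x)"
        using RP [of z] z hA [OF z] by (simp add: blinfun.add_left cinner_add_right
            del: blinfun_apply_blinfun_compose)
      also have "\<dots> = h z - 1 / (z - complex_of_real e) * cinner y (P x)"
        by (simp add: cinner_scaleC_right)
      finally show "h z - 1 / (z - complex_of_real e) * cinner y (P x) = cinner y (resolvent A z x)"
        by simp
    qed
    from has_contour_integral_unique [OF I this] show ?thesis by (simp add: wind1)
  qed
  then have "cinner y (((- 1 / (2 * complex_of_real pi * \<i>)) *\<^sub>O contour_integral_op \<gamma>'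
      (resolvent A)) x) = cinner y (P x)" for x y
    by (simp add: cinner_scaleC_right)
  then have "(- 1 / (2 * complex_of_real pi * \<i>)) *\<^sub>O contour_integral_op \<gamma>' (resolvent A) = P"
    by (rule operator_eqI)
  then show ?thesis
    by (simp add: spectral_projector_def Let_def \<gamma>'_def)
qed

section \<open>Dependence of the spectral data on parameters\<close>

lemma nonzero_operator_fixed_vector:
  fixes P :: "'a::complex_hilbert operator"
  assumes "P o\<^sub>L P = P" "P \<noteq> 0"
  obtains u where "u \<noteq> 0" "blinfun_apply P u = u"
proof -
  obtain x where "P x \<noteq> 0" using assms(2) by (metis blinfun_eqI zero_blinfun.rep_eq)
  moreover have "P (P x) = P x" using assms(1) by (metis blinfun_apply_blinfun_compose)
  ultimately show ?thesis using that by blast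
qed

lemma spectral_splitting_eigenvector:
  assumes "spectral_splitting A e P S" "blinfun_apply P u = u"
  shows "blinfun_apply A u = e *\<^sub>R u"
proof -
  have "((A - e *\<^sub>R id_blinfun) o\<^sub>L P) u = 0"
    using assms(1) by (simp add: spectral_splitting_def)
  then show ?thesis by (simp add: assms(2) blinfun.bilinear_simps)
qed

text \<open>The winding number pins \<open>e q\<close> to the component of the loop containing \<open>e p\<close>; there the
  resolvent of \<open>h p\<close> is bounded away from \<open>e p\<close>, which an almost-eigenvector of \<open>h p\<close> at \<open>e q\<close>
  would contradict.\<close>

lemma eigenvalue_continuous:
  fixes h P S :: "'b::metric_space \<Rightarrow> 'a::complex_hilbert operator"
  assumes cont: "continuous_on D h"
    and split: "\<And>q. q \<in> D \<Longrightarrow> spectral_splitting (h q) (e q) (P q) (S q)"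
    and nz: "\<And>q. q \<in> D \<Longrightarrow> P q \<noteq> 0"
    and loop: "\<And>p. p \<in> D \<Longrightarrow> \<exists>N \<gamma>. open N \<and> p \<in> N \<and> (\<forall>q\<in>N \<inter> D.
      encircles \<gamma> {complex_of_real (e q)} (op_spectrum (h q) - {complex_of_real (e q)}))"
  shows "continuous_on D e"
  unfolding continuous_on_def
proof (intro ballI tendstoI)
  fix p and \<eta> :: real assume p: "p \<in> D" and \<eta>: "0 < \<eta>"
  obtain N \<gamma> where N: "open N" "p \<in> N" and enc: "\<And>q. q \<in> N \<inter> D \<Longrightarrow>
      encircles \<gamma> {complex_of_real (e q)} (op_spectrum (h q) - {complex_of_real (e q)})"
    using loop [OF p] by blast
  have \<gamma>: "path \<gamma>" "pathfinish \<gamma> = pathstart \<gamma>"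
    using enc [of p] p N by (auto simp: encircles_def valid_path_imp_path)
  define level where "level k = {z. z \<notin> path_image \<gamma> \<and> winding_number \<gamma> z = k}" for k
  have e_level: "complex_of_real (e q) \<in> level 1" if "q \<in> N \<inter> D" for q
    using enc [OF that] by (auto simp: encircles_def level_def)
  \<comment> \<open>\<open>K\<close> contains every \<open>e q\<close> that is \<eta>-far from
    \<open>e p\<close>: such a point has winding number 1 and modulus at most
    \<open>norm (h p) + 1\<close>. Taking the closure makes \<open>K\<close> compact.\<close>
  define K where "K = closure (level 1) \<inter> cball 0 (norm (h p) + 1) - ball (complex_of_real (e p)) \<eta>"
  have "compact K"
    unfolding K_def by (intro compact_diff closed_Int_compact) auto
  have K: "K \<subseteq> - op_spectrum (h p)"
  proof
    fix z assume z: "z \<in> K"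
    show "z \<in> - op_spectrum (h p)"
    proof
      assume "z \<in> op_spectrum (h p)"
      moreover have "z \<noteq> complex_of_real (e p)" using z \<eta> by (auto simp: K_def)
      \<comment> \<open>A second spectral point would have winding number 0, but the open set
        \<open>level 0\<close> does not meet the closure of \<open>level 1\<close>.\<close>
      ultimately have "z \<in> level 0"
        using enc [of p] p N by (auto simp: encircles_def level_def)
      moreover have "open (level 0)"
        unfolding level_def by (rule open_winding_number_levelsets [OF \<gamma>])
      moreover have "level 0 \<inter> level 1 = {}" by (auto simp: level_def)
      ultimately have "z \<notin> closure (level 1)"
        by (metis disjoint_iff open_Int_closure_eq_empty)
      then show False using z by (simp add: K_def)
    qed
  qed
  then have "compact (resolvent (h p) ` K)"
    by (rule compact_continuous_image [OF continuous_on_subset [OF continuous_on_resolvent] \<open>compact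
        K\<close>])
  then obtain B where B: "0 < B" "\<And>z. z \<in> K \<Longrightarrow> norm (resolvent (h p) z) \<le> B"
    by (auto dest!: compact_imp_bounded simp: bounded_pos)
  have lim: "(h \<longlongrightarrow> h p) (at p within D)" using cont p by (simp add: continuous_on_def)
  have "\<forall>\<^sub>F q in at p within D. q \<in> N"
    using N by (auto simp: eventually_at_topological)
  moreover have "\<forall>\<^sub>F q in at p within D. q \<in> D" by (simp add: eventually_at_filter)
  \<comment> \<open>The bound 1 keeps \<open>e q\<close> in the ball used for \<open>K\<close>; the
    bound \<open>1 / B\<close> makes the final estimate \<open>norm u < norm u\<close>
    contradictory.\<close>
  moreover have "\<forall>\<^sub>F q in at p within D. dist (h q) (h p) < min 1 (1 / B)"
    by (rule tendstoD [OF lim]) (use B in simp)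
  ultimately show "\<forall>\<^sub>F q in at p within D. dist (e q) (e p) < \<eta>"
  proof eventually_elim
    case (elim q)
    then have q: "q \<in> N \<inter> D" "q \<in> D" by auto
    have Pq: "P q o\<^sub>L P q = P q" by (rule spectral_splitting_projection [OF split [OF q(2)]])
    obtain u where u: "u \<noteq> 0" "P q u = u"
      by (rule nonzero_operator_fixed_vector [OF Pq nz [OF q(2)]])
    have hu: "h q u = e q *\<^sub>R u"
      by (rule spectral_splitting_eigenvector [OF split [OF q(2)] u(2)])
    show ?case
    proof (rule ccontr)
      assume far: "\<not> dist (e q) (e p) < \<eta>"
      have "\<bar>e q\<bar> * norm u \<le> norm (h q) * norm u"
        using norm_blinfun [of "h q" u] by (simp add: hu)
      then have "\<bar>e q\<bar> \<le> norm (h q)" using u by simp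
      also have "\<dots> \<le> norm (h p) + 1"
        using elim(3) norm_triangle_ineq2 [of "h q" "h p"] by (simp add: dist_norm)
      finally have "complex_of_real (e q) \<in> K"
        using far e_level [OF q(1)] closure_subset [of "level 1"]
        by (auto simp: K_def dist_commute)
      then have inv: "is_inverse_op (h p - complex_of_real (e q) *\<^sub>O id_blinfun)
          (resolvent (h p) (e q))"
        and nB: "norm (resolvent (h p) (complex_of_real (e q))) \<le> B"
        using K B by (auto intro!: is_inverse_op_resolvent)
      have "u = (resolvent (h p) (e q) o\<^sub>L (h p - complex_of_real (e q) *\<^sub>O id_blinfun)) u"
        using inv by (simp add: is_inverse_op_def)
      also have "\<dots> = resolvent (h p) (e q) ((h p - h q) u)"
        by (simp add: blinfun.bilinear_simps hu scaleC_of_real)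
      finally have "norm u \<le> norm (resolvent (h p) (complex_of_real (e q))) * norm ((h p - h q) u)"
        by (metis norm_blinfun)
      also have "\<dots> \<le> B * (norm (h p - h q) * norm u)"
        using B by (intro mult_mono nB norm_blinfun) auto
      also have "\<dots> = (B * dist (h q) (h p)) * norm u" by (simp add: dist_norm norm_minus_commute)
      also have "\<dots> < 1 * norm u"
        using elim(3) B u by (intro mult_strict_right_mono) (auto simp: field_simps)
      finally show False by simp
    qed
  qed
qed

text \<open>Cancelling with the relations of both splittings, the right-hand side becomes
  \<open>(1 - P) P' - P (1 - P')\<close>.\<close>

lemma spectral_projector_difference:
  assumes p: "spectral_splitting A e P S" and q: "spectral_splitting A' e' P' S'"
  shows "P' - P = - (S o\<^sub>L (A' - A - (e' - e) *\<^sub>R id_blinfun) o\<^sub>L P')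
    - (P o\<^sub>L (A' - A - (e' - e) *\<^sub>R id_blinfun) o\<^sub>L S')"
proof -
  define B where "B = A - e *\<^sub>R id_blinfun"
  define B' where "B' = A' - e' *\<^sub>R id_blinfun"
  have "A' - A - (e' - e) *\<^sub>R id_blinfun = B' - B"
    by (simp add: B_def B'_def scaleR_diff_left)
  moreover have "S o\<^sub>L (B' - B) o\<^sub>L P' = (S o\<^sub>L (B' o\<^sub>L P')) - ((S o\<^sub>L B) o\<^sub>L P')"
    "P o\<^sub>L (B' - B) o\<^sub>L S' = (P o\<^sub>L (B' o\<^sub>L S')) - ((P o\<^sub>L B) o\<^sub>L S')"
    by (simp_all only: op_simps)
  ultimately show ?thesis
    using p q by (simp add: spectral_splitting_def B_def [symmetric] B'_def [symmetric] op_simps)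
qed

lemma spectral_data_continuous:
  fixes h P S :: "'b::topological_space \<Rightarrow> 'a::complex_hilbert operator"
  assumes h: "continuous_on D h" and e: "continuous_on D e"
    and split: "\<And>q. q \<in> D \<Longrightarrow> spectral_splitting (h q) (e q) (P q) (S q)"
    and bound: "\<And>q. q \<in> D \<Longrightarrow> norm (S q) \<le> M"
  shows "continuous_on D P" and "continuous_on D S"
proof -
  show P: "continuous_on D P"
    unfolding continuous_on_def
  proof
    fix p assume p: "p \<in> D"
    define \<Delta> where "\<Delta> q = h q - h p - (e q - e p) *\<^sub>R id_blinfun" for q
    have "((\<lambda>q. norm (\<Delta> q) * (2 * M)) \<longlongrightarrow>
        norm (h p - h p - (e p - e p) *\<^sub>R (id_blinfun :: 'a operator)) * (2 * M)) (at p within D)"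
      unfolding \<Delta>_def using h e p by (intro tendsto_intros) (auto simp: continuous_on_def)
    then have lim: "((\<lambda>q. norm (\<Delta> q) * (2 * M)) \<longlongrightarrow> 0) (at p within D)" by simp
    have "norm (P q - P p) \<le> norm (\<Delta> q) * (2 * M)" if q: "q \<in> D" for q
    proof -
      have "norm (P q - P p) \<le> norm (S p o\<^sub>L \<Delta> q o\<^sub>L P q) + norm (P p o\<^sub>L \<Delta> q o\<^sub>L S q)"
        unfolding spectral_projector_difference [OF split [OF p] split [OF q]] \<Delta>_def [symmetric]
        by (metis norm_minus_cancel norm_triangle_ineq4)
      also have "\<dots> \<le> M * norm (\<Delta> q) * 1 + 1 * norm (\<Delta> q) * M"
        by (intro add_mono norm_compose_le bound p q order_refl
            spectral_splitting_projection [OF split [OF p]]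
                spectral_splitting_projection [OF split [OF q]])
      finally show ?thesis by (simp add: mult_ac)
    qed
    then have "\<forall>\<^sub>F q in at p within D. norm (P q - P p) \<le> norm (\<Delta> q) * (2 * M)"
      by (simp add: eventually_at_filter)
    from Lim_null_comparison [OF this lim] show "(P \<longlongrightarrow> P p) (at p within D)"
      by (rule LIM_zero_cancel)
  qed
  have "continuous_on D (\<lambda>q. S q + P q)"
    unfolding continuous_on_def
  proof
    fix p assume p: "p \<in> D"
    show "((\<lambda>q. S q + P q) \<longlongrightarrow> S p + P p) (at p within D)"
    proof (rule inverse_tendsto)
      show "\<forall>\<^sub>F q in at p within D. is_inverse_op (h q - e q *\<^sub>R id_blinfun + P q) (S q + P q)"
        by (simp add: eventually_at_filter spectral_splitting_inverse split)
      show "is_inverse_op (h p - e p *\<^sub>R id_blinfun + P p) (S p + P p)"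
        by (rule spectral_splitting_inverse [OF split [OF p]])
      show "((\<lambda>q. h q - e q *\<^sub>R id_blinfun + P q) \<longlongrightarrow> h p - e p *\<^sub>R id_blinfun + P p) (at p within D)"
        using h e P p by (intro tendsto_intros) (auto simp: continuous_on_def)
    qed
  qed
  then have "continuous_on D (\<lambda>q. (S q + P q) - P q)" by (rule continuous_on_diff [OF _ P])
  then show "continuous_on D S" unfolding add_diff_cancel_right' .
qed

text \<open>The derivative \<open>c\<close> of the eigenvalue is accessible only through
  \<open>c P = P h' P\<close>. Its modulus is a quotient of norms, and the difference identity for
  \<open>(c q - c p) A p\<close> then controls \<open>c\<close> itself, sign included.\<close>

lemma scale_factor_continuous:
  fixes A M :: "'b::topological_space \<Rightarrow> 'c::real_normed_vector" and c :: "'b \<Rightarrow> real"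
  assumes eq: "\<And>q. q \<in> D \<Longrightarrow> c q *\<^sub>R A q = M q" and nz: "\<And>q. q \<in> D \<Longrightarrow> A q \<noteq> 0"
    and A: "continuous_on D A" and M: "continuous_on D M"
  shows "continuous_on D c"
  unfolding continuous_on_def
proof
  fix p assume p: "p \<in> D"
  have lims: "(A \<longlongrightarrow> A p) (at p within D)" "(M \<longlongrightarrow> M p) (at p within D)"
    using A M p by (auto simp: continuous_on_def)
  have abs: "\<bar>c q\<bar> = norm (M q) / norm (A q)" if "q \<in> D" for q
    using eq [OF that, symmetric] nz [OF that] by simp
  have "((\<lambda>q. (norm (M q - M p) + norm (M q) / norm (A q) * norm (A q - A p)) / norm (A p)) \<longlongrightarrow>
      (norm (M p - M p) + norm (M p) / norm (A p) * norm (A p - A p)) / norm (A p)) (at p within D)"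
    using nz [OF p] by (intro tendsto_intros lims) auto
  then have lim: "((\<lambda>q. (norm (M q - M p) + norm (M q) / norm (A q) * norm (A q - A p)) /
      norm (A p)) \<longlongrightarrow> 0) (at p within D)"
    by simp
  have "norm (c q - c p) \<le> (norm (M q - M p) + norm (M q) / norm (A q) * norm (A q - A p)) /
      norm (A p)"
    if q: "q \<in> D" for q
  proof -
    have "(c q - c p) *\<^sub>R A p = (M q - M p) - c q *\<^sub>R (A q - A p)"
      by (simp add: eq [OF p, symmetric] eq [OF q, symmetric] algebra_simps)
    then have "\<bar>c q - c p\<bar> * norm (A p) = norm ((M q - M p) - c q *\<^sub>R (A q - A p))"
      by (metis norm_scaleR)
    also have "\<dots> \<le> norm (M q - M p) + \<bar>c q\<bar> * norm (A q - A p)"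
      by (metis norm_scaleR norm_triangle_ineq4)
    finally show ?thesis using nz [OF p] by (simp add: abs [OF q] pos_le_divide_eq)
  qed
  then have "\<forall>\<^sub>F q in at p within D. norm (c q - c p) \<le>
      (norm (M q - M p) + norm (M q) / norm (A q) * norm (A q - A p)) / norm (A p)"
    by (simp add: eventually_at_filter)
  from Lim_null_comparison [OF this lim] show "(c \<longlongrightarrow> c p) (at p within D)"
    by (rule LIM_zero_cancel)
qed

text \<open>The first-order perturbation formula in direction \<open>B\<close>, obtained from
  \<open>spectral_projector_difference\<close>; the eigenvalue shift has dropped out because
  \<open>S P = P S = 0\<close>.\<close>

definition projector_derivative ::
    "'a::complex_hilbert operator \<Rightarrow> 'a operator \<Rightarrow> 'a operator \<Rightarrow> 'a operator" where
  "projector_derivative B P S = - (S o\<^sub>L B o\<^sub>L P) - (P o\<^sub>L B o\<^sub>L S)"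

text \<open>The derivative of \<open>S\<close>, written as the inverse of \<open>A - e + P\<close>
  minus \<open>P\<close>, where \<open>c\<close> is the derivative of \<open>e\<close>.\<close>

definition reduced_resolvent_derivative ::
    "'a::complex_hilbert operator \<Rightarrow> real \<Rightarrow> 'a operator \<Rightarrow> 'a operator \<Rightarrow> 'a operator" where
  "reduced_resolvent_derivative B c P S =
      - ((S + P) o\<^sub>L (B - c *\<^sub>R id_blinfun + projector_derivative B P S) o\<^sub>L (S + P))
     - projector_derivative B P S"

text \<open>Each increment is a product with a factor that vanishes at \<open>r0\<close> and is
  already known to be differentiable, so continuity of the other factors suffices. This dictates the
  order: \<open>e\<close> from \<open>h\<close>, then \<open>P\<close> from \<open>h\<close> and
  \<open>e\<close>, then \<open>S\<close> from all three.\<close>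

lemma spectral_data_has_vector_derivative:
  fixes h P S :: "real \<Rightarrow> 'a::complex_hilbert operator"
  assumes split: "\<And>r. r \<in> T \<Longrightarrow> spectral_splitting (h r) (e r) (P r) (S r)"
    and nz: "P r0 \<noteq> 0" and r0: "r0 \<in> T" and nt: "at r0 within T \<noteq> bot"
    and P: "continuous_on T P" and S: "continuous_on T S"
    and h: "(h has_vector_derivative h') (at r0 within T)"
  obtains c where "(e has_vector_derivative c) (at r0 within T)"
    and "c *\<^sub>R P r0 = P r0 o\<^sub>L h' o\<^sub>L P r0"
    and "(P has_vector_derivative projector_derivative h' (P r0) (S r0)) (at r0 within T)"
    and "(S has_vector_derivative reduced_resolvent_derivative h' c (P r0) (S r0)) (at r0 within T)"
proof -
  let ?F = "at r0 within T"
  note s0 = split [OF r0]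
  note Pr0 = spectral_splitting_projection [OF s0]
  have limP: "(P \<longlongrightarrow> P r0) ?F" and limS: "(S \<longlongrightarrow> S r0) ?F"
    using P S r0 by (auto simp: continuous_on_def)
  have inT: "\<forall>\<^sub>F r in ?F. r \<in> T" by (simp add: eventually_at_filter)
  have dh: "((\<lambda>r. h r - h r0) has_derivative (\<lambda>k. k *\<^sub>R h')) ?F"
    using h by (auto simp: has_vector_derivative_def intro!: derivative_eq_intros)
  have PhP: "P r0 o\<^sub>L (h r - h r0) o\<^sub>L P r = (e r - e r0) *\<^sub>R (P r0 o\<^sub>L P r)" if "r \<in> T" for r
  proof -
    have "h r o\<^sub>L P r = e r *\<^sub>R P r" "P r0 o\<^sub>L h r0 = e r0 *\<^sub>R P r0"
      using split [OF that] s0 by (auto simp: spectral_splitting_def op_simps)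
    moreover have "P r0 o\<^sub>L (h r - h r0) o\<^sub>L P r =
        (P r0 o\<^sub>L (h r o\<^sub>L P r)) - ((P r0 o\<^sub>L h r0) o\<^sub>L P r)"
      by (simp only: op_simps)
    ultimately show ?thesis by (simp add: op_simps scaleR_diff_left)
  qed
  obtain u where u: "u \<noteq> 0" "P r0 u = u" by (rule nonzero_operator_fixed_vector [OF Pr0(1) nz])
  \<comment> \<open>Testing with the eigenvector \<open>u\<close> absorbs \<open>P r0\<close> on the
    left, so \<open>PhP\<close> can be solved for \<open>e r - e r0\<close> by dividing by
    \<open>l (P r)\<close>, which is nonzero near \<open>r0\<close>.\<close>
  define l where "l B = Re (cinner u (blinfun_apply B u))" for B
  have l: "bounded_linear l"
    unfolding l_def using complex_functional_matrix_element(1) [of u u]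
    by (intro bounded_linear_compose [OF bounded_linear_Re]) (simp add: complex_functional_def)
  have lP: "l (P r0 o\<^sub>L B) = l B" for B
  proof -
    have "cinner u (P r0 (B u)) = cinner (P r0 u) (B u)" using Pr0(2)
      by (simp add: adjoint_pair_def)
    then show ?thesis by (simp add: l_def u)
  qed
  have l0: "l (P r0) \<noteq> 0" using u by (simp add: l_def cinner_self)
  have liml: "((\<lambda>r. l (P r)) \<longlongrightarrow> l (P r0)) ?F" by (rule bounded_linear.tendsto [OF l limP])
  have "\<forall>\<^sub>F r in ?F. l (P r) \<noteq> 0"
    using liml l0 by (rule tendsto_imp_eventually_ne)
  with inT have ee: "\<forall>\<^sub>F r in ?F. e r0 + l ((h r - h r0) o\<^sub>L (inverse (l (P r)) *\<^sub>R P r)) = e r"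
  proof eventually_elim
    case (elim r)
    have "l ((h r - h r0) o\<^sub>L P r) = l (P r0 o\<^sub>L (h r - h r0) o\<^sub>L P r)"
      by (simp only: compose_assoc lP)
    also have "\<dots> = (e r - e r0) * l (P r0 o\<^sub>L P r)"
      unfolding PhP [OF elim(1)] by (simp add: linear_simps [OF l])
    finally have "l ((h r - h r0) o\<^sub>L P r) = (e r - e r0) * l (P r)" by (simp only: lP)
    moreover have "l ((h r - h r0) o\<^sub>L (inverse (l (P r)) *\<^sub>R P r)) =
        inverse (l (P r)) * l ((h r - h r0) o\<^sub>L P r)"
      by (simp only: compose_distribs(8) linear_simps(5) [OF l] real_scaleR_def)
    moreover have "inverse (l (P r)) * ((e r - e r0) * l (P r)) = e r - e r0" using elim(2) by simp
    ultimately show ?case by simp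
  qed
  define c where "c = l (h' o\<^sub>L (inverse (l (P r0)) *\<^sub>R P r0))"
  have "((\<lambda>r. (h r - h r0) o\<^sub>L (inverse (l (P r)) *\<^sub>R P r)) has_derivative
      (\<lambda>k. (k *\<^sub>R h') o\<^sub>L (inverse (l (P r0)) *\<^sub>R P r0))) ?F"
    by (rule has_derivative_vanishing_compose_left [OF dh]) (auto intro!: tendsto_intros limP liml
        l0)
  then have "((\<lambda>r. e r0 + l ((h r - h r0) o\<^sub>L (inverse (l (P r)) *\<^sub>R P r))) has_derivative
      (\<lambda>k. 0 + l ((k *\<^sub>R h') o\<^sub>L (inverse (l (P r0)) *\<^sub>R P r0)))) ?F"
    by (intro has_derivative_add has_derivative_const bounded_linear.has_derivative [OF l])
  moreover have "0 + l ((k *\<^sub>R h') o\<^sub>L (inverse (l (P r0)) *\<^sub>R P r0)) = k *\<^sub>R c" for k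
    by (simp only: c_def compose_distribs(7) linear_simps(5) [OF l] add_0_left)
  ultimately have "((\<lambda>r. e r0 + l ((h r - h r0) o\<^sub>L (inverse (l (P r)) *\<^sub>R P r))) has_derivative
      (\<lambda>k. k *\<^sub>R c)) ?F"
    by (simp only:)
  then have e: "(e has_vector_derivative c) ?F"
    unfolding has_vector_derivative_def
    by (rule has_derivative_transform_eventually [OF _ ee])
        (use r0 in \<open>auto simp: linear_simps [OF l]\<close>)
  have de: "((\<lambda>r. e r - e r0) has_derivative (\<lambda>k. k *\<^sub>R c)) ?F"
    using e by (auto simp: has_vector_derivative_def intro!: derivative_eq_intros)
  have "((\<lambda>r. P r0 o\<^sub>L ((h r - h r0) o\<^sub>L P r)) has_derivative
      (\<lambda>k. P r0 o\<^sub>L ((k *\<^sub>R h') o\<^sub>L P r0))) ?F"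
    by (intro bounded_linear.has_derivative
        [OF bounded_bilinear.bounded_linear_right [OF bounded_bilinear_blinfun_compose]]
        has_derivative_vanishing_compose_left dh limP) simp
  then have left: "((\<lambda>r. P r0 o\<^sub>L ((h r - h r0) o\<^sub>L P r)) has_vector_derivative
      P r0 o\<^sub>L (h' o\<^sub>L P r0)) ?F"
    by (simp only: has_vector_derivative_def compose_distribs(7,8))
  \<comment> \<open>By \<open>PhP\<close> this is the function differentiated in
    \<open>left\<close>; uniqueness of the derivative yields the formula for
    \<open>c\<close>.\<close>
  have "((\<lambda>r. (e r - e r0) *\<^sub>R (P r0 o\<^sub>L P r)) has_derivative
      (\<lambda>k. (k *\<^sub>R c) *\<^sub>R (P r0 o\<^sub>L P r0))) ?F"
    by (rule has_derivative_vanishing_bilinear [OF bounded_bilinear_scaleR de])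
      (auto intro!: tendsto_compose_op limP)
  then have "((\<lambda>r. P r0 o\<^sub>L ((h r - h r0) o\<^sub>L P r)) has_derivative
      (\<lambda>k. (k *\<^sub>R c) *\<^sub>R (P r0 o\<^sub>L P r0))) ?F"
    by (rule has_derivative_transform_within [OF _ zero_less_one r0])
      (simp only: PhP [symmetric] compose_assoc)
  then have "((\<lambda>r. P r0 o\<^sub>L ((h r - h r0) o\<^sub>L P r)) has_vector_derivative c *\<^sub>R P r0) ?F"
    by (simp only: has_vector_derivative_def Pr0(1) scaleR_scaleR real_scaleR_def)
  note left this
  then have cP: "c *\<^sub>R P r0 = P r0 o\<^sub>L h' o\<^sub>L P r0"
    using vector_derivative_unique_within [OF nt] by (simp add: compose_assoc)
  define \<Delta> where "\<Delta> r = h r - h r0 - (e r - e r0) *\<^sub>R (id_blinfun :: 'a operator)" for r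
  have d\<Delta>: "(\<Delta> has_derivative (\<lambda>k. k *\<^sub>R h' - (k *\<^sub>R c) *\<^sub>R id_blinfun)) ?F"
    unfolding \<Delta>_def by (intro has_derivative_diff dh bounded_linear.has_derivative
        [OF bounded_linear_scaleR_left] de)
  have [simp]: "\<Delta> r0 = 0" by (simp add: \<Delta>_def)
  have "((\<lambda>r. S r0 o\<^sub>L (\<Delta> r o\<^sub>L P r)) has_derivative
      (\<lambda>k. S r0 o\<^sub>L ((k *\<^sub>R h' - (k *\<^sub>R c) *\<^sub>R id_blinfun) o\<^sub>L P r0))) ?F"
    "((\<lambda>r. P r0 o\<^sub>L (\<Delta> r o\<^sub>L S r)) has_derivative
        (\<lambda>k. P r0 o\<^sub>L ((k *\<^sub>R h' - (k *\<^sub>R c) *\<^sub>R id_blinfun) o\<^sub>L S r0))) ?F"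
    by (intro bounded_linear.has_derivative
        [OF bounded_bilinear.bounded_linear_right [OF bounded_bilinear_blinfun_compose]]
        has_derivative_vanishing_compose_left d\<Delta> limP limS; simp)+
  then have "((\<lambda>r. P r0 + (- (S r0 o\<^sub>L (\<Delta> r o\<^sub>L P r)) - (P r0 o\<^sub>L (\<Delta> r o\<^sub>L S r)))) has_derivative
      (\<lambda>k. 0 + (- (S r0 o\<^sub>L ((k *\<^sub>R h' - (k *\<^sub>R c) *\<^sub>R id_blinfun) o\<^sub>L P r0))
        - (P r0 o\<^sub>L ((k *\<^sub>R h' - (k *\<^sub>R c) *\<^sub>R id_blinfun) o\<^sub>L S r0))))) ?F"
    by (intro has_derivative_add has_derivative_const has_derivative_diff has_derivative_minus)
  \<comment> \<open>These relations remove the terms containing \<open>c\<close>.\<close>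
  moreover have "S r0 o\<^sub>L P r0 = 0" "P r0 o\<^sub>L S r0 = 0" using s0
    by (auto simp: spectral_splitting_def)
  ultimately have "((\<lambda>r. P r0 + (- (S r0 o\<^sub>L (\<Delta> r o\<^sub>L P r)) - (P r0 o\<^sub>L (\<Delta> r o\<^sub>L S r))))
      has_vector_derivative
      projector_derivative h' (P r0) (S r0)) ?F"
    by (simp add: has_vector_derivative_def projector_derivative_def op_simps scaleR_diff_right)
  then have dP: "(P has_vector_derivative projector_derivative h' (P r0) (S r0)) ?F"
    unfolding has_vector_derivative_def
  proof (rule has_derivative_transform_within [OF _ zero_less_one r0])
    fix r assume "r \<in> T"
    from spectral_projector_difference [OF s0 split [OF this]]
    show "P r0 + (- (S r0 o\<^sub>L (\<Delta> r o\<^sub>L P r)) - (P r0 o\<^sub>L (\<Delta> r o\<^sub>L S r))) = P r"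
      unfolding \<Delta>_def [symmetric] by (simp add: compose_assoc algebra_simps)
  qed
  define B where "B r = S r + P r" for r
  define A where "A r = h r - e r *\<^sub>R id_blinfun + P r" for r
  let ?P' = "projector_derivative h' (P r0) (S r0)"
  let ?A' = "h' - c *\<^sub>R id_blinfun + ?P'"
  have "(A has_vector_derivative ?A') ?F"
    unfolding A_def
    by (intro has_vector_derivative_add has_vector_derivative_diff h dP
        bounded_linear.has_vector_derivative [OF bounded_linear_scaleR_left e])
  then have "(B has_vector_derivative - (B r0 o\<^sub>L ?A' o\<^sub>L B r0)) ?F"
    by (intro inverse_has_vector_derivative [of T A B] r0)
      (simp add: A_def B_def spectral_splitting_inverse split)
  then have "((\<lambda>r. B r - P r) has_vector_derivative - (B r0 o\<^sub>L ?A' o\<^sub>L B r0) - ?P') ?F"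
    by (intro has_vector_derivative_diff dP)
  then have dS: "(S has_vector_derivative reduced_resolvent_derivative h' c (P r0) (S r0)) ?F"
    by (simp add: B_def reduced_resolvent_derivative_def)
  show ?thesis using that [OF e cP dP dS] .
qed

section \<open>Families on the unit square\<close>

abbreviation (input) unit_square :: "(real \<times> real) set" where
  "unit_square \<equiv> {0..1} \<times> {0..1}"

definition C1_square :: "(real \<Rightarrow> real \<Rightarrow> 'b::real_normed_vector) \<Rightarrow> bool" where
  "C1_square F \<longleftrightarrow> continuous_on unit_square (\<lambda>p. F (fst p) (snd p)) \<and>
     continuous_on unit_square (\<lambda>p. d_t F (fst p) (snd p)) \<and>
     continuous_on unit_square (\<lambda>p. d_alpha F (fst p) (snd p)) \<and>
     (\<forall>s\<in>{0..1}. \<forall>a\<in>{0..1}.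
        ((\<lambda>s. F s a) has_vector_derivative d_t F s a) (at s within {0..1}) \<and>
        ((\<lambda>a. F s a) has_vector_derivative d_alpha F s a) (at a within {0..1}))"

lemma at_within_unit_interval: "x \<in> {0..1::real} \<Longrightarrow> at x within {0..1} \<noteq> bot"
  by (simp add: trivial_limit_within)

text \<open>No point of the unit interval is isolated in it, so derivatives are unique and the
  choice operator behind \<open>d_t\<close> and \<open>d_alpha\<close> returns \<open>F1\<close> and
  \<open>F2\<close>.\<close>

lemma C1_squareI:
  assumes "continuous_on unit_square (\<lambda>p. F (fst p) (snd p))"
    and "continuous_on unit_square (\<lambda>p. F1 (fst p) (snd p))"
    and "continuous_on unit_square (\<lambda>p. F2 (fst p) (snd p))"
    and 1: "\<And>s a. s \<in> {0..1} \<Longrightarrow> a \<in> {0..1} \<Longrightarrow> ((\<lambda>s. F s a) has_vector_derivative F1 s a)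
        (at s within {0..1})"
    and 2: "\<And>s a. s \<in> {0..1} \<Longrightarrow> a \<in> {0..1} \<Longrightarrow> ((\<lambda>a. F s a) has_vector_derivative F2 s a)
        (at a within {0..1})"
  shows "C1_square F" and "\<And>s a. s \<in> {0..1} \<Longrightarrow> a \<in> {0..1} \<Longrightarrow> d_t F s a = F1 s a"
    and "\<And>s a. s \<in> {0..1} \<Longrightarrow> a \<in> {0..1} \<Longrightarrow> d_alpha F s a = F2 s a"
proof -
  show d1: "d_t F s a = F1 s a" if "s \<in> {0..1}" "a \<in> {0..1}" for s a
    unfolding d_t_def by (rule vector_derivative_within [OF at_within_unit_interval 1])
        (use that in auto)
  show d2: "d_alpha F s a = F2 s a" if "s \<in> {0..1}" "a \<in> {0..1}" for s a
    unfolding d_alpha_def by (rule vector_derivative_within [OF at_within_unit_interval 2])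
        (use that in auto)
  have "continuous_on unit_square (\<lambda>p. d_t F (fst p) (snd p))"
    by (rule continuous_on_eq [OF assms(2)]) (auto simp: d1)
  moreover have "continuous_on unit_square (\<lambda>p. d_alpha F (fst p) (snd p))"
    by (rule continuous_on_eq [OF assms(3)]) (auto simp: d2)
  ultimately show "C1_square F"
    using assms unfolding C1_square_def by (simp add: d1 d2)
qed

lemma C1_squareD:
  assumes "C1_square F"
  shows "continuous_on unit_square (\<lambda>p. F (fst p) (snd p))"
    and "continuous_on unit_square (\<lambda>p. d_t F (fst p) (snd p))"
    and "continuous_on unit_square (\<lambda>p. d_alpha F (fst p) (snd p))"
    and "\<And>s a. s \<in> {0..1} \<Longrightarrow> a \<in> {0..1} \<Longrightarrow>
      ((\<lambda>s. F s a) has_vector_derivative d_t F s a) (at s within {0..1})"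
    and "\<And>s a. s \<in> {0..1} \<Longrightarrow> a \<in> {0..1} \<Longrightarrow>
      ((\<lambda>a. F s a) has_vector_derivative d_alpha F s a) (at a within {0..1})"
  using assms by (auto simp: C1_square_def)

section \<open>Calculus of C1 families on the square\<close>

lemma C1_square_cong:
  assumes "C1_square F" "\<And>s a. s \<in> {0..1} \<Longrightarrow> a \<in> {0..1} \<Longrightarrow> F s a = G s a"
  shows "C1_square G"
proof (rule C1_squareI(1))
  show "continuous_on unit_square (\<lambda>p. G (fst p) (snd p))"
    by (rule continuous_on_eq [OF C1_squareD(1) [OF assms(1)]]) (use assms(2) in auto)
  show "((\<lambda>s. G s a) has_vector_derivative d_t F s a) (at s within {0..1})"
    if "s \<in> {0..1}" "a \<in> {0..1}" for s a
    by (rule has_vector_derivative_transform [OF that(1) _ C1_squareD(4) [OF assms(1) that]])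
      (use assms(2) that in auto)
  show "((\<lambda>a. G s a) has_vector_derivative d_alpha F s a) (at a within {0..1})"
    if "s \<in> {0..1}" "a \<in> {0..1}" for s a
    by (rule has_vector_derivative_transform [OF that(2) _ C1_squareD(5) [OF assms(1) that]])
      (use assms(2) that in auto)
qed (use C1_squareD [OF assms(1)] in auto)

lemma C1_square_compose:
  fixes F G :: "real \<Rightarrow> real \<Rightarrow> 'a::complex_hilbert operator"
  assumes "C1_square F" "C1_square G"
  shows "C1_square (\<lambda>s a. F s a o\<^sub>L G s a)"
    and "\<And>s a. s \<in> {0..1} \<Longrightarrow> a \<in> {0..1} \<Longrightarrow>
      d_t (\<lambda>s a. F s a o\<^sub>L G s a) s a = (F s a o\<^sub>L d_t G s a) + (d_t F s a o\<^sub>L G s a)"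
    and "\<And>s a. s \<in> {0..1} \<Longrightarrow> a \<in> {0..1} \<Longrightarrow>
      d_alpha (\<lambda>s a. F s a o\<^sub>L G s a) s a = (F s a o\<^sub>L d_alpha G s a) + (d_alpha F s a o\<^sub>L G s a)"
proof -
  note D = C1_squareD [OF assms(1)] C1_squareD [OF assms(2)]
  have *: "continuous_on unit_square (\<lambda>p. F (fst p) (snd p) o\<^sub>L G (fst p) (snd p))"
    "continuous_on unit_square (\<lambda>p. (F (fst p) (snd p) o\<^sub>L d_t G (fst p) (snd p)) +
        (d_t F (fst p) (snd p) o\<^sub>L G (fst p) (snd p)))"
    "continuous_on unit_square (\<lambda>p. (F (fst p) (snd p) o\<^sub>L d_alpha G (fst p) (snd p)) +
        (d_alpha F (fst p) (snd p) o\<^sub>L G (fst p) (snd p)))"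
    by (intro continuous_intros D)+
  note I = C1_squareI [OF *, OF has_vector_derivative_compose_op has_vector_derivative_compose_op]
  show "C1_square (\<lambda>s a. F s a o\<^sub>L G s a)"
    by (rule I(1)) (use D in auto)
  show "d_t (\<lambda>s a. F s a o\<^sub>L G s a) s a = (F s a o\<^sub>L d_t G s a) + (d_t F s a o\<^sub>L G s a)"
    if "s \<in> {0..1}" "a \<in> {0..1}" for s a
    by (rule I(2)) (use D that in auto)
  show "d_alpha (\<lambda>s a. F s a o\<^sub>L G s a) s a = (F s a o\<^sub>L d_alpha G s a) + (d_alpha F s a o\<^sub>L G s a)"
    if "s \<in> {0..1}" "a \<in> {0..1}" for s a
    by (rule I(3)) (use D that in auto)
qed

lemma C1_square_diff:
  assumes "C1_square F" "C1_square G"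
  shows "C1_square (\<lambda>s a. F s a - G s a)"
    and "\<And>s a. s \<in> {0..1} \<Longrightarrow> a \<in> {0..1} \<Longrightarrow> d_t (\<lambda>s a. F s a - G s a) s a = d_t F s a - d_t G s a"
    and "\<And>s a. s \<in> {0..1} \<Longrightarrow> a \<in> {0..1} \<Longrightarrow> d_alpha (\<lambda>s a. F s a - G s a) s a =
        d_alpha F s a - d_alpha G s a"
proof -
  note D = C1_squareD [OF assms(1)] C1_squareD [OF assms(2)]
  have *: "continuous_on unit_square (\<lambda>p. F (fst p) (snd p) - G (fst p) (snd p))"
    "continuous_on unit_square (\<lambda>p. d_t F (fst p) (snd p) - d_t G (fst p) (snd p))"
    "continuous_on unit_square (\<lambda>p. d_alpha F (fst p) (snd p) - d_alpha G (fst p) (snd p))"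
    by (intro continuous_intros D)+
  note I = C1_squareI [OF *, OF has_vector_derivative_diff has_vector_derivative_diff]
  show "C1_square (\<lambda>s a. F s a - G s a)"
    by (rule I(1)) (use D in auto)
  show "d_t (\<lambda>s a. F s a - G s a) s a = d_t F s a - d_t G s a"
    if "s \<in> {0..1}" "a \<in> {0..1}" for s a
    by (rule I(2)) (use D that in auto)
  show "d_alpha (\<lambda>s a. F s a - G s a) s a = d_alpha F s a - d_alpha G s a"
    if "s \<in> {0..1}" "a \<in> {0..1}" for s a
    by (rule I(3)) (use D that in auto)
qed

lemma C1_square_const: "C1_square (\<lambda>s a. c)"
  by (rule C1_squareI(1) [where ?F1.0 = "\<lambda>s a. 0" and ?F2.0 = "\<lambda>s a. 0"]) auto

lemma Ck_on_continuous: "Ck_on k f D \<Longrightarrow> continuous_on D f"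
  by (cases k) (auto intro: has_derivative_continuous_on)

text \<open>\<open>Ck_on\<close> only asserts that some partial derivatives exist. Restriction to
  coordinate lines identifies them with \<open>d_t\<close> and \<open>d_alpha\<close>, so that the
  recursion can be continued with these.\<close>

lemma Ck_on_Suc_square:
  fixes F :: "real \<Rightarrow> real \<Rightarrow> 'b::real_normed_vector"
  assumes "Ck_on (Suc k) (\<lambda>(s, a). F s a) unit_square"
  shows "C1_square F" and "Ck_on k (\<lambda>(s, a). d_t F s a) unit_square"
    and "Ck_on k (\<lambda>(s, a). d_alpha F s a) unit_square"
proof -
  obtain f1 f2 where der: "\<And>p. p \<in> unit_square \<Longrightarrow>
      ((\<lambda>(s, a). F s a) has_derivative (\<lambda>h. fst h *\<^sub>R f1 p + snd h *\<^sub>R f2 p))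
          (at p within unit_square)"
    and f: "Ck_on k f1 unit_square" "Ck_on k f2 unit_square"
    using assms by auto
  have 1: "((\<lambda>s. F s a) has_vector_derivative f1 (s, a)) (at s within {0..1})"
    if "s \<in> {0..1}" "a \<in> {0..1}" for s a
  proof -
    have "((\<lambda>s. (s, a)) has_derivative (\<lambda>k. (k, 0))) (at s within {0..1})"
      by (auto intro!: derivative_eq_intros)
    moreover have "((\<lambda>(s, a). F s a) has_derivative (\<lambda>h. fst h *\<^sub>R f1 (s, a) + snd h *\<^sub>R f2 (s, a)))
        (at (s, a) within (\<lambda>s. (s, a)) ` {0..1})"
      by (rule has_derivative_subset [OF der]) (use that in auto)
    ultimately show ?thesis
      using has_derivative_in_compose [of "\<lambda>s. (s, a)"] by (force simp: has_vector_derivative_def)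
  qed
  have 2: "((\<lambda>a. F s a) has_vector_derivative f2 (s, a)) (at a within {0..1})"
    if "s \<in> {0..1}" "a \<in> {0..1}" for s a
  proof -
    have "((\<lambda>a. (s, a)) has_derivative (\<lambda>k. (0, k))) (at a within {0..1})"
      by (auto intro!: derivative_eq_intros)
    moreover have "((\<lambda>(s, a). F s a) has_derivative (\<lambda>h. fst h *\<^sub>R f1 (s, a) + snd h *\<^sub>R f2 (s, a)))
        (at (s, a) within (\<lambda>a. (s, a)) ` {0..1})"
      by (rule has_derivative_subset [OF der]) (use that in auto)
    ultimately show ?thesis
      using has_derivative_in_compose [of "\<lambda>a. (s, a)"] by (force simp: has_vector_derivative_def)
  qed
  have c: "continuous_on unit_square (\<lambda>p. F (fst p) (snd p))"
    "continuous_on unit_square (\<lambda>p. f1 (fst p, snd p))"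
        "continuous_on unit_square (\<lambda>p. f2 (fst p, snd p))"
    using Ck_on_continuous [OF assms] Ck_on_continuous [OF f(1)] Ck_on_continuous [OF f(2)]
    by (simp_all add: case_prod_beta')
  note I = C1_squareI [OF c 1 2]
  show "C1_square F" by (rule I)
  \<comment> \<open>The partial derivatives agree with \<open>f1\<close> and \<open>f2\<close> on
    the square only, hence this invariance.\<close>
  have cong: "Ck_on k g unit_square" if fg: "Ck_on k f unit_square" "\<And>p. p \<in> unit_square \<Longrightarrow> f p =
      g p" for f g :: "_ \<Rightarrow> 'b"
  proof (cases k)
    case 0
    then show ?thesis using fg(1) continuous_on_eq [OF _ fg(2)] by simp
  next
    case (Suc m)
    then obtain g1 g2 where "\<forall>p\<in>unit_square. (f has_derivative
        (\<lambda>h. fst h *\<^sub>R g1 p + snd h *\<^sub>R g2 p)) (at p within unit_square)"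
      "Ck_on m g1 unit_square" "Ck_on m g2 unit_square"
      using fg(1) by auto
    moreover have "(g has_derivative D) (at p within unit_square)"
      if "p \<in> unit_square" "(f has_derivative D) (at p within unit_square)" for p D
      by (rule has_derivative_transform [OF that(1) _ that(2)]) (rule fg(2) [symmetric])
    ultimately show ?thesis unfolding Suc Ck_on.simps by blast
  qed
  show "Ck_on k (\<lambda>(s, a). d_t F s a) unit_square"
    by (rule cong [OF f(1)]) (use I(2) in auto)
  show "Ck_on k (\<lambda>(s, a). d_alpha F s a) unit_square"
    by (rule cong [OF f(2)]) (use I(3) in auto)
qed

lemma continuous_on_square_line:
  fixes F :: "real \<Rightarrow> real \<Rightarrow> 'b::topological_space"
  assumes F: "continuous_on unit_square (\<lambda>p. F (fst p) (snd p))" and x: "x \<in> {0..1}"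
  shows "continuous_on {0..1} (\<lambda>s. F s x)" and "continuous_on {0..1} (\<lambda>a. F x a)"
proof -
  have c: "continuous_on {0..1::real} (\<lambda>s. (s, x))" "continuous_on {0..1::real} (\<lambda>a. (x, a))"
    by (intro continuous_intros)+
  have i: "(\<lambda>s. (s, x)) ` {0..1} \<subseteq> unit_square" "(\<lambda>a. (x, a)) ` {0..1} \<subseteq> unit_square"
    using x by auto
  show "continuous_on {0..1} (\<lambda>s. F s x)" "continuous_on {0..1} (\<lambda>a. F x a)"
    using continuous_on_compose2 [OF F c(1) i(1)] continuous_on_compose2 [OF F c(2) i(2)]
      by simp_all
qed

text \<open>The one-variable result is applied along both families of coordinate lines. The
  derivatives of \<open>P\<close> and \<open>S\<close> are continuous by their explicit formulas,
  and those of \<open>E\<close> by division by \<open>P\<close>.\<close>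

lemma spectral_data_C1_square:
  fixes H P S :: "real \<Rightarrow> real \<Rightarrow> 'a::complex_hilbert operator"
  assumes H: "C1_square H"
    and split: "\<And>s a. s \<in> {0..1} \<Longrightarrow> a \<in> {0..1} \<Longrightarrow> spectral_splitting (H s a) (E s a) (P s a) (S s a)"
    and nz: "\<And>s a. s \<in> {0..1} \<Longrightarrow> a \<in> {0..1} \<Longrightarrow> P s a \<noteq> 0"
    and E: "continuous_on unit_square (\<lambda>p. E (fst p) (snd p))"
    and bound: "\<And>s a. s \<in> {0..1} \<Longrightarrow> a \<in> {0..1} \<Longrightarrow> norm (S s a) \<le> M"
  shows "C1_square E" and "C1_square P" and "C1_square S"
    and "\<And>s a. s \<in> {0..1} \<Longrightarrow> a \<in> {0..1} \<Longrightarrow> d_alpha E s a *\<^sub>R P s a =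
        P s a o\<^sub>L d_alpha H s a o\<^sub>L P s a"
    and "\<And>s a. s \<in> {0..1} \<Longrightarrow> a \<in> {0..1} \<Longrightarrow> d_t P s a =
        projector_derivative (d_t H s a) (P s a) (S s a)"
    and "\<And>s a. s \<in> {0..1} \<Longrightarrow> a \<in> {0..1} \<Longrightarrow> d_alpha P s a =
        projector_derivative (d_alpha H s a) (P s a) (S s a)"
proof -
  note HD = C1_squareD [OF H]
  have PS: "continuous_on unit_square (\<lambda>p. P (fst p) (snd p))"
      "continuous_on unit_square (\<lambda>p. S (fst p) (snd p))"
    by (rule spectral_data_continuous [OF HD(1) E, where P = "\<lambda>p. P (fst p) (snd p)"
          and S = "\<lambda>p. S (fst p) (snd p)" and M = M]; use split bound in auto)+
  note line1 = continuous_on_square_line(1) and line2 = continuous_on_square_line(2)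
  have 1: "((\<lambda>s. E s a) has_vector_derivative d_t E s a) (at s within {0..1}) \<and>
      d_t E s a *\<^sub>R P s a = P s a o\<^sub>L d_t H s a o\<^sub>L P s a \<and>
      ((\<lambda>s. P s a) has_vector_derivative projector_derivative (d_t H s a) (P s a) (S s a))
          (at s within {0..1}) \<and>
      ((\<lambda>s. S s a) has_vector_derivative reduced_resolvent_derivative (d_t H s a) (d_t E s a)
          (P s a) (S s a)) (at s within {0..1})"
    if sa: "s \<in> {0..1}" "a \<in> {0..1}" for s a
  proof -
    obtain c where c: "((\<lambda>s. E s a) has_vector_derivative c) (at s within {0..1})"
      "c *\<^sub>R P s a = P s a o\<^sub>L d_t H s a o\<^sub>L P s a"
      "((\<lambda>s. P s a) has_vector_derivative projector_derivative (d_t H s a) (P s a) (S s a))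
          (at s within {0..1})"
      "((\<lambda>s. S s a) has_vector_derivative
          reduced_resolvent_derivative (d_t H s a) c (P s a) (S s a)) (at s within {0..1})"
      by (rule spectral_data_has_vector_derivative [of "{0..1}" "\<lambda>s. H s a" "\<lambda>s. E s a" "\<lambda>s. P s a"
          "\<lambda>s. S s a" s,
          OF split nz _ at_within_unit_interval line1 [OF PS(1)] line1 [OF PS(2)] HD(4)])
        (use sa in auto)
    have "d_t E s a = c" unfolding d_t_def
      by (rule vector_derivative_within [OF at_within_unit_interval c(1)]) fact
    then show ?thesis using c by simp
  qed
  have 2: "((\<lambda>a. E s a) has_vector_derivative d_alpha E s a) (at a within {0..1}) \<and>
      d_alpha E s a *\<^sub>R P s a = P s a o\<^sub>L d_alpha H s a o\<^sub>L P s a \<and>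
      ((\<lambda>a. P s a) has_vector_derivative projector_derivative (d_alpha H s a) (P s a) (S s a))
          (at a within {0..1}) \<and>
      ((\<lambda>a. S s a) has_vector_derivative reduced_resolvent_derivative (d_alpha H s a)
          (d_alpha E s a) (P s a) (S s a)) (at a within {0..1})"
    if sa: "s \<in> {0..1}" "a \<in> {0..1}" for s a
  proof -
    obtain c where c: "((\<lambda>a. E s a) has_vector_derivative c) (at a within {0..1})"
      "c *\<^sub>R P s a = P s a o\<^sub>L d_alpha H s a o\<^sub>L P s a"
      "((\<lambda>a. P s a) has_vector_derivative projector_derivative (d_alpha H s a) (P s a) (S s a))
          (at a within {0..1})"
      "((\<lambda>a. S s a) has_vector_derivative
          reduced_resolvent_derivative (d_alpha H s a) c (P s a) (S s a)) (at a within {0..1})"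
      by (rule spectral_data_has_vector_derivative [of "{0..1}" "\<lambda>a. H s a" "\<lambda>a. E s a" "\<lambda>a. P s a"
          "\<lambda>a. S s a" a,
          OF split nz _ at_within_unit_interval line2 [OF PS(1)] line2 [OF PS(2)] HD(5)])
        (use sa in auto)
    have "d_alpha E s a = c" unfolding d_alpha_def
      by (rule vector_derivative_within [OF at_within_unit_interval c(1)]) fact
    then show ?thesis using c by simp
  qed
  show "d_alpha E s a *\<^sub>R P s a = P s a o\<^sub>L d_alpha H s a o\<^sub>L P s a" if "s \<in> {0..1}" "a \<in> {0..1}"
    for s a
    using 2 that by blast
  have contE: "continuous_on unit_square (\<lambda>p. d_t E (fst p) (snd p))"
    "continuous_on unit_square (\<lambda>p. d_alpha E (fst p) (snd p))"
  proof -
    note scale = scale_factor_continuous [where A = "\<lambda>p. P (fst p) (snd p)"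
        and D = unit_square, OF _ _ PS(1)]
    show "continuous_on unit_square (\<lambda>p. d_t E (fst p) (snd p))"
      by (rule scale [where M = "\<lambda>p. P (fst p) (snd p) o\<^sub>L d_t H (fst p) (snd p) o\<^sub>L P (fst p)
          (snd p)"])
        (use 1 nz in \<open>auto intro!: continuous_intros PS HD\<close>)
    show "continuous_on unit_square (\<lambda>p. d_alpha E (fst p) (snd p))"
      by (rule scale [where M = "\<lambda>p. P (fst p) (snd p) o\<^sub>L d_alpha H (fst p) (snd p) o\<^sub>L P (fst p)
          (snd p)"])
        (use 2 nz in \<open>auto intro!: continuous_intros PS HD\<close>)
  qed
  show "C1_square E" by (rule C1_squareI [OF E contE]) (use 1 2 in auto)
  have "continuous_on unit_square (\<lambda>p. projector_derivative (d_t H (fst p) (snd p))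
      (P (fst p) (snd p)) (S (fst p) (snd p)))"
    "continuous_on unit_square (\<lambda>p. projector_derivative (d_alpha H (fst p) (snd p))
        (P (fst p) (snd p)) (S (fst p) (snd p)))"
    unfolding projector_derivative_def by (intro continuous_intros PS HD)+
  note I = C1_squareI [OF PS(1) this]
  show "C1_square P" by (rule I(1)) (use 1 2 in auto)
  show "d_t P s a = projector_derivative (d_t H s a) (P s a) (S s a)" if "s \<in> {0..1}" "a \<in> {0..1}"
    for s a
    by (rule I(2)) (use 1 2 that in auto)
  show "d_alpha P s a = projector_derivative (d_alpha H s a) (P s a) (S s a)"
    if "s \<in> {0..1}" "a \<in> {0..1}" for s a
    by (rule I(3)) (use 1 2 that in auto)
  have "continuous_on unit_square (\<lambda>p. reduced_resolvent_derivative (d_t H (fst p) (snd p))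
      (d_t E (fst p) (snd p)) (P (fst p) (snd p)) (S (fst p) (snd p)))"
    "continuous_on unit_square (\<lambda>p. reduced_resolvent_derivative (d_alpha H (fst p) (snd p))
        (d_alpha E (fst p) (snd p)) (P (fst p) (snd p)) (S (fst p) (snd p)))"
    unfolding reduced_resolvent_derivative_def projector_derivative_def
      by (intro continuous_intros PS HD contE)+
  note I = C1_squareI [OF PS(2) this]
  show "C1_square S" by (rule I(1)) (use 1 2 in auto)
qed

lemma gap_hypothesis_distance:
  assumes gap: "gap_hypothesis H \<sigma> \<sigma>'"
  obtains g where "0 < g" and "\<And>s a z w. s \<in> {0..1} \<Longrightarrow> a \<in> {0..1} \<Longrightarrow> z \<in> \<sigma> s a \<Longrightarrow> w \<in> \<sigma>' s a \<Longrightarrow> g \<le>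
      dist z w"
proof -
  have "0 < spectral_gap \<sigma> \<sigma>'" using gap by (simp add: gap_hypothesis_def)
  \<comment> \<open>The gap is infinite if the other part of the spectrum is always empty, so a
    smaller positive value is taken instead.\<close>
  then obtain x where x: "0 < x" "x < spectral_gap \<sigma> \<sigma>'" using dense by blast
  then obtain g where g: "x = ereal g" by (cases x) auto
  have "g \<le> dist z w" if "s \<in> {0..1}" "a \<in> {0..1}" "z \<in> \<sigma> s a" "w \<in> \<sigma>' s a" for s a z w
  proof -
    have "spectral_gap \<sigma> \<sigma>' \<le> ereal (dist z w)"
      unfolding spectral_gap_def
      by (rule INF_lower2 [OF that(1)], rule INF_lower2 [OF that(2)], rule INF_lower2
          [OF that(3)], rule INF_lower [OF that(4)])
    then show ?thesis using x g by (metis ereal_less_eq(3) less_imp_le order_trans)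
  qed
  then show ?thesis using that [of g] x g by auto
qed

text \<open>Since \<open>P S = S P = 0\<close>, the derivative of \<open>E\<close> drops out of the derivatives of \<open>P\<close>, which are
  therefore as smooth as those of \<open>H\<close> and \<open>S\<close>.\<close>

lemma isolated_eigenvalue_family:
  fixes H P :: "real \<Rightarrow> real \<Rightarrow> 'a::complex_hilbert operator"
  assumes selfadjoint: "\<And>s a. s \<in> {0..1} \<Longrightarrow> a \<in> {0..1} \<Longrightarrow> selfadjoint_op (H s a)"
    and regularity: "Ck_on 3 (\<lambda>(s, a). H s a) unit_square"
    and gap: "gap_hypothesis H \<sigma> \<sigma>'"
    and eigenvalue: "\<And>s a. s \<in> {0..1} \<Longrightarrow> a \<in> {0..1} \<Longrightarrow> \<sigma> s a = {complex_of_real (E s a)}"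
    and projector: "\<And>s a. s \<in> {0..1} \<Longrightarrow> a \<in> {0..1} \<Longrightarrow> P s a = spectral_projector (H s a) (\<sigma> s a)"
  obtains S where "\<And>s a. s \<in> {0..1} \<Longrightarrow> a \<in> {0..1} \<Longrightarrow>
      spectral_splitting (H s a) (E s a) (P s a) (S s a)"
    and "C1_square H" and "C1_square E" and "C1_square P" and "C1_square S"
    and "C1_square (d_t P)" and "C1_square (d_alpha P)"
    and "\<And>s a. s \<in> {0..1} \<Longrightarrow> a \<in> {0..1} \<Longrightarrow> d_alpha E s a *\<^sub>R P s a =
        P s a o\<^sub>L d_alpha H s a o\<^sub>L P s a"
    and "\<And>s a. s \<in> {0..1} \<Longrightarrow> a \<in> {0..1} \<Longrightarrow> d_t P s a =
        projector_derivative (d_t H s a) (P s a) (S s a)"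
    and "\<And>s a. s \<in> {0..1} \<Longrightarrow> a \<in> {0..1} \<Longrightarrow> d_alpha P s a =
        projector_derivative (d_alpha H s a) (P s a) (S s a)"
proof -
  obtain g where g: "0 < g" and dist: "\<And>s a z w. s \<in> {0..1} \<Longrightarrow> a \<in> {0..1} \<Longrightarrow> z \<in> \<sigma> s a \<Longrightarrow> w \<in> \<sigma>' s a \<Longrightarrow>
      g \<le> dist z w"
    using gap_hypothesis_distance [OF gap] by blast
  have spec: "complex_of_real (E s a) \<in> op_spectrum (H s a)"
    "\<sigma>' s a = op_spectrum (H s a) - {complex_of_real (E s a)}"
    if "s \<in> {0..1}" "a \<in> {0..1}" for s a
  proof -
    have "op_spectrum (H s a) = \<sigma> s a \<union> \<sigma>' s a" "\<sigma> s a \<inter> \<sigma>' s a = {}"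
      using gap that by (auto simp: gap_hypothesis_def)
    then show "complex_of_real (E s a) \<in> op_spectrum (H s a)"
      "\<sigma>' s a = op_spectrum (H s a) - {complex_of_real (E s a)}"
      using eigenvalue [OF that] by auto
  qed
  have loop: "\<exists>N \<gamma>. open N \<and> p \<in> N \<and> (\<forall>q\<in>N \<inter> unit_square. encircles \<gamma>
      {complex_of_real (E (fst q) (snd q))}
      (op_spectrum (H (fst q) (snd q)) - {complex_of_real (E (fst q) (snd q))}))"
    if p: "p \<in> unit_square" for p
  proof -
    have "\<forall>p\<in>unit_square. \<exists>N \<gamma>. open N \<and> p \<in> N \<and>
        (\<forall>(t, \<alpha>)\<in>N \<inter> unit_square. encircles \<gamma> (\<sigma> t \<alpha>) (\<sigma>' t \<alpha>))"
      using gap unfolding gap_hypothesis_def by (elim conjE)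
    from bspec [OF this p] obtain N \<gamma> where N: "open N" "p \<in> N"
      "\<forall>(t, \<alpha>)\<in>N \<inter> unit_square. encircles \<gamma> (\<sigma> t \<alpha>) (\<sigma>' t \<alpha>)"
      by (elim exE conjE)
    show ?thesis
    proof (intro exI conjI ballI)
      fix q assume q: "q \<in> N \<inter> unit_square"
      then have "fst q \<in> {0..1}" "snd q \<in> {0..1}" by auto
      then show "encircles \<gamma> {complex_of_real (E (fst q) (snd q))}
          (op_spectrum (H (fst q) (snd q)) - {complex_of_real (E (fst q) (snd q))})"
        using bspec [OF N(3) q] by (simp add: case_prod_beta' eigenvalue spec(2))
    qed (use N in auto)
  qed
  have "\<exists>S. spectral_splitting (H s a) (E s a) (P s a) S \<and> norm S \<le> 2 / g"
    if sa: "s \<in> {0..1}" "a \<in> {0..1}" for s a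
  proof -
    have d: "g \<le> dist (complex_of_real (E s a)) w"
      if "w \<in> op_spectrum (H s a) - {complex_of_real (E s a)}" for w
      using dist [OF sa] eigenvalue [OF sa] spec [OF sa] that by simp
    obtain P' S where PS: "spectral_splitting (H s a) (E s a) P' S" "norm S \<le> 2 / g"
      using isolated_point_splitting [OF selfadjoint [OF sa] g d] by blast
    obtain \<gamma> where "encircles \<gamma> {complex_of_real (E s a)}
        (op_spectrum (H s a) - {complex_of_real (E s a)})"
      using loop [of "(s, a)"] sa by (fastforce dest: bspec [of _ _ "(s, a)"])
    then have "spectral_projector (H s a) (\<sigma> s a) = P'"
      unfolding eigenvalue [OF sa] using spectral_projector_eq [OF PS(1) spec(1) [OF sa] g d]
        by blast
    then show ?thesis using PS projector [OF sa] by auto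
  qed
  then obtain S where split: "\<And>s a. s \<in> {0..1} \<Longrightarrow> a \<in> {0..1} \<Longrightarrow>
      spectral_splitting (H s a) (E s a) (P s a) (S s a)"
    and bound: "\<And>s a. s \<in> {0..1} \<Longrightarrow> a \<in> {0..1} \<Longrightarrow> norm (S s a) \<le> 2 / g"
    by metis
  \<comment> \<open>With a vanishing projector \<open>S\<close> would invert \<open>H - E\<close>,
    although \<open>E\<close> is a spectral value.\<close>
  have nz: "P s a \<noteq> 0" if "s \<in> {0..1}" "a \<in> {0..1}" for s a
  proof
    assume "P s a = 0"
    then have "is_inverse_op (H s a - complex_of_real (E s a) *\<^sub>O id_blinfun) (S s a)"
      using split [OF that] by (simp add: spectral_splitting_def is_inverse_op_def scale_op_of_real)
    then show False using spec(1) [OF that] by (auto simp: op_spectrum_def)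
  qed
  have "Ck_on (Suc 2) (\<lambda>(s, a). H s a) unit_square" using regularity by (simp add: eval_nat_numeral)
  note H3 = Ck_on_Suc_square [OF this]
  have "Ck_on (Suc 1) (\<lambda>(s, a). d_t H s a) unit_square" "Ck_on (Suc 1) (\<lambda>(s, a). d_alpha H s a)
      unit_square"
    using H3 by (simp_all only: Suc_1)
  note H = H3(1) Ck_on_Suc_square(1) [OF this(1)] Ck_on_Suc_square(1) [OF this(2)]
  have E: "continuous_on unit_square (\<lambda>p. E (fst p) (snd p))"
    by (rule eigenvalue_continuous [OF C1_squareD(1) [OF H(1)], where P = "\<lambda>p. P (fst p) (snd p)"
        and S = "\<lambda>p. S (fst p) (snd p)"])
      (use split nz loop in auto)
  note data = spectral_data_C1_square [OF H(1) split nz E bound]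
  have PD: "C1_square (\<lambda>s a. projector_derivative (B s a) (P s a) (S s a))" if "C1_square B" for B
  proof -
    have eq: "projector_derivative (B s a) (P s a) (S s a) =
        (0 - ((S s a o\<^sub>L B s a) o\<^sub>L P s a)) - ((P s a o\<^sub>L B s a) o\<^sub>L S s a)" for s a
      by (simp add: projector_derivative_def)
    show ?thesis
      unfolding eq by (intro C1_square_diff C1_square_compose C1_square_const that data(2,3))
  qed
  have "C1_square (d_t P)" "C1_square (d_alpha P)"
    using C1_square_cong [OF PD [OF H(2)], of "d_t P"]
        C1_square_cong [OF PD [OF H(3)], of "d_alpha P"] data(5,6)
    by auto
  then show ?thesis
    using that [OF split H(1) data(1-3) _ _ data(4-6)] by blast
qed

section \<open>Unitary evolutions\<close>

lemma vector_derivative_bound: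
  fixes f :: "real \<Rightarrow> 'b::real_normed_vector"
  assumes "convex T" and f: "\<And>r. r \<in> T \<Longrightarrow> (f has_vector_derivative f' r) (at r within T)"
    and B: "\<And>r. r \<in> T \<Longrightarrow> norm (f' r) \<le> B" and "x \<in> T" "y \<in> T"
  shows "norm (f x - f y) \<le> B * \<bar>x - y\<bar>"
proof -
  have "norm (f x - f y) \<le> B * norm (x - y)"
  proof (rule differentiable_bound [OF assms(1) _ _ assms(4,5)])
    show "(f has_derivative (\<lambda>h. h *\<^sub>R f' r)) (at r within T)" if "r \<in> T" for r
      using f [OF that] by (simp add: has_vector_derivative_def)
    show "onorm (\<lambda>h. h *\<^sub>R f' r) \<le> B" if "r \<in> T" for r
    proof (rule onorm_bound)
      show "0 \<le> B" using B [OF that] norm_ge_zero order_trans by blast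
      show "norm (h *\<^sub>R f' r) \<le> B * norm h" for h
        using mult_right_mono [OF B [OF that], of "\<bar>h\<bar>"] by (simp add: mult.commute)
    qed
  qed
  then show ?thesis by simp
qed

lemma has_vector_derivative_continuous_on:
  "(\<And>r. r \<in> T \<Longrightarrow> (f has_vector_derivative f' r) (at r within T)) \<Longrightarrow> continuous_on T f"
  unfolding continuous_on_eq_continuous_within using has_vector_derivative_continuous by blast

text \<open>The coefficient is imaginary and \<open>A\<close> symmetric, so the derivative cancels.
  Stated for arbitrary solution curves, it serves both for conservation of inner products and,
  applied to a curve starting at 0, for uniqueness.\<close>

lemma evolution_cinner_constant:
  fixes y z :: "real \<Rightarrow> 'a::complex_hilbert"
  assumes A: "\<And>s. s \<in> {0..1} \<Longrightarrow> selfadjoint_op (A s)"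
    and y: "\<And>s. s \<in> {0..1} \<Longrightarrow> (y has_vector_derivative (- \<i> / complex_of_real c) *\<^sub>C A s (y s))
        (at s within {0..1})"
    and z: "\<And>s. s \<in> {0..1} \<Longrightarrow> (z has_vector_derivative (- \<i> / complex_of_real c) *\<^sub>C A s (z s))
        (at s within {0..1})"
    and s: "s \<in> {0..1}"
  shows "cinner (y s) (z s) = cinner (y 0) (z 0)"
proof -
  have "((\<lambda>s. cinner (y s) (z s)) has_vector_derivative 0) (at s within {0..1})" if "s \<in> {0..1}"
    for s
  proof -
    have "cinner (y s) ((- \<i> / complex_of_real c) *\<^sub>C A s (z s)) +
        cinner ((- \<i> / complex_of_real c) *\<^sub>C A s (y s)) (z s) = 0"
      using A [OF that] by (simp add: cinner_scaleC_left cinner_scaleC_right selfadjoint_op_def)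
    then show ?thesis
      using bounded_bilinear.has_vector_derivative [OF bounded_bilinear_cinner y [OF that]
          z [OF that]] by simp
  qed
  then obtain k where "\<And>s. s \<in> {0..1} \<Longrightarrow> cinner (y s) (z s) = k"
    using has_vector_derivative_zero_constant [of "{0..1}" "\<lambda>s. cinner (y s) (z s)"] by auto
  then show ?thesis using s by auto
qed

lemma solves_evolution_has_vector_derivative:
  assumes V: "solves_evolution c A V" and c: "c \<noteq> 0" and s: "s \<in> {0..1}"
  shows "(V has_vector_derivative (- \<i> / complex_of_real c) *\<^sub>O (A s o\<^sub>L V s)) (at s within {0..1})"
proof -
  obtain V' where V': "(V has_vector_derivative V') (at s within {0..1})"
    "(\<i> * complex_of_real c) *\<^sub>O V' = A s o\<^sub>L V s"
    using V s unfolding solves_evolution_def by blast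
  have "(- \<i> / complex_of_real c) *\<^sub>O ((\<i> * complex_of_real c) *\<^sub>O V') = V'"
    using c by (simp add: scale_op_scale_op)
  then show ?thesis using V' by simp
qed

context
  fixes A V :: "real \<Rightarrow> 'a::complex_hilbert operator" and c :: real
  assumes V: "solves_evolution c A V" and c: "c \<noteq> 0"
    and A: "\<And>s. s \<in> {0..1} \<Longrightarrow> selfadjoint_op (A s)"
begin

private lemma dV: "s \<in> {0..1} \<Longrightarrow>
    (V has_vector_derivative (- \<i> / complex_of_real c) *\<^sub>O (A s o\<^sub>L V s)) (at s within {0..1})"
  by (rule solves_evolution_has_vector_derivative [OF V c])

private lemma V0: "V 0 = id_blinfun" using V by (simp add: solves_evolution_def)

private lemma dVx: "s \<in> {0..1} \<Longrightarrow>
    ((\<lambda>s. V s x) has_vector_derivative (- \<i> / complex_of_real c) *\<^sub>C A s (V s x))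
        (at s within {0..1})"
  using bounded_linear.has_vector_derivative [OF blinfun.bounded_linear_left dV] by simp

lemma evolution_cinner: "s \<in> {0..1} \<Longrightarrow> cinner (V s x) (V s y) = cinner x y"
  using evolution_cinner_constant [where A = A, OF A dVx dVx] by (simp add: V0)

lemma evolution_isometry: "s \<in> {0..1} \<Longrightarrow> norm (V s x) = norm x"
proof -
  assume "s \<in> {0..1}"
  then have "complex_of_real ((norm (V s x))\<^sup>2) = complex_of_real ((norm x)\<^sup>2)"
    using evolution_cinner [of s x x] by (simp only: cinner_self)
  then show ?thesis by (simp only: of_real_eq_iff) simp
qed

text \<open>The defect of complex linearity solves the same equation with initial value 0, and its
  norm is conserved.\<close>

lemma evolution_complex_linear:
  assumes s: "s \<in> {0..1}"
  shows "complex_linear_op (V s)"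
  unfolding complex_linear_op_def
proof (intro allI)
  fix k x
  define y where "y s = V s (k *\<^sub>C x) - k *\<^sub>C V s x" for s
  have "(y has_vector_derivative (- \<i> / complex_of_real c) *\<^sub>C A s (y s)) (at s within {0..1})"
    if "s \<in> {0..1}" for s
  proof -
    have "(y has_vector_derivative (- \<i> / complex_of_real c) *\<^sub>C A s (V s (k *\<^sub>C x)) -
        k *\<^sub>C ((- \<i> / complex_of_real c) *\<^sub>C A s (V s x))) (at s within {0..1})"
      unfolding y_def
      by (intro has_vector_derivative_diff dVx that bounded_linear.has_vector_derivative
          [OF bounded_linear_scaleC])
    moreover have "k *\<^sub>C ((- \<i> / complex_of_real c) *\<^sub>C A s (V s x)) =
        (- \<i> / complex_of_real c) *\<^sub>C A s (k *\<^sub>C V s x)"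
      using A [OF that] by (simp add: selfadjoint_op_def complex_linear_op_def scaleC_scaleC
          mult.commute)
    ultimately show ?thesis
      by (simp add: y_def blinfun.diff_right
          linear_diff [OF bounded_linear.linear [OF bounded_linear_scaleC]])
  qed
  from evolution_cinner_constant [where A = A, OF A this this s]
  have "cinner (y s) (y s) = 0" by (simp add: y_def V0)
  then show "V s (k *\<^sub>C x) = k *\<^sub>C V s x" by (simp add: cinner_self y_def)
qed

private lemma inverse_norm:
  assumes "s \<in> {0..1}" "is_inverse_op (V s) B"
  shows "norm B \<le> 1"
proof (rule norm_blinfun_bound)
  fix x
  have "V s (B x) = x"
    using assms(2) unfolding is_inverse_op_def
    by (metis blinfun_apply_blinfun_compose blinfun_apply_id_blinfun)
  then show "norm (B x) \<le> 1 * norm x" using evolution_isometry [OF assms(1), of "B x"] by simp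
qed simp

text \<open>Adjoints are not available, so surjectivity is propagated along \<open>[0, 1]\<close> in small steps.\<close>

lemma evolution_inverse:
  assumes s: "s \<in> {0..1}"
  shows "is_inverse_op (V s) (inverse_op (V s))"
proof -
  have "continuous_on {0..1} V"
    by (rule has_vector_derivative_continuous_on [OF dV])
  then have "uniformly_continuous_on {0..1} V" by (rule compact_uniformly_continuous) simp
  then obtain d where d: "d > 0" "\<And>r s. r \<in> {0..1} \<Longrightarrow> s \<in> {0..1} \<Longrightarrow> dist s r < d \<Longrightarrow>
      dist (V s) (V r) < 1"
    unfolding uniformly_continuous_on_def using zero_less_one by blast
  \<comment> \<open>Inverses of isometries have norm at most 1, so invertibility at \<open>r\<close>
    extends to all points within \<open>d\<close>. The step \<open>d / 2\<close> is thus uniform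
    along the interval.\<close>
  have "\<forall>s\<in>{0..1}. s \<le> real n * (d / 2) \<longrightarrow> (\<exists>B. is_inverse_op (V s) B)" for n
  proof (induction n)
    case 0
    show ?case by (auto simp: V0 is_inverse_op_def intro!: exI [of _ id_blinfun])
  next
    case (Suc n)
    show ?case
    proof (intro ballI impI)
      fix s :: real assume s: "s \<in> {0..1}" "s \<le> real (Suc n) * (d / 2)"
      define r where "r = max 0 (s - d / 2)"
      have r: "r \<in> {0..1}" "r \<le> real n * (d / 2)" "dist s r < d"
        using s d(1) by (auto simp: r_def dist_real_def algebra_simps max_def)
      then obtain B where B: "is_inverse_op (V r) B" using Suc by blast
      have "norm (V r - V s) * norm B \<le> norm (V r - V s) * 1"
        by (intro mult_left_mono inverse_norm [OF r(1) B]) simp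
      also have "\<dots> < 1" using d(2) [OF r(1) s(1) r(3)] by (simp add: dist_norm norm_minus_commute)
      finally obtain B' where "is_inverse_op (V r - (V r - V s)) B'"
        using is_inverse_op_perturb [OF B] by blast
      then show "\<exists>B. is_inverse_op (V s) B" by auto
    qed
  qed
  moreover obtain n where "s / (d / 2) < real n" using reals_Archimedean2 by blast
  then have "s \<le> real n * (d / 2)" using d(1) by (simp add: field_simps)
  ultimately show ?thesis using s is_inverse_op_inverse_op by blast
qed

lemma evolution_norm: "s \<in> {0..1} \<Longrightarrow> norm (V s) \<le> 1" "s \<in> {0..1} \<Longrightarrow> norm (inverse_op (V s)) \<le> 1"
  using evolution_isometry inverse_norm [OF _ evolution_inverse]
  by (auto intro!: norm_blinfun_bound)

lemma evolution_inverse_complex_linear: "s \<in> {0..1} \<Longrightarrow> complex_linear_op (inverse_op (V s))"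
  using is_inverse_op_complex_linear [OF evolution_inverse evolution_complex_linear] .

lemma evolution_adjoint: "s \<in> {0..1} \<Longrightarrow> adjoint_pair (V s) (inverse_op (V s))"
  unfolding adjoint_pair_def
proof (intro allI)
  fix x y assume s: "s \<in> {0..1}"
  have "V s (inverse_op (V s) y) = y"
    using evolution_inverse [OF s] unfolding is_inverse_op_def
    by (metis blinfun_apply_blinfun_compose blinfun_apply_id_blinfun)
  then show "cinner (V s x) y = cinner x (inverse_op (V s) y)"
    using evolution_cinner [OF s, of x "inverse_op (V s) y"] by simp
qed

lemma evolution_has_vector_derivative: "s \<in> {0..1} \<Longrightarrow>
    (V has_vector_derivative (- \<i> / complex_of_real c) *\<^sub>O (A s o\<^sub>L V s)) (at s within {0..1})"
  by (rule dV)

lemma evolution_inverse_has_vector_derivative: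
  assumes s: "s \<in> {0..1}"
  shows "((\<lambda>s. inverse_op (V s)) has_vector_derivative
    (\<i> / complex_of_real c) *\<^sub>O (inverse_op (V s) o\<^sub>L A s)) (at s within {0..1})"
proof -
  have "((\<lambda>s. inverse_op (V s)) has_vector_derivative
      - (inverse_op (V s) o\<^sub>L (- \<i> / complex_of_real c) *\<^sub>O (A s o\<^sub>L V s) o\<^sub>L inverse_op (V s)))
          (at s within {0..1})"
    by (rule inverse_has_vector_derivative [OF evolution_inverse s dV [OF s]])
  moreover have "inverse_op (V s) o\<^sub>L (- \<i> / complex_of_real c) *\<^sub>O (A s o\<^sub>L V s)
      o\<^sub>L inverse_op (V s)
      = (- \<i> / complex_of_real c) *\<^sub>O ((inverse_op (V s) o\<^sub>L A s) o\<^sub>L (V s o\<^sub>L inverse_op (V s)))"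
    by (simp only: compose_scale_op_right [OF evolution_inverse_complex_linear [OF s]]
        compose_scale_op_left compose_assoc)
  ultimately show ?thesis
    using evolution_inverse [OF s] by (simp add: is_inverse_op_def scale_op_simps)
qed

lemma evolution_continuous:
  "continuous_on {0..1} V" "continuous_on {0..1} (\<lambda>s. inverse_op (V s))"
  by (rule has_vector_derivative_continuous_on [OF dV] |
      rule has_vector_derivative_continuous_on [OF evolution_inverse_has_vector_derivative] |
          assumption)+

end

section \<open>Parallel transport\<close>

lemma adjoint_pair_derivative:
  fixes F :: "real \<Rightarrow> 'a::complex_hilbert operator"
  assumes F: "(F has_vector_derivative F') (at s within {0..1})" and s: "s \<in> {0..1}"
    and adj: "\<And>r. r \<in> {0..1} \<Longrightarrow> adjoint_pair (F r) (F r)"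
  shows "adjoint_pair F' F'"
  unfolding adjoint_pair_def
proof (intro allI)
  fix x y
  have "((\<lambda>r. F r x) has_vector_derivative F' x) (at s within {0..1})" for x
    by (rule bounded_linear.has_vector_derivative [OF blinfun.bounded_linear_left F])
  then have "((\<lambda>r. cinner (F r x) y - cinner x (F r y)) has_vector_derivative
      cinner (F' x) y - cinner x (F' y)) (at s within {0..1})"
    by (intro has_vector_derivative_diff
        bounded_linear.has_vector_derivative
            [OF bounded_bilinear.bounded_linear_left [OF bounded_bilinear_cinner]]
        bounded_linear.has_vector_derivative
            [OF bounded_bilinear.bounded_linear_right [OF bounded_bilinear_cinner]])
  then have "((\<lambda>r. 0) has_vector_derivative cinner (F' x) y - cinner x (F' y)) (at s within {0..1})"
    by (rule has_vector_derivative_transform [OF s, rotated])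
        (use adj in \<open>auto simp: adjoint_pair_def\<close>)
  then have "cinner (F' x) y - cinner x (F' y) = 0"
    using vector_derivative_unique_within [OF at_within_unit_interval [OF s] _
        has_vector_derivative_const] by blast
  then show "cinner (F' x) y = cinner x (F' y)" by simp
qed

lemma complex_linear_derivative:
  fixes F :: "real \<Rightarrow> 'a::complex_hilbert operator"
  assumes F: "(F has_vector_derivative F') (at s within {0..1})" and s: "s \<in> {0..1}"
    and lin: "\<And>r. r \<in> {0..1} \<Longrightarrow> complex_linear_op (F r)"
  shows "complex_linear_op F'"
  unfolding complex_linear_op_def
proof (intro allI)
  fix k x
  have "((\<lambda>r. F r x) has_vector_derivative F' x) (at s within {0..1})" for x
    by (rule bounded_linear.has_vector_derivative [OF blinfun.bounded_linear_left F])
  then have "((\<lambda>r. F r (k *\<^sub>C x) - k *\<^sub>C F r x) has_vector_derivative F' (k *\<^sub>C x) - k *\<^sub>C F' x)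
      (at s within {0..1})"
    by (intro has_vector_derivative_diff bounded_linear.has_vector_derivative
        [OF bounded_linear_scaleC])
  then have "((\<lambda>r. 0) has_vector_derivative F' (k *\<^sub>C x) - k *\<^sub>C F' x) (at s within {0..1})"
    by (rule has_vector_derivative_transform [OF s, rotated])
        (use lin in \<open>auto simp: complex_linear_op_def\<close>)
  then have "F' (k *\<^sub>C x) - k *\<^sub>C F' x = 0"
    using vector_derivative_unique_within [OF at_within_unit_interval [OF s] _
        has_vector_derivative_const] by blast
  then show "F' (k *\<^sub>C x) = k *\<^sub>C F' x" by simp
qed

lemma commutator_generator_selfadjoint:
  assumes "adjoint_pair A A" "adjoint_pair B B" "complex_linear_op A" "complex_linear_op B"
  shows "selfadjoint_op (\<i> *\<^sub>O commutator_op A B)"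
  using assms unfolding selfadjoint_op_def
  by (simp add: commutator_op_def complex_linear_op_intros adjoint_pair_def blinfun.bilinear_simps
      cinner_scaleC_left cinner_scaleC_right cinner_diff_left cinner_diff_right algebra_simps)

text \<open>Writing \<open>K = i L\<close>, the generator of the transport equation is \<open>L\<close>.\<close>

lemma transport_has_vector_derivative:
  assumes W: "solves_evolution 1 (\<lambda>s. \<i> *\<^sub>O L s) W"
    and K: "\<And>s. s \<in> {0..1} \<Longrightarrow> selfadjoint_op (\<i> *\<^sub>O L s)" and s: "s \<in> {0..1}"
  shows "(W has_vector_derivative L s o\<^sub>L W s) (at s within {0..1})"
    and "((\<lambda>s. inverse_op (W s)) has_vector_derivative - (inverse_op (W s) o\<^sub>L L s))
        (at s within {0..1})"
proof -
  note E = evolution_has_vector_derivative [OF W _ K] evolution_inverse_has_vector_derivative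
      [OF W _ K]
  show "(W has_vector_derivative L s o\<^sub>L W s) (at s within {0..1})"
    using E(1) [OF _ _ s] by (simp add: compose_scale_op_left scale_op_scale_op)
  show "((\<lambda>s. inverse_op (W s)) has_vector_derivative - (inverse_op (W s) o\<^sub>L L s))
      (at s within {0..1})"
    using E(2) [OF _ _ s] evolution_inverse_complex_linear [OF W _ K s]
    by (simp add: compose_scale_op_right scale_op_scale_op scale_op_simps)
qed

text \<open>Compressing the second hypothesis by \<open>P\<close> on both sides gives
  \<open>P P1 P = 2 P P1 P\<close>.\<close>

lemma projection_derivative_block:
  fixes P P1 :: "'a::complex_hilbert operator"
  assumes "P o\<^sub>L P = P" and "P1 = (P1 o\<^sub>L P) + (P o\<^sub>L P1)"
  shows "P o\<^sub>L P1 o\<^sub>L P = 0"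
proof -
  have PPX: "P o\<^sub>L (P o\<^sub>L X) = P o\<^sub>L X" for X by (metis assms(1) compose_assoc)
  have "P o\<^sub>L P1 o\<^sub>L P = P o\<^sub>L ((P1 o\<^sub>L P) + (P o\<^sub>L P1)) o\<^sub>L P" by (simp only: assms(2) [symmetric])
  also have "\<dots> = (P o\<^sub>L P1 o\<^sub>L P) + (P o\<^sub>L P1 o\<^sub>L P)"
    by (simp add: op_simps PPX assms(1))
  finally show ?thesis by simp
qed

text \<open>The generator \<open>L = [P1, P]\<close> satisfies \<open>[L, P] = P1\<close>, so the
  conjugated projector \<open>W^-1 P W\<close> has derivative
  \<open>W^-1 (P1 + P L - L P) W = 0\<close> and keeps its initial value \<open>P 0\<close>.\<close>

lemma transport_intertwines:
  assumes W: "solves_evolution 1 (\<lambda>s. \<i> *\<^sub>O commutator_op (P1 s) (P s)) W"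
    and K: "\<And>s. s \<in> {0..1} \<Longrightarrow> selfadjoint_op (\<i> *\<^sub>O commutator_op (P1 s) (P s))"
    and P: "\<And>s. s \<in> {0..1} \<Longrightarrow> (P has_vector_derivative P1 s) (at s within {0..1})"
    and PP: "\<And>s. s \<in> {0..1} \<Longrightarrow> P s o\<^sub>L P s = P s"
    and block: "\<And>s. s \<in> {0..1} \<Longrightarrow> P1 s = (P1 s o\<^sub>L P s) + (P s o\<^sub>L P1 s)"
    and s: "s \<in> {0..1}"
  shows "P s o\<^sub>L W s = W s o\<^sub>L P 0" and "inverse_op (W s) o\<^sub>L P s = P 0 o\<^sub>L inverse_op (W s)"
proof -
  have inv: "is_inverse_op (W s) (inverse_op (W s))" if "s \<in> {0..1}" for s
    by (rule evolution_inverse [OF W _ K that]) simp_all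
  have W0: "W 0 = id_blinfun" using W by (simp add: solves_evolution_def)
  have "((\<lambda>s. inverse_op (W s) o\<^sub>L (P s o\<^sub>L W s)) has_vector_derivative 0) (at s within {0..1})"
    if s: "s \<in> {0..1}" for s
  proof -
    let ?L = "commutator_op (P1 s) (P s)"
    have PPX: "P s o\<^sub>L (P s o\<^sub>L X) = P s o\<^sub>L X" for X by (metis PP [OF s] compose_assoc)
    have PP1P: "P s o\<^sub>L (P1 s o\<^sub>L P s) = 0" 
      using projection_derivative_block [OF PP [OF s] block [OF s]] by (simp add: compose_assoc)
    have "P1 s + (P s o\<^sub>L ?L) - (?L o\<^sub>L P s) = 0"
      using block [OF s] by (simp add: commutator_op_def op_simps PP [OF s] PPX PP1P algebra_simps)
    moreover have "((\<lambda>s. inverse_op (W s) o\<^sub>L (P s o\<^sub>L W s)) has_vector_derivative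
        (inverse_op (W s) o\<^sub>L ((P s o\<^sub>L (?L o\<^sub>L W s)) + (P1 s o\<^sub>L W s)))
        + (- (inverse_op (W s) o\<^sub>L ?L) o\<^sub>L (P s o\<^sub>L W s))) (at s within {0..1})"
      by (intro has_vector_derivative_compose_op transport_has_vector_derivative [OF W K] P s)
    moreover have "(inverse_op (W s) o\<^sub>L ((P s o\<^sub>L (?L o\<^sub>L W s)) + (P1 s o\<^sub>L W s)))
        + (- (inverse_op (W s) o\<^sub>L ?L) o\<^sub>L (P s o\<^sub>L W s)) =
        inverse_op (W s) o\<^sub>L (P1 s + (P s o\<^sub>L ?L) - (?L o\<^sub>L P s)) o\<^sub>L W s"
      by (simp only: op_simps) simp
    ultimately show ?thesis by simp
  qed
  then obtain k where k: "\<And>s. s \<in> {0..1} \<Longrightarrow> inverse_op (W s) o\<^sub>L (P s o\<^sub>L W s) = k"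
    using has_vector_derivative_zero_constant [of "{0..1}" "\<lambda>s. inverse_op (W s) o\<^sub>L (P s o\<^sub>L W s)"]
      by auto
  have "k = P 0" using k [of 0] inv [of 0] by (simp add: W0 is_inverse_op_def)
  then have eq: "inverse_op (W s) o\<^sub>L (P s o\<^sub>L W s) = P 0" using k s by simp
  have "W s o\<^sub>L (inverse_op (W s) o\<^sub>L (P s o\<^sub>L W s)) = P s o\<^sub>L W s"
    using inv [OF s] by (simp add: is_inverse_op_def compose_assoc [symmetric])
  then show "P s o\<^sub>L W s = W s o\<^sub>L P 0" by (simp add: eq)
  have "(inverse_op (W s) o\<^sub>L (P s o\<^sub>L W s)) o\<^sub>L inverse_op (W s) = inverse_op (W s) o\<^sub>L P s"
    using inv [OF s] by (simp add: is_inverse_op_def compose_assoc)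
  then show "inverse_op (W s) o\<^sub>L P s = P 0 o\<^sub>L inverse_op (W s)" by (simp add: eq)
qed

text \<open>Uniform continuity of \<open>d_alpha L\<close> on the compact square makes the
  linearization error uniform in \<open>s\<close>, as needed to integrate it over
  \<open>s\<close>.\<close>

lemma C1_square_uniform_difference:
  fixes L :: "real \<Rightarrow> real \<Rightarrow> 'b::real_normed_vector"
  assumes L: "C1_square L" and \<alpha>: "\<alpha> \<in> {0..1}" and e: "0 < e"
  obtains d where "0 < d" and "\<And>s a. s \<in> {0..1} \<Longrightarrow> a \<in> {0..1} \<Longrightarrow> \<bar>a - \<alpha>\<bar> < d \<Longrightarrow>
    norm (L s a - L s \<alpha> - (a - \<alpha>) *\<^sub>R d_alpha L s \<alpha>) \<le> e * \<bar>a - \<alpha>\<bar>"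
proof -
  have "uniformly_continuous_on unit_square (\<lambda>p. d_alpha L (fst p) (snd p))"
    by (rule compact_uniformly_continuous [OF C1_squareD(3) [OF L]])
        (intro compact_Times compact_Icc)
  then obtain d where d: "0 < d" and unif: "\<And>p q. p \<in> unit_square \<Longrightarrow> q \<in> unit_square \<Longrightarrow> dist q p < d \<Longrightarrow>
      dist (d_alpha L (fst q) (snd q)) (d_alpha L (fst p) (snd p)) < e"
    unfolding uniformly_continuous_on_def using e by blast
  have "norm (L s a - L s \<alpha> - (a - \<alpha>) *\<^sub>R d_alpha L s \<alpha>) \<le> e * \<bar>a - \<alpha>\<bar>"
    if s: "s \<in> {0..1}" and a: "a \<in> {0..1}" and close: "\<bar>a - \<alpha>\<bar> < d" for s a
  proof -
    define T where "T = {0..1} \<inter> ball \<alpha> d"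
    have T: "convex T" "a \<in> T" "\<alpha> \<in> T" "T \<subseteq> {0..1}"
      using a \<alpha> close d by (auto simp: T_def dist_real_def convex_Int)
    \<comment> \<open>The mean value bound is applied to \<open>L\<close> minus its linear part at
      \<alpha>, whose derivative is small on \<open>T\<close>.\<close>
    have "norm ((L s a - (a - \<alpha>) *\<^sub>R d_alpha L s \<alpha>) - (L s \<alpha> - (\<alpha> - \<alpha>) *\<^sub>R d_alpha L s \<alpha>)) \<le>
        e * \<bar>a - \<alpha>\<bar>"
    proof (rule vector_derivative_bound [OF T(1) _ _ T(2,3)])
      fix b assume b: "b \<in> T"
      then have b': "b \<in> {0..1}" using T by auto
      have "((\<lambda>b. L s b) has_vector_derivative d_alpha L s b) (at b within T)"
        by (rule has_vector_derivative_within_subset [OF C1_squareD(5) [OF L s b'] T(4)])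
      moreover have "((\<lambda>b. (b - \<alpha>) *\<^sub>R d_alpha L s \<alpha>) has_vector_derivative d_alpha L s \<alpha>)
          (at b within T)"
        by (auto intro!: derivative_eq_intros)
      ultimately show "((\<lambda>b. L s b - (b - \<alpha>) *\<^sub>R d_alpha L s \<alpha>) has_vector_derivative
          d_alpha L s b - d_alpha L s \<alpha>) (at b within T)"
        by (rule has_vector_derivative_diff)
      show "norm (d_alpha L s b - d_alpha L s \<alpha>) \<le> e"
        using unif [of "(s, \<alpha>)" "(s, b)"] b b' s \<alpha>
        by (auto simp: T_def dist_norm dist_Pair_Pair norm_minus_commute abs_minus_commute)
    qed
    then show ?thesis by (simp add: algebra_simps)
  qed
  then show ?thesis using that [of d] d by blast
qed

text \<open>The relative evolution \<open>X\<close>, the inverse of \<open>W\<close> at \<alpha>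
  times \<open>W\<close> at \<open>a\<close>, starts at the identity and has a derivative in
  \<open>s\<close> proportional to \<open>L s a - L s \<alpha>\<close>. Linearizing in
  \<open>a\<close> and integrating gives Duhamel's formula; that \<open>W\<close> is differentiable
  in \<alpha> is part of the outcome.\<close>

lemma transport_parameter_derivative:
  fixes L W :: "real \<Rightarrow> real \<Rightarrow> 'a::complex_hilbert operator"
  assumes L: "C1_square L"
    and K: "\<And>s a. s \<in> {0..1} \<Longrightarrow> a \<in> {0..1} \<Longrightarrow> selfadjoint_op (\<i> *\<^sub>O L s a)"
    and W: "\<And>a. a \<in> {0..1} \<Longrightarrow> solves_evolution 1 (\<lambda>s. \<i> *\<^sub>O L s a) (\<lambda>s. W s a)"
    and t: "t \<in> {0..1}" and \<alpha>: "\<alpha> \<in> {0..1}"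
  shows "inverse_op (W t \<alpha>) o\<^sub>L d_alpha W t \<alpha> =
    integral {0..t} (\<lambda>s. inverse_op (W s \<alpha>) o\<^sub>L d_alpha L s \<alpha> o\<^sub>L W s \<alpha>)"
proof -
  define Wi where "Wi s = inverse_op (W s \<alpha>)" for s
  have nW: "norm (W s a) \<le> 1" if "s \<in> {0..1}" "a \<in> {0..1}" for s a
    by (rule evolution_norm(1) [OF W [OF that(2)]]) (use K that in auto)
  have nWi: "norm (Wi s) \<le> 1" if "s \<in> {0..1}" for s
    unfolding Wi_def by (rule evolution_norm(2) [OF W [OF \<alpha>]]) (use K \<alpha> that in auto)
  have inv: "is_inverse_op (W s \<alpha>) (Wi s)" if "s \<in> {0..1}" for s
    unfolding Wi_def by (rule evolution_inverse [OF W [OF \<alpha>]]) (use K \<alpha> that in auto)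
  have dW: "((\<lambda>s. W s a) has_vector_derivative L s a o\<^sub>L W s a) (at s within {0..1})"
    if "s \<in> {0..1}" "a \<in> {0..1}" for s a
    by (rule transport_has_vector_derivative(1) [OF W [OF that(2)]]) (use K that in auto)
  have dWi: "(Wi has_vector_derivative - (Wi s o\<^sub>L L s \<alpha>)) (at s within {0..1})" if "s \<in> {0..1}"
    for s
    unfolding Wi_def by (rule transport_has_vector_derivative(2) [OF W [OF \<alpha>]])
        (use K \<alpha> that in auto)
  define L' where "L' s = d_alpha L s \<alpha>" for s
  have contL': "continuous_on {0..1} L'"
    unfolding L'_def by (rule continuous_on_square_line(1) [OF C1_squareD(3) [OF L] \<alpha>])
  then have "bounded (L' ` {0..1})" by (intro compact_imp_bounded compact_continuous_image) auto
  then obtain M where M: "0 < M" "\<And>s. s \<in> {0..1} \<Longrightarrow> norm (L' s) \<le> M" by (auto simp: bounded_pos)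
  define G where "G s = integral {0..s} (\<lambda>s. Wi s o\<^sub>L L' s o\<^sub>L W s \<alpha>)" for s
  have "continuous_on {0..1} (\<lambda>s. W s \<alpha>)" "continuous_on {0..1} Wi"
    by (rule has_vector_derivative_continuous_on; use dW dWi \<alpha> in blast)+
  then have dG: "(G has_vector_derivative Wi s o\<^sub>L L' s o\<^sub>L W s \<alpha>) (at s within {0..1})"
    if "s \<in> {0..1}" for s
    unfolding G_def by (intro integral_has_vector_derivative that continuous_intros contL')
  have G0: "G 0 = 0" by (simp add: G_def)
  have W0: "W 0 a = id_blinfun" if "a \<in> {0..1}" for a using W [OF that]
    by (simp add: solves_evolution_def)
  have Wi0: "Wi 0 = id_blinfun" using inv [of 0] \<alpha> by (simp add: W0 is_inverse_op_def)
  define X where "X s a = Wi s o\<^sub>L W s a" for s a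
  have X0: "X 0 a = id_blinfun" if "a \<in> {0..1}" for a using that by (simp add: X_def W0 Wi0)
  have dX: "((\<lambda>s. X s a) has_vector_derivative Wi s o\<^sub>L (L s a - L s \<alpha>) o\<^sub>L W s a)
      (at s within {0..1})"
    if "s \<in> {0..1}" "a \<in> {0..1}" for s a
  proof -
    have "((\<lambda>s. X s a) has_vector_derivative
        (Wi s o\<^sub>L (L s a o\<^sub>L W s a)) + (- (Wi s o\<^sub>L L s \<alpha>) o\<^sub>L W s a)) (at s within {0..1})"
      unfolding X_def by (intro has_vector_derivative_compose_op dW dWi that)
    then show ?thesis by (simp add: op_simps)
  qed
  have "((\<lambda>a. X t a) has_vector_derivative G t) (at \<alpha> within {0..1})"
    unfolding has_vector_derivative_def has_derivative_within_alt2
  proof (intro conjI allI impI bounded_linear_scaleR_left)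
    fix e :: real assume e: "e > 0"
    obtain d where d: "0 < d" and diff: "\<And>s a. s \<in> {0..1} \<Longrightarrow> a \<in> {0..1} \<Longrightarrow> \<bar>a - \<alpha>\<bar> < d \<Longrightarrow>
        norm (L s a - L s \<alpha> - (a - \<alpha>) *\<^sub>R d_alpha L s \<alpha>) \<le> e / 2 * \<bar>a - \<alpha>\<bar>"
      using C1_square_uniform_difference [OF L \<alpha>, of "e / 2"] e by auto
    \<comment> \<open>\<open>N * \<delta>\<close> bounds the error of replacing \<open>W s a\<close>
      by \<open>W s \<alpha>\<close>: a factor \<open>M\<close> from \<open>L'\<close> and
      \<open>M + e / 2\<close> from \<open>close\<close>. The choice of \<open>d'\<close> keeps it
      below \<open>e / 2\<close>; the other half of \<open>e\<close> is the linearization error of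
      \<open>L\<close>.\<close>
    define N where "N = M * (M + e / 2)"
    have N: "0 < N" using M e by (auto simp: N_def intro!: mult_pos_pos)
    define d' where "d' = min d (e / 2 / N)"
    have d': "0 < d'" using d e N by (auto simp: d'_def)
    have key: "norm (X t a - X t \<alpha> - (a - \<alpha>) *\<^sub>R G t) \<le> e * norm (a - \<alpha>)"
      if a: "a \<in> {0..1}" "\<bar>a - \<alpha>\<bar> < d'" for a
    proof -
      define \<delta> where "\<delta> = \<bar>a - \<alpha>\<bar>"
      have \<delta>: "0 \<le> \<delta>" "\<delta> < d" "N * \<delta> \<le> e / 2"
        using a N by (auto simp: \<delta>_def d'_def field_simps)
      have dL: "norm (L s a - L s \<alpha>) \<le> (M + e / 2) * \<delta>" if s: "s \<in> {0..1}" for s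
      proof -
        have "norm (L s a - L s \<alpha>) \<le> norm (L s a - L s \<alpha> - (a - \<alpha>) *\<^sub>R L' s) +
            norm ((a - \<alpha>) *\<^sub>R L' s)"
          by (metis diff_add_cancel norm_triangle_ineq)
        also have "\<dots> \<le> e / 2 * \<delta> + \<delta> * M"
          using diff [OF s a(1)] \<delta>(2) mult_left_mono [OF M(2) [OF s] \<delta>(1)]
          by (simp add: L'_def \<delta>_def)
        finally show ?thesis by (simp add: algebra_simps)
      qed
      \<comment> \<open>\<open>X\<close> departs from the identity by at most its integrated
        derivative, and the contraction \<open>W s \<alpha>\<close> carries this over to
        \<open>W\<close>.\<close>
      have close: "norm (W s a - W s \<alpha>) \<le> (M + e / 2) * \<delta>" if s: "s \<in> {0..1}" for s
      proof -
        have "norm (X s a - X 0 a) \<le> (M + e / 2) * \<delta> * \<bar>s - 0\<bar>"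
        proof (rule vector_derivative_bound [OF _ dX])
          fix r :: real assume r: "r \<in> {0..1}"
          have "norm (Wi r o\<^sub>L (L r a - L r \<alpha>) o\<^sub>L W r a) \<le> 1 * ((M + e / 2) * \<delta>) * 1"
            by (intro norm_compose_le nWi nW dL r a)
          then show "norm (Wi r o\<^sub>L (L r a - L r \<alpha>) o\<^sub>L W r a) \<le> (M + e / 2) * \<delta>" by simp
        qed (use s a in auto)
        also have "\<dots> \<le> (M + e / 2) * \<delta> * 1"
          using s M e \<delta> by (intro mult_left_mono) auto
        finally have "norm (X s a - id_blinfun) \<le> (M + e / 2) * \<delta>" using X0 [OF a(1)] by simp
        moreover have "W s a - W s \<alpha> = W s \<alpha> o\<^sub>L (X s a - id_blinfun)"
          using inv [OF s] by (simp add: X_def op_simps is_inverse_op_def)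
            (metis compose_assoc compose_id(2))
        ultimately show ?thesis
          using norm_compose_le [OF nW [OF s \<alpha>], of "X s a - id_blinfun"] by simp
      qed
      have "norm ((X t a - (a - \<alpha>) *\<^sub>R G t) - (X 0 a - (a - \<alpha>) *\<^sub>R G 0)) \<le> e * \<delta> * \<bar>t - 0\<bar>"
      proof (rule vector_derivative_bound [where T = "{0..1}"])
        fix r :: real assume r: "r \<in> {0..1}"
        show "((\<lambda>s. X s a - (a - \<alpha>) *\<^sub>R G s) has_vector_derivative
            (Wi r o\<^sub>L (L r a - L r \<alpha>) o\<^sub>L W r a) - (a - \<alpha>) *\<^sub>R (Wi r o\<^sub>L L' r o\<^sub>L W r \<alpha>))
                (at r within {0..1})"
          by (intro has_vector_derivative_diff dX r a
              bounded_linear.has_vector_derivative [OF bounded_linear_scaleR_right dG])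
        have "(Wi r o\<^sub>L (L r a - L r \<alpha>) o\<^sub>L W r a) - (a - \<alpha>) *\<^sub>R (Wi r o\<^sub>L L' r o\<^sub>L W r \<alpha>) =
            (Wi r o\<^sub>L (L r a - L r \<alpha> - (a - \<alpha>) *\<^sub>R L' r) o\<^sub>L W r a)
            + (a - \<alpha>) *\<^sub>R (Wi r o\<^sub>L L' r o\<^sub>L (W r a - W r \<alpha>))"
          by (simp add: op_simps algebra_simps)
        also have "norm \<dots> \<le> 1 * (e / 2 * \<delta>) * 1 + \<delta> * (1 * M * ((M + e / 2) * \<delta>))"
        proof (intro order_trans [OF norm_triangle_ineq] add_mono norm_compose_le nWi nW r a)
          show "norm (L r a - L r \<alpha> - (a - \<alpha>) *\<^sub>R L' r) \<le> e / 2 * \<delta>"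
            using diff [OF r a(1)] \<delta>(2) by (simp add: L'_def \<delta>_def)
          have "norm (Wi r o\<^sub>L L' r o\<^sub>L (W r a - W r \<alpha>)) \<le> 1 * M * ((M + e / 2) * \<delta>)"
            by (intro norm_compose_le nWi M close r)
          from mult_left_mono [OF this \<delta>(1)]
          show "norm ((a - \<alpha>) *\<^sub>R (Wi r o\<^sub>L L' r o\<^sub>L (W r a - W r \<alpha>))) \<le>
              \<delta> * (1 * M * ((M + e / 2) * \<delta>))"
            by (simp add: \<delta>_def)
        qed
        also have "\<dots> = \<delta> * (e / 2 + N * \<delta>)" by (simp add: N_def algebra_simps)
        also have "\<dots> \<le> \<delta> * e" using \<delta> by (intro mult_left_mono) auto
        finally show "norm ((Wi r o\<^sub>L (L r a - L r \<alpha>) o\<^sub>L W r a) -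
            (a - \<alpha>) *\<^sub>R (Wi r o\<^sub>L L' r o\<^sub>L W r \<alpha>)) \<le> e * \<delta>"
          by (simp add: mult.commute)
      qed (use t in auto)
      also have "\<dots> \<le> e * \<delta> * 1" using t e \<delta> by (intro mult_left_mono) auto
      finally have "norm (X t a - (a - \<alpha>) *\<^sub>R G t - id_blinfun) \<le> e * \<delta>"
        by (simp add: X0 [OF a(1)] G0)
      moreover have "X t \<alpha> = id_blinfun" using inv [OF t] by (simp add: X_def is_inverse_op_def)
      ultimately show ?thesis by (simp add: \<delta>_def algebra_simps)
    qed
    show "\<forall>\<^sub>F a in at \<alpha> within {0..1}. norm (X t a - X t \<alpha> - (a - \<alpha>) *\<^sub>R G t) \<le> e * norm (a - \<alpha>)"
      unfolding eventually_at using d' key by (intro exI [of _ d']) (auto simp: dist_real_def)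
  qed
  then have "((\<lambda>a. W t \<alpha> o\<^sub>L X t a) has_vector_derivative W t \<alpha> o\<^sub>L G t) (at \<alpha> within {0..1})"
    by (rule bounded_linear.has_vector_derivative
        [OF bounded_bilinear.bounded_linear_right [OF bounded_bilinear_blinfun_compose]])
  moreover have "W t \<alpha> o\<^sub>L X t a = W t a" for a
    using inv [OF t] by (simp add: X_def is_inverse_op_def compose_assoc [symmetric])
  ultimately have "d_alpha W t \<alpha> = W t \<alpha> o\<^sub>L G t"
    unfolding d_alpha_def by (intro vector_derivative_within at_within_unit_interval \<alpha>) simp
  then have "Wi t o\<^sub>L d_alpha W t \<alpha> = G t"
    using inv [OF t] by (simp add: is_inverse_op_def compose_assoc [symmetric])
  then show ?thesis by (simp add: Wi_def G_def L'_def)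
qed

section \<open>Adiabatic estimates\<close>

lemma continuous_on_unit_interval_bound:
  fixes f :: "real \<Rightarrow> 'b::real_normed_vector"
  assumes "continuous_on {0..1} f"
  shows "\<exists>C\<ge>0. \<forall>s\<in>{0..1}. norm (f s) \<le> C"
proof -
  have "bounded (f ` {0..1})" by (intro compact_imp_bounded compact_continuous_image assms) simp
  then show ?thesis by (auto simp: bounded_pos intro: less_imp_le)
qed

text \<open>The setting for one fixed \<alpha>: \<open>A\<close> is \<open>H - E\<close>,
  \<open>P1\<close> and \<open>P11\<close> are the first two t-derivatives of \<open>P\<close>, and
  \<open>S1\<close> is that of \<open>S\<close>. The small parameter enters only with the evolutions
  quantified inside the lemmas, so all constants are independent of it.\<close>

context
  fixes A P S P1 P11 S1 W :: "real \<Rightarrow> 'a::complex_hilbert operator"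
  assumes A: "\<And>s. s \<in> {0..1} \<Longrightarrow> selfadjoint_op (A s)"
    and AP: "\<And>s. s \<in> {0..1} \<Longrightarrow> A s o\<^sub>L P s = 0"
    and PA: "\<And>s. s \<in> {0..1} \<Longrightarrow> P s o\<^sub>L A s = 0"
    and AS: "\<And>s. s \<in> {0..1} \<Longrightarrow> A s o\<^sub>L S s = id_blinfun - P s"
    and PP: "\<And>s. s \<in> {0..1} \<Longrightarrow> P s o\<^sub>L P s = P s"
    and P_adj: "\<And>s. s \<in> {0..1} \<Longrightarrow> adjoint_pair (P s) (P s)"
    and P_lin: "\<And>s. s \<in> {0..1} \<Longrightarrow> complex_linear_op (P s)"
    and P_norm: "\<And>s. s \<in> {0..1} \<Longrightarrow> norm (P s) \<le> 1" "\<And>s. s \<in> {0..1} \<Longrightarrow> norm (id_blinfun - P s) \<le> 1"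
    and dP: "\<And>s. s \<in> {0..1} \<Longrightarrow> (P has_vector_derivative P1 s) (at s within {0..1})"
    and dP1: "\<And>s. s \<in> {0..1} \<Longrightarrow> (P1 has_vector_derivative P11 s) (at s within {0..1})"
    and dS: "\<And>s. s \<in> {0..1} \<Longrightarrow> (S has_vector_derivative S1 s) (at s within {0..1})"
    and P11: "continuous_on {0..1} P11" and S1: "continuous_on {0..1} S1"
    and block: "\<And>s. s \<in> {0..1} \<Longrightarrow> P1 s = (P1 s o\<^sub>L P s) + (P s o\<^sub>L P1 s)"
    and K: "\<And>s. s \<in> {0..1} \<Longrightarrow> selfadjoint_op (\<i> *\<^sub>O commutator_op (P1 s) (P s))"
    and W: "solves_evolution 1 (\<lambda>s. \<i> *\<^sub>O commutator_op (P1 s) (P s)) W"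
begin

private lemma contP: "continuous_on {0..1} P" "continuous_on {0..1} P1" "continuous_on {0..1} S"
  using has_vector_derivative_continuous_on [of "{0..1}" P P1, OF dP]
    has_vector_derivative_continuous_on [of "{0..1}" P1 P11, OF dP1]
    has_vector_derivative_continuous_on [of "{0..1}" S S1, OF dS] by blast+

private lemma contW: "continuous_on {0..1} W" "continuous_on {0..1} (\<lambda>s. inverse_op (W s))"
  by (rule evolution_continuous [OF W _ K]; simp)+

private lemma W_norm: "s \<in> {0..1} \<Longrightarrow> norm (W s) \<le> 1" "s \<in> {0..1} \<Longrightarrow> norm (inverse_op (W s)) \<le> 1"
  using evolution_norm [OF W _ K] by simp_all

private lemma dW: "s \<in> {0..1} \<Longrightarrow> (W has_vector_derivative commutator_op (P1 s) (P s) o\<^sub>L W s)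
    (at s within {0..1})"
  by (rule transport_has_vector_derivative [OF W K])

private lemma W_range: "s \<in> {0..1} \<Longrightarrow> P s o\<^sub>L (W s o\<^sub>L P 0) = W s o\<^sub>L P 0"
  "s \<in> {0..1} \<Longrightarrow> P 0 o\<^sub>L (inverse_op (W s) o\<^sub>L P s) = P 0 o\<^sub>L inverse_op (W s)"
  "s \<in> {0..1} \<Longrightarrow> P s o\<^sub>L W s = W s o\<^sub>L P 0"
proof -
  assume s: "s \<in> {0..1}"
  note inter = transport_intertwines [OF W K dP PP block s]
  show "P s o\<^sub>L W s = W s o\<^sub>L P 0" by (rule inter(1)) simp_all
  moreover have "inverse_op (W s) o\<^sub>L P s = P 0 o\<^sub>L inverse_op (W s)" by (rule inter(2)) simp_all
  moreover have "P 0 o\<^sub>L P 0 = P 0" by (rule PP) simp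
  ultimately show "P s o\<^sub>L (W s o\<^sub>L P 0) = W s o\<^sub>L P 0"
    "P 0 o\<^sub>L (inverse_op (W s) o\<^sub>L P s) = P 0 o\<^sub>L inverse_op (W s)"
    by (metis compose_assoc)+
qed

text \<open>Since \<open>A W P0 = 0\<close>, the derivative of \<open>V^-1 W P0\<close> is
  \<open>V^-1 P1 W P0\<close>, of order 1. As \<open>P1\<close> maps the range of \<open>P\<close>
  into its complement, where \<open>A S = 1\<close>, adding \<i>\<epsilon> times
  \<open>V^-1 Y\<close> cancels this term and leaves a derivative of order \<epsilon>.\<close>

lemma adiabatic_theorem:
  "\<exists>C\<ge>0. \<forall>\<epsilon>>0. \<forall>V. solves_evolution \<epsilon> A V \<longrightarrow> (\<forall>s\<in>{0..1}.
      norm ((V s o\<^sub>L P 0) - (W s o\<^sub>L P 0)) \<le> C * \<epsilon> \<and>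
      norm ((P 0 o\<^sub>L inverse_op (V s)) - (P 0 o\<^sub>L inverse_op (W s))) \<le> C * \<epsilon>)"
proof -
  define Y where "Y s = S s o\<^sub>L (P1 s o\<^sub>L (W s o\<^sub>L P 0))" for s
  define Y' where "Y' s = (S s o\<^sub>L ((P1 s o\<^sub>L (commutator_op (P1 s) (P s) o\<^sub>L W s o\<^sub>L P 0)) +
      (P11 s o\<^sub>L (W s o\<^sub>L P 0))))
    + (S1 s o\<^sub>L (P1 s o\<^sub>L (W s o\<^sub>L P 0)))" for s
  have dWP: "((\<lambda>s. W s o\<^sub>L P 0) has_vector_derivative commutator_op (P1 s) (P s) o\<^sub>L W s o\<^sub>L P 0)
      (at s within {0..1})"
    if "s \<in> {0..1}" for s
    by (rule bounded_linear.has_vector_derivative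
        [OF bounded_bilinear.bounded_linear_left [OF bounded_bilinear_blinfun_compose]
            dW [OF that]])
  have dY: "(Y has_vector_derivative Y' s) (at s within {0..1})" if "s \<in> {0..1}" for s
    unfolding Y_def Y'_def by (intro has_vector_derivative_compose_op dWP dS dP1 that)
  have contY: "continuous_on {0..1} Y" by (rule has_vector_derivative_continuous_on [OF dY])
  have contY': "continuous_on {0..1} Y'"
    unfolding Y'_def commutator_op_def by (intro continuous_intros contP contW P11 S1)
  obtain B where B: "0 \<le> B" "\<And>s. s \<in> {0..1} \<Longrightarrow> norm (Y s) \<le> B"
    using continuous_on_unit_interval_bound [OF contY] by blast
  obtain B' where B': "0 \<le> B'" "\<And>s. s \<in> {0..1} \<Longrightarrow> norm (Y' s) \<le> B'"
    using continuous_on_unit_interval_bound [OF contY'] by blast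
  \<comment> \<open>\<open>B'\<close> comes from integrating the derivative of the corrected
    quantity \<open>Z\<close>, and \<open>2 * B\<close> from removing the correction at both end
    points.\<close>
  have right: "norm ((V s o\<^sub>L P 0) - (W s o\<^sub>L P 0)) \<le> (B' + 2 * B) * \<epsilon>"
    if \<epsilon>: "\<epsilon> > 0" and V: "solves_evolution \<epsilon> A V" and s: "s \<in> {0..1}" for \<epsilon> V s
  proof -
    define Vi where "Vi s = inverse_op (V s)" for s
    have \<epsilon>': "\<epsilon> \<noteq> 0" using \<epsilon> by simp
    have nV: "norm (V s) \<le> 1" "norm (Vi s) \<le> 1" if "s \<in> {0..1}" for s
      using evolution_norm [OF V \<epsilon>' A that] by (auto simp: Vi_def)
    have inv: "is_inverse_op (V s) (Vi s)" if "s \<in> {0..1}" for s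
      using evolution_inverse [OF V \<epsilon>' A that] by (simp add: Vi_def)
    have dVi: "(Vi has_vector_derivative (\<i> / complex_of_real \<epsilon>) *\<^sub>O (Vi s o\<^sub>L A s))
        (at s within {0..1})"
      if "s \<in> {0..1}" for s
      using evolution_inverse_has_vector_derivative [OF V \<epsilon>' A that] unfolding Vi_def by simp
    define Z where "Z s = (Vi s o\<^sub>L (W s o\<^sub>L P 0)) + (\<i> * \<epsilon>) *\<^sub>O (Vi s o\<^sub>L Y s)" for s
    have dZ: "(Z has_vector_derivative (\<i> * \<epsilon>) *\<^sub>O (Vi s o\<^sub>L Y' s)) (at s within {0..1})"
      if s: "s \<in> {0..1}" for s
    proof -
      have "(Z has_vector_derivative
          ((Vi s o\<^sub>L (commutator_op (P1 s) (P s) o\<^sub>L W s o\<^sub>L P 0)) +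
              ((\<i> / complex_of_real \<epsilon>) *\<^sub>O (Vi s o\<^sub>L A s) o\<^sub>L (W s o\<^sub>L P 0)))
          + (\<i> * \<epsilon>) *\<^sub>O ((Vi s o\<^sub>L Y' s) + ((\<i> / complex_of_real \<epsilon>) *\<^sub>O (Vi s o\<^sub>L A s) o\<^sub>L Y s)))
              (at s within {0..1})"
        unfolding Z_def
        by (intro has_vector_derivative_add has_vector_derivative_compose_op dVi dWP dY s
            bounded_linear.has_vector_derivative
                [OF bounded_bilinear.bounded_linear_right [OF bounded_bilinear_scale_op]])
      moreover have "A s o\<^sub>L (W s o\<^sub>L P 0) = 0"
        by (subst W_range(1) [OF s, symmetric], subst compose_assoc [symmetric])
            (simp add: AP [OF s])
      moreover have PPP: "P s o\<^sub>L (P1 s o\<^sub>L (W s o\<^sub>L P 0)) = 0"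
      proof -
        have "P s o\<^sub>L (P1 s o\<^sub>L (P s o\<^sub>L (W s o\<^sub>L P 0))) = (P s o\<^sub>L P1 s o\<^sub>L P s) o\<^sub>L (W s o\<^sub>L P 0)"
          by (simp only: compose_assoc)
        then show ?thesis using projection_derivative_block [OF PP [OF s] block [OF s]]
            W_range(1) [OF s] by simp
      qed
      moreover have "A s o\<^sub>L Y s = P1 s o\<^sub>L (W s o\<^sub>L P 0)"
      proof -
        have "A s o\<^sub>L Y s = (A s o\<^sub>L S s) o\<^sub>L (P1 s o\<^sub>L (W s o\<^sub>L P 0))"
          by (simp only: Y_def compose_assoc)
        then show ?thesis by (simp add: AS [OF s] op_simps PPP)
      qed
      moreover have "commutator_op (P1 s) (P s) o\<^sub>L W s o\<^sub>L P 0 = P1 s o\<^sub>L (W s o\<^sub>L P 0)"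
        by (simp add: commutator_op_def op_simps PPP W_range(1) [OF s])
      ultimately show ?thesis
        using \<epsilon>' by (simp add: compose_assoc compose_scale_op_left scale_op_simps scale_op_scale_op)
    qed
    have "norm (Z s - Z 0) \<le> \<epsilon> * B' * \<bar>s - 0\<bar>"
    proof (rule vector_derivative_bound [OF _ dZ])
      fix r :: real assume r: "r \<in> {0..1}"
      have "norm (Vi r o\<^sub>L Y' r) \<le> 1 * B'" by (intro norm_compose_le nV B' r)
      from mult_left_mono [OF this, of \<epsilon>]
      show "norm ((\<i> * \<epsilon>) *\<^sub>O (Vi r o\<^sub>L Y' r)) \<le> \<epsilon> * B'" using \<epsilon>
        by (simp add: norm_scale_op norm_mult)
    qed (use s in auto)
    also have "\<dots> \<le> \<epsilon> * B' * 1" using s \<epsilon> B' by (intro mult_left_mono) auto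
    finally have Z: "norm (Z s - Z 0) \<le> \<epsilon> * B'" by simp
    have "V 0 = id_blinfun" "W 0 = id_blinfun" using V W by (auto simp: solves_evolution_def)
    then have "Z 0 = P 0 + (\<i> * \<epsilon>) *\<^sub>O (Vi 0 o\<^sub>L Y 0)"
      using inv [of 0] by (simp add: Z_def is_inverse_op_def)
    then have "(Vi s o\<^sub>L (W s o\<^sub>L P 0)) - P 0 =
        (Z s - Z 0) - (\<i> * \<epsilon>) *\<^sub>O ((Vi s o\<^sub>L Y s) - (Vi 0 o\<^sub>L Y 0))"
      by (simp add: Z_def scale_op_simps)
    also have "norm \<dots> \<le> \<epsilon> * B' + \<epsilon> * (1 * B + 1 * B)"
    proof (rule order_trans [OF norm_triangle_ineq4], rule add_mono [OF Z])
      have "norm ((Vi s o\<^sub>L Y s) - (Vi 0 o\<^sub>L Y 0)) \<le> 1 * B + 1 * B"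
        by (intro order_trans [OF norm_triangle_ineq4] add_mono norm_compose_le nV B s) auto
      from mult_left_mono [OF this, of \<epsilon>]
      show "norm ((\<i> * \<epsilon>) *\<^sub>O ((Vi s o\<^sub>L Y s) - (Vi 0 o\<^sub>L Y 0))) \<le> \<epsilon> * (1 * B + 1 * B)"
        using \<epsilon> by (simp add: norm_scale_op norm_mult)
    qed
    finally have "norm ((Vi s o\<^sub>L (W s o\<^sub>L P 0)) - P 0) \<le> (B' + 2 * B) * \<epsilon>"
      by (simp add: algebra_simps)
    from norm_compose_le [OF nV(1) [OF s] this]
    have "norm (V s o\<^sub>L ((Vi s o\<^sub>L (W s o\<^sub>L P 0)) - P 0)) \<le> (B' + 2 * B) * \<epsilon>" by simp
    moreover have "V s o\<^sub>L ((Vi s o\<^sub>L (W s o\<^sub>L P 0)) - P 0) =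
        ((V s o\<^sub>L Vi s) o\<^sub>L (W s o\<^sub>L P 0)) - (V s o\<^sub>L P 0)"
      by (simp only: op_simps)
    ultimately show ?thesis
      using inv [OF s] by (simp add: is_inverse_op_def norm_minus_commute)
  qed
  have left: "norm ((P 0 o\<^sub>L inverse_op (V s)) - (P 0 o\<^sub>L inverse_op (W s))) \<le> (B' + 2 * B) * \<epsilon>"
    if \<epsilon>: "\<epsilon> > 0" and V: "solves_evolution \<epsilon> A V" and s: "s \<in> {0..1}" for \<epsilon> V s
  proof -
    have "adjoint_pair ((V s o\<^sub>L P 0) - (W s o\<^sub>L P 0))
        ((P 0 o\<^sub>L inverse_op (V s)) - (P 0 o\<^sub>L inverse_op (W s)))"
      using evolution_adjoint [OF V _ A s] evolution_adjoint [OF W _ K s] \<epsilon>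
      by (intro adjoint_pair_intros P_adj) auto
    from adjoint_pair_norm [OF this] right [OF that] show ?thesis by linarith
  qed
  show ?thesis
    using B(1) B'(1) right left by (intro exI [of _ "B' + 2 * B"] conjI allI impI ballI) auto
qed

text \<open>With \<open>X = [P, P2]\<close> one has \<open>D = [A, X] + (1 - P) D (1 - P)\<close>. The commutator with the
  generator integrates to boundary terms, and the diagonal block only sees the transitions out of
  the range of \<open>P\<close>, which are of order \<open>\<epsilon>\<close> on both sides.\<close>

lemma adiabatic_integral:
  fixes D B P2 P21 :: "real \<Rightarrow> 'a operator"
  assumes D: "continuous_on {0..1} D" and B: "continuous_on {0..1} B"
    and dP2: "\<And>s. s \<in> {0..1} \<Longrightarrow> (P2 has_vector_derivative P21 s) (at s within {0..1})"
    and P21: "continuous_on {0..1} P21"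
    and P2_lin: "\<And>s. s \<in> {0..1} \<Longrightarrow> complex_linear_op (P2 s)"
    and block2: "\<And>s. s \<in> {0..1} \<Longrightarrow> P2 s = (P2 s o\<^sub>L P s) + (P s o\<^sub>L P2 s)"
    and DP: "\<And>s. s \<in> {0..1} \<Longrightarrow> D s o\<^sub>L P s = - (A s o\<^sub>L P2 s o\<^sub>L P s)"
    and PD: "\<And>s. s \<in> {0..1} \<Longrightarrow> P s o\<^sub>L D s = - (P s o\<^sub>L P2 s o\<^sub>L A s)"
    and PBP: "\<And>s. s \<in> {0..1} \<Longrightarrow> P s o\<^sub>L B s o\<^sub>L P s =
        P s o\<^sub>L ((P1 s o\<^sub>L P2 s) - (P2 s o\<^sub>L P1 s)) o\<^sub>L P s"
  obtains C where "\<And>\<epsilon> V t. \<epsilon> > 0 \<Longrightarrow> solves_evolution \<epsilon> A V \<Longrightarrow> t \<in> {0..1} \<Longrightarrow>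
    norm ((P 0 o\<^sub>L integral {0..t} (\<lambda>s. inverse_op (V s) o\<^sub>L D s o\<^sub>L V s) o\<^sub>L P 0)
      - (\<i> * \<epsilon>) *\<^sub>O (P 0 o\<^sub>L integral {0..t} (\<lambda>s. inverse_op (W s) o\<^sub>L B s o\<^sub>L W s) o\<^sub>L P 0)) \<le>
          C * \<epsilon>\<^sup>2"
proof -
  obtain C where C: "0 \<le> C"
    and right: "\<And>\<epsilon> V s. \<epsilon> > 0 \<Longrightarrow> solves_evolution \<epsilon> A V \<Longrightarrow> s \<in> {0..1} \<Longrightarrow>
      norm ((V s o\<^sub>L P 0) - (W s o\<^sub>L P 0)) \<le> C * \<epsilon>"
    and left: "\<And>\<epsilon> V s. \<epsilon> > 0 \<Longrightarrow> solves_evolution \<epsilon> A V \<Longrightarrow> s \<in> {0..1} \<Longrightarrow>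
      norm ((P 0 o\<^sub>L inverse_op (V s)) - (P 0 o\<^sub>L inverse_op (W s))) \<le> C * \<epsilon>"
    using adiabatic_theorem by meson
  have contP2: "continuous_on {0..1} P2" by (rule has_vector_derivative_continuous_on [OF dP2])
  define X where "X s = commutator_op (P s) (P2 s)" for s
  define X' where "X' s = ((P s o\<^sub>L P21 s) + (P1 s o\<^sub>L P2 s)) - ((P2 s o\<^sub>L P1 s) + (P21 s o\<^sub>L P s))"
    for s
  have dX: "(X has_vector_derivative X' s) (at s within {0..1})" if "s \<in> {0..1}" for s
    unfolding X_def X'_def commutator_op_def
    by (intro has_vector_derivative_diff has_vector_derivative_compose_op dP dP2 that)
  have X_lin: "complex_linear_op (X s)" if "s \<in> {0..1}" for s
    unfolding X_def commutator_op_def by (intro complex_linear_op_intros P_lin P2_lin that)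
  have contX: "continuous_on {0..1} X" "continuous_on {0..1} X'"
    unfolding X_def X'_def commutator_op_def by (intro continuous_intros contP contP2 P21)+
  obtain MX where MX: "0 \<le> MX" "\<And>s. s \<in> {0..1} \<Longrightarrow> norm (X s) \<le> MX"
    using continuous_on_unit_interval_bound [OF contX(1)] by blast
  obtain MX' where MX': "0 \<le> MX'" "\<And>s. s \<in> {0..1} \<Longrightarrow> norm (X' s) \<le> MX'"
    using continuous_on_unit_interval_bound [OF contX(2)] by blast
  obtain MD where MD: "0 \<le> MD" "\<And>s. s \<in> {0..1} \<Longrightarrow> norm (D s) \<le> MD"
    using continuous_on_unit_interval_bound [OF D] by blast
  have PPX: "P s o\<^sub>L (P s o\<^sub>L X) = P s o\<^sub>L X" if "s \<in> {0..1}" for s X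
    by (metis PP [OF that] compose_assoc)
  \<comment> \<open>\<open>X\<close> is off-diagonal; hence its boundary terms vanish in the
    \<open>W\<close> picture.\<close>
  have PXP: "P s o\<^sub>L (X s o\<^sub>L P s) = 0" if "s \<in> {0..1}" for s
    unfolding X_def commutator_op_def by (simp add: op_simps PPX [OF that] PP [OF that])
  \<comment> \<open>The two terms with \<open>P21\<close> cancel under the compression, leaving the
    commutator in the hypothesis on \<open>B\<close>.\<close>
  have PX'P: "P s o\<^sub>L X' s o\<^sub>L P s = P s o\<^sub>L B s o\<^sub>L P s" if "s \<in> {0..1}" for s
    unfolding PBP [OF that] X'_def by (simp add: op_simps PPX [OF that] PP [OF that])
  have split: "D s - commutator_op (A s) (X s) = (id_blinfun - P s) o\<^sub>L D s o\<^sub>L (id_blinfun - P s)"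
    if s: "s \<in> {0..1}" for s
  proof -
    have APX: "A s o\<^sub>L (P s o\<^sub>L X) = 0" for X using AP [OF s]
      by (metis blinfun_compose_zero(1) compose_assoc)
    have DPX: "D s o\<^sub>L P s = - (A s o\<^sub>L (P2 s o\<^sub>L P s))" "P s o\<^sub>L D s = - (P s o\<^sub>L (P2 s o\<^sub>L A s))"
      using DP [OF s] PD [OF s] by (simp_all add: compose_assoc)
    have PAX: "P s o\<^sub>L (A s o\<^sub>L X) = 0" for X using PA [OF s]
      by (metis blinfun_compose_zero(1) compose_assoc)
    show ?thesis
      by (simp add: X_def commutator_op_def op_simps DPX APX AP [OF s] PA [OF s] PAX)
  qed
  \<comment> \<open>Exchanging \<open>V\<close> for \<open>W\<close> in a compressed conjugation
    costs \<open>C * \<epsilon>\<close> on each side.\<close>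
  have sandwich: "norm ((P 0 o\<^sub>L (inverse_op (V s) o\<^sub>L (Q o\<^sub>L (V s o\<^sub>L P 0))))
      - (P 0 o\<^sub>L (inverse_op (W s) o\<^sub>L (Q o\<^sub>L (W s o\<^sub>L P 0))))) \<le> 2 * C * M * \<epsilon>"
    if \<epsilon>: "\<epsilon> > 0" and V: "solves_evolution \<epsilon> A V" and s: "s \<in> {0..1}" and Q: "norm Q \<le> M"
      for \<epsilon> V s Q M
  proof -
    have "(P 0 o\<^sub>L (inverse_op (V s) o\<^sub>L (Q o\<^sub>L (V s o\<^sub>L P 0)))) -
        (P 0 o\<^sub>L (inverse_op (W s) o\<^sub>L (Q o\<^sub>L (W s o\<^sub>L P 0)))) =
        (((P 0 o\<^sub>L inverse_op (V s)) - (P 0 o\<^sub>L inverse_op (W s))) o\<^sub>L (Q o\<^sub>L (V s o\<^sub>L P 0)))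
        + ((P 0 o\<^sub>L inverse_op (W s)) o\<^sub>L (Q o\<^sub>L ((V s o\<^sub>L P 0) - (W s o\<^sub>L P 0))))"
      by (simp add: op_simps)
    also have "norm \<dots> \<le> (C * \<epsilon>) * (M * (1 * 1)) + (1 * 1) * (M * (C * \<epsilon>))"
      by (intro order_trans [OF norm_triangle_ineq] add_mono norm_compose_le left right Q \<epsilon> V s
          W_norm P_norm
          evolution_norm [OF V _ A]) (use \<epsilon> in auto)
    finally show ?thesis by (simp add: algebra_simps)
  qed
  \<comment> \<open>In this order: the diagonal block, the passage from \<open>X'\<close> conjugated
    by \<open>V\<close> to \<open>B\<close> conjugated by \<open>W\<close>, and the boundary
    term.\<close>
  define Ct where "Ct = C * C * MD + 2 * C * MX' + 2 * C * MX"
  have "norm ((P 0 o\<^sub>L integral {0..t} (\<lambda>s. inverse_op (V s) o\<^sub>L D s o\<^sub>L V s) o\<^sub>L P 0)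
      - (\<i> * \<epsilon>) *\<^sub>O (P 0 o\<^sub>L integral {0..t} (\<lambda>s. inverse_op (W s) o\<^sub>L B s o\<^sub>L W s) o\<^sub>L P 0)) \<le>
          Ct * \<epsilon>\<^sup>2"
    if \<epsilon>: "\<epsilon> > 0" and V: "solves_evolution \<epsilon> A V" and t: "t \<in> {0..1}" for \<epsilon> V t
  proof -
    have \<epsilon>': "\<epsilon> \<noteq> 0" using \<epsilon> by simp
    define Vi where "Vi s = inverse_op (V s)" for s
    define Wi where "Wi s = inverse_op (W s)" for s
    have V0: "V 0 = id_blinfun" using V by (simp add: solves_evolution_def)
    have contV: "continuous_on {0..1} V" "continuous_on {0..1} Vi"
      using evolution_continuous [OF V \<epsilon>' A] by (auto simp: Vi_def)
    have inv: "is_inverse_op (V s) (Vi s)" if "s \<in> {0..1}" for s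
      using evolution_inverse [OF V \<epsilon>' A that] by (simp add: Vi_def)
    have Vi_lin: "complex_linear_op (Vi s)" if "s \<in> {0..1}" for s
      using evolution_inverse_complex_linear [OF V \<epsilon>' A that] by (simp add: Vi_def)
    define F where "F s = integral {0..s} (\<lambda>s. Vi s o\<^sub>L D s o\<^sub>L V s)" for s
    define G where "G s = integral {0..s} (\<lambda>s. Wi s o\<^sub>L B s o\<^sub>L W s)" for s
    have dF: "(F has_vector_derivative Vi s o\<^sub>L D s o\<^sub>L V s) (at s within {0..1})" if "s \<in> {0..1}"
      for s
      unfolding F_def by (intro integral_has_vector_derivative that continuous_intros contV D)
    have dG: "(G has_vector_derivative Wi s o\<^sub>L B s o\<^sub>L W s) (at s within {0..1})" if "s \<in> {0..1}"
      for s
      unfolding G_def Wi_def by (intro integral_has_vector_derivative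
          that continuous_intros contW B)
    define N where "N s = Vi s o\<^sub>L (X s o\<^sub>L V s)" for s
    have dN: "(N has_vector_derivative (\<i> / \<epsilon>) *\<^sub>O (Vi s o\<^sub>L commutator_op (A s) (X s) o\<^sub>L V s) +
        (Vi s o\<^sub>L X' s o\<^sub>L V s)) (at s within {0..1})"
      if s: "s \<in> {0..1}" for s
    proof -
      have "(N has_vector_derivative
          (Vi s o\<^sub>L ((X s o\<^sub>L (- \<i> / complex_of_real \<epsilon>) *\<^sub>O (A s o\<^sub>L V s)) + (X' s o\<^sub>L V s)))
          + ((\<i> / complex_of_real \<epsilon>) *\<^sub>O (Vi s o\<^sub>L A s) o\<^sub>L (X s o\<^sub>L V s))) (at s within {0..1})"
        unfolding N_def Vi_def
        by (intro has_vector_derivative_compose_op dX s evolution_has_vector_derivative [OF V \<epsilon>' A]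
            evolution_inverse_has_vector_derivative [OF V \<epsilon>' A])
      moreover have "(Vi s o\<^sub>L ((X s o\<^sub>L (- \<i> / complex_of_real \<epsilon>) *\<^sub>O (A s o\<^sub>L V s)) +
          (X' s o\<^sub>L V s)))
          + ((\<i> / complex_of_real \<epsilon>) *\<^sub>O (Vi s o\<^sub>L A s) o\<^sub>L (X s o\<^sub>L V s)) =
          (\<i> / \<epsilon>) *\<^sub>O (Vi s o\<^sub>L commutator_op (A s) (X s) o\<^sub>L V s) + (Vi s o\<^sub>L X' s o\<^sub>L V s)"
        by (simp add: commutator_op_def op_simps compose_scale_op_right [OF X_lin [OF s]]
            compose_scale_op_right [OF Vi_lin [OF s]])
      ultimately show ?thesis by simp
    qed
    let ?P = "\<lambda>Q. P 0 o\<^sub>L Q o\<^sub>L P 0"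
    have bl: "bounded_linear ?P"
      by (intro bounded_linear_compose [OF bounded_bilinear.bounded_linear_left
          [OF bounded_bilinear_blinfun_compose]]
          bounded_bilinear.bounded_linear_right [OF bounded_bilinear_blinfun_compose])
    \<comment> \<open>The quantity to be estimated plus the boundary correction. Since
      \<i>\<epsilon> times \<i>/\<epsilon> is -1, differentiating the correction subtracts
      \<open>[A, X]\<close> from \<open>D\<close>, and the derivative becomes of order
      \<epsilon>^2.\<close>
    define \<Phi> where "\<Phi> s = ?P (F s) - (\<i> * \<epsilon>) *\<^sub>O ?P (G s) + (\<i> * \<epsilon>) *\<^sub>O ?P (N s)" for s
    define \<Phi>' where "\<Phi>' s = ?P (Vi s o\<^sub>L (D s - commutator_op (A s) (X s)) o\<^sub>L V s)
      + (\<i> * \<epsilon>) *\<^sub>O (?P (Vi s o\<^sub>L X' s o\<^sub>L V s) - ?P (Wi s o\<^sub>L B s o\<^sub>L W s))" for s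
    have P0_lin: "complex_linear_op (P 0)" by (rule P_lin) simp
    have d\<Phi>: "(\<Phi> has_vector_derivative \<Phi>' s) (at s within {0..1})" if s: "s \<in> {0..1}" for s
    proof -
      have "(\<Phi> has_vector_derivative
          ?P (Vi s o\<^sub>L D s o\<^sub>L V s) - (\<i> * \<epsilon>) *\<^sub>O ?P (Wi s o\<^sub>L B s o\<^sub>L W s)
          + (\<i> * \<epsilon>) *\<^sub>O ?P ((\<i> / \<epsilon>) *\<^sub>O (Vi s o\<^sub>L commutator_op (A s) (X s) o\<^sub>L V s) +
              (Vi s o\<^sub>L X' s o\<^sub>L V s))) (at s within {0..1})"
        unfolding \<Phi>_def
        by (intro has_vector_derivative_add has_vector_derivative_diff
            bounded_linear.has_vector_derivative
                [OF bounded_bilinear.bounded_linear_right [OF bounded_bilinear_scale_op]]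
            bounded_linear.has_vector_derivative [OF bl] dF dG dN s)
      moreover have "?P (Vi s o\<^sub>L D s o\<^sub>L V s) - (\<i> * \<epsilon>) *\<^sub>O ?P (Wi s o\<^sub>L B s o\<^sub>L W s)
          + (\<i> * \<epsilon>) *\<^sub>O ?P ((\<i> / \<epsilon>) *\<^sub>O (Vi s o\<^sub>L commutator_op (A s) (X s) o\<^sub>L V s) +
              (Vi s o\<^sub>L X' s o\<^sub>L V s)) = \<Phi>' s"
        using \<epsilon>' by (simp add: \<Phi>'_def op_simps compose_scale_op_right [OF P0_lin])
      ultimately show ?thesis by simp
    qed
    have n\<Phi>': "norm (\<Phi>' s) \<le> (C * C * MD + 2 * C * MX') * \<epsilon>\<^sup>2" if s: "s \<in> {0..1}" for s
    proof -
      define Q where "Q = id_blinfun - P s"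
      have QW: "Q o\<^sub>L (W s o\<^sub>L P 0) = 0" using W_range(1) [OF s] by (simp add: Q_def op_simps)
      have WQ: "P 0 o\<^sub>L (Wi s o\<^sub>L Q) = 0" using W_range(2) [OF s]
        by (simp add: Q_def Wi_def op_simps)
      have "?P (Vi s o\<^sub>L (D s - commutator_op (A s) (X s)) o\<^sub>L V s) =
          (P 0 o\<^sub>L (Vi s o\<^sub>L Q)) o\<^sub>L D s o\<^sub>L (Q o\<^sub>L (V s o\<^sub>L P 0))"
        unfolding split [OF s] Q_def by (simp only: compose_assoc)
      \<comment> \<open>Subtracting the vanishing \<open>W\<close> expressions exhibits two
        transition amplitudes, each of order \<epsilon>.\<close>
      also have "\<dots> = ((P 0 o\<^sub>L (Vi s o\<^sub>L Q)) - (P 0 o\<^sub>L (Wi s o\<^sub>L Q))) o\<^sub>L D s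
          o\<^sub>L ((Q o\<^sub>L (V s o\<^sub>L P 0)) - (Q o\<^sub>L (W s o\<^sub>L P 0)))"
        unfolding QW WQ by simp
      also have "\<dots> = (((P 0 o\<^sub>L Vi s) - (P 0 o\<^sub>L Wi s)) o\<^sub>L Q) o\<^sub>L D s
          o\<^sub>L (Q o\<^sub>L ((V s o\<^sub>L P 0) - (W s o\<^sub>L P 0)))"
        by (simp only: compose_assoc compose_distribs)
      also have "norm \<dots> \<le> ((C * \<epsilon>) * 1) * MD * (1 * (C * \<epsilon>))"
        unfolding Vi_def Wi_def Q_def by (intro norm_compose_le left right \<epsilon> V s P_norm MD)
      finally have 1: "norm (?P (Vi s o\<^sub>L (D s - commutator_op (A s) (X s)) o\<^sub>L V s)) \<le>
          C * C * MD * \<epsilon>\<^sup>2"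
        by (simp add: power2_eq_square mult_ac)
      have "?P (Wi s o\<^sub>L B s o\<^sub>L W s) = P 0 o\<^sub>L (Wi s o\<^sub>L P s) o\<^sub>L B s o\<^sub>L (P s o\<^sub>L (W s o\<^sub>L P 0))"
        using W_range(1,2) [OF s] by (simp add: Wi_def compose_assoc [symmetric])
      also have "\<dots> = P 0 o\<^sub>L Wi s o\<^sub>L (P s o\<^sub>L B s o\<^sub>L P s) o\<^sub>L (W s o\<^sub>L P 0)"
        by (simp only: compose_assoc)
      also have "\<dots> = P 0 o\<^sub>L (Wi s o\<^sub>L P s) o\<^sub>L X' s o\<^sub>L (P s o\<^sub>L (W s o\<^sub>L P 0))"
        unfolding PX'P [OF s, symmetric] by (simp only: compose_assoc)
      also have "\<dots> = P 0 o\<^sub>L (Wi s o\<^sub>L (X' s o\<^sub>L (W s o\<^sub>L P 0)))"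
        using W_range(1,2) [OF s] by (simp add: Wi_def compose_assoc [symmetric])
      finally have "norm (?P (Vi s o\<^sub>L X' s o\<^sub>L V s) - ?P (Wi s o\<^sub>L B s o\<^sub>L W s)) \<le> 2 * C * MX' * \<epsilon>"
        using sandwich [OF \<epsilon> V s MX'(2) [OF s]] by (simp add: Vi_def Wi_def compose_assoc)
      from mult_left_mono [OF this, of \<epsilon>] \<epsilon>
      have "norm ((\<i> * \<epsilon>) *\<^sub>O (?P (Vi s o\<^sub>L X' s o\<^sub>L V s) - ?P (Wi s o\<^sub>L B s o\<^sub>L W s))) \<le>
          2 * C * MX' * \<epsilon>\<^sup>2"
        by (simp add: norm_scale_op norm_mult power2_eq_square mult_ac)
      with 1 have "norm (\<Phi>' s) \<le> C * C * MD * \<epsilon>\<^sup>2 + 2 * C * MX' * \<epsilon>\<^sup>2"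
        unfolding \<Phi>'_def by (intro order_trans [OF norm_triangle_ineq] add_mono)
      then show ?thesis by (simp add: distrib_right)
    qed
    have "norm (\<Phi> t - \<Phi> 0) \<le> (C * C * MD + 2 * C * MX') * \<epsilon>\<^sup>2 * \<bar>t - 0\<bar>"
      by (rule vector_derivative_bound [OF _ d\<Phi> n\<Phi>']) (use t in auto)
    also have "\<dots> \<le> (C * C * MD + 2 * C * MX') * \<epsilon>\<^sup>2 * 1"
      using t C MD MX' by (intro mult_left_mono) auto
    finally have n\<Phi>: "norm (\<Phi> t - \<Phi> 0) \<le> (C * C * MD + 2 * C * MX') * \<epsilon>\<^sup>2" by simp
    have "\<Phi> 0 = 0"
      using inv [of 0] PXP [of 0]
      by (simp add: \<Phi>_def F_def G_def N_def V0 is_inverse_op_def compose_assoc scale_op_simps)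
    \<comment> \<open>The \<open>W\<close> counterpart of the boundary term is zero by
      \<open>PXP\<close>, so the boundary term itself is of order \<epsilon>.\<close>
    have "P 0 o\<^sub>L (Wi t o\<^sub>L (X t o\<^sub>L (W t o\<^sub>L P 0))) =
        P 0 o\<^sub>L (Wi t o\<^sub>L P t) o\<^sub>L X t o\<^sub>L (P t o\<^sub>L (W t o\<^sub>L P 0))"
      using W_range(1,2) [OF t] by (simp add: Wi_def compose_assoc [symmetric])
    also have "\<dots> = P 0 o\<^sub>L Wi t o\<^sub>L (P t o\<^sub>L (X t o\<^sub>L P t)) o\<^sub>L (W t o\<^sub>L P 0)"
      by (simp only: compose_assoc)
    finally have "norm (?P (N t)) \<le> 2 * C * MX * \<epsilon>"
      using sandwich [OF \<epsilon> V t MX(2) [OF t]]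
        by (simp add: PXP [OF t] N_def Vi_def Wi_def compose_assoc)
    from mult_left_mono [OF this, of \<epsilon>] \<epsilon>
    have "norm ((\<i> * \<epsilon>) *\<^sub>O ?P (N t)) \<le> 2 * C * MX * \<epsilon>\<^sup>2"
      by (simp add: norm_scale_op norm_mult power2_eq_square mult_ac)
    moreover have "?P (F t) - (\<i> * \<epsilon>) *\<^sub>O ?P (G t) = (\<Phi> t - \<Phi> 0) - (\<i> * \<epsilon>) *\<^sub>O ?P (N t)"
      unfolding \<open>\<Phi> 0 = 0\<close> by (simp add: \<Phi>_def)
    ultimately have "norm (?P (F t) - (\<i> * \<epsilon>) *\<^sub>O ?P (G t)) \<le>
        (C * C * MD + 2 * C * MX') * \<epsilon>\<^sup>2 + 2 * C * MX * \<epsilon>\<^sup>2"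
      using n\<Phi> norm_triangle_ineq4 [of "\<Phi> t - \<Phi> 0" "(\<i> * \<epsilon>) *\<^sub>O ?P (N t)"] by simp
    then show ?thesis by (simp add: Ct_def F_def G_def Vi_def Wi_def distrib_right)
  qed
  then show ?thesis using that [of Ct] by blast
qed

end

section \<open>The charge operator\<close>

text \<open>The formula consists of the blocks \<open>S B P\<close> and \<open>P B S\<close>, each
  of which maps between the range of \<open>P\<close> and its complement.\<close>

lemma projector_derivative_block:
  assumes "spectral_splitting A e P S"
  shows "projector_derivative B P S =
      (projector_derivative B P S o\<^sub>L P) + (P o\<^sub>L projector_derivative B P S)"
proof -
  have SP: "S o\<^sub>L P = 0" "P o\<^sub>L S = 0" using assms by (auto simp: spectral_splitting_def)
  have PP: "P o\<^sub>L P = P" by (rule spectral_splitting_projection [OF assms])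
  have SX: "P o\<^sub>L (S o\<^sub>L X) = 0" "P o\<^sub>L (P o\<^sub>L X) = P o\<^sub>L X" for X
    by (metis SP(2) blinfun_compose_zero(1) compose_assoc, metis PP compose_assoc)
  show ?thesis by (simp add: projector_derivative_def op_simps SP PP SX)
qed

text \<open>These are the derivatives of \<open>(A - e) P = 0\<close> and
  \<open>P (A - e) = 0\<close>, multiplied by \<open>P\<close>. Algebraically,
  \<open>(A - e) S = 1 - P\<close> turns the first right-hand side into \<open>(1 - P) B P\<close>,
  which is \<open>B P - c P\<close>; the second is symmetric.\<close>

lemma off_diagonal_block:
  assumes split: "spectral_splitting A e P S" and c: "c *\<^sub>R P = P o\<^sub>L B o\<^sub>L P"
  shows "(B - c *\<^sub>R id_blinfun) o\<^sub>L P =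
      - ((A - e *\<^sub>R id_blinfun) o\<^sub>L projector_derivative B P S o\<^sub>L P)"
    and "P o\<^sub>L (B - c *\<^sub>R id_blinfun) =
        - (P o\<^sub>L projector_derivative B P S o\<^sub>L (A - e *\<^sub>R id_blinfun))"
proof -
  define A' where "A' = A - e *\<^sub>R id_blinfun"
  have s: "S o\<^sub>L P = 0" "P o\<^sub>L S = 0" "A' o\<^sub>L S = id_blinfun - P" "S o\<^sub>L A' = id_blinfun - P"
    using split by (auto simp: spectral_splitting_def A'_def)
  have PP: "P o\<^sub>L P = P" by (rule spectral_splitting_projection [OF split])
  have "projector_derivative B P S o\<^sub>L P = - (S o\<^sub>L (B o\<^sub>L P))"
    by (simp add: projector_derivative_def op_simps s PP)
  then have "- (A' o\<^sub>L projector_derivative B P S o\<^sub>L P) = (A' o\<^sub>L S) o\<^sub>L (B o\<^sub>L P)"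
    by (simp add: op_simps)
  also have "\<dots> = (B o\<^sub>L P) - c *\<^sub>R P" by (simp add: s c op_simps)
  finally show "(B - c *\<^sub>R id_blinfun) o\<^sub>L P =
      - ((A - e *\<^sub>R id_blinfun) o\<^sub>L projector_derivative B P S o\<^sub>L P)"
    by (simp add: A'_def [symmetric] op_simps)
  have SX: "P o\<^sub>L (S o\<^sub>L X) = 0" "P o\<^sub>L (P o\<^sub>L X) = P o\<^sub>L X" for X
    by (metis s(2) blinfun_compose_zero(1) compose_assoc, metis PP compose_assoc)
  have "- (P o\<^sub>L projector_derivative B P S o\<^sub>L A') = P o\<^sub>L B o\<^sub>L (S o\<^sub>L A')"
    by (simp add: projector_derivative_def op_simps SX)
  also have "\<dots> = (P o\<^sub>L B) - c *\<^sub>R P" by (simp add: s c op_simps)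
  finally show "P o\<^sub>L (B - c *\<^sub>R id_blinfun) =
      - (P o\<^sub>L projector_derivative B P S o\<^sub>L (A - e *\<^sub>R id_blinfun))"
    by (simp add: A'_def [symmetric] op_simps)
qed

text \<open>The phase is \<open>exp (\<i> \<phi> / c)\<close> with \<phi> the integral of
  \<open>E\<close>. It is a complex scalar, which is why it cancels in the conjugation only for a
  complex linear \<open>D\<close>.\<close>

lemma evolution_phase_shift:
  fixes H U :: "real \<Rightarrow> 'a::complex_hilbert operator" and E :: "real \<Rightarrow> real"
  assumes U: "solves_evolution c H U" and c: "c \<noteq> 0"
    and H: "\<And>s. s \<in> {0..1} \<Longrightarrow> selfadjoint_op (H s)" and E: "continuous_on {0..1} E"
  obtains V where "solves_evolution c (\<lambda>s. H s - E s *\<^sub>R id_blinfun) V"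
    and "\<And>s D. s \<in> {0..1} \<Longrightarrow> complex_linear_op D \<Longrightarrow>
      inverse_op (V s) o\<^sub>L D o\<^sub>L V s = inverse_op (U s) o\<^sub>L D o\<^sub>L U s"
proof -
  define \<phi> where "\<phi> s = integral {0..s} E" for s
  define \<theta> where "\<theta> s = exp (\<i> * complex_of_real (\<phi> s) / complex_of_real c)" for s
  define V where "V s = \<theta> s *\<^sub>O U s" for s
  have d\<theta>: "(\<theta> has_vector_derivative (\<i> * complex_of_real (E s) / complex_of_real c) * \<theta> s)
      (at s within {0..1})"
    if s: "s \<in> {0..1}" for s
  proof -
    have "(\<phi> has_vector_derivative E s) (at s within {0..1})"
      unfolding \<phi>_def by (rule integral_has_vector_derivative [OF E s])
    then have "((\<lambda>s. (\<i> / complex_of_real c) * complex_of_real (\<phi> s)) has_vector_derivative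
        (\<i> / complex_of_real c) * complex_of_real (E s)) (at s within {0..1})"
      by (intro has_vector_derivative_mult_right has_vector_derivative_of_real)
        (simp add: has_real_derivative_iff_has_vector_derivative)
    then have "((\<lambda>s. \<i> * complex_of_real (\<phi> s) / complex_of_real c) has_vector_derivative
        \<i> * complex_of_real (E s) / complex_of_real c) (at s within {0..1})" by simp
    from field_vector_diff_chain_within [OF this has_field_derivative_at_within [OF DERIV_exp]]
        show ?thesis
      unfolding o_def \<theta>_def .
  qed
  have "solves_evolution c (\<lambda>s. H s - E s *\<^sub>R id_blinfun) V"
    unfolding solves_evolution_def
  proof (intro conjI ballI)
    show "V 0 = id_blinfun" using U by (simp add: V_def \<theta>_def \<phi>_def solves_evolution_def)
    fix s :: real assume s: "s \<in> {0..1}"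
    have lin: "complex_linear_op (H s)" using H [OF s] by (simp add: selfadjoint_op_def)
    have "(V has_vector_derivative \<theta> s *\<^sub>O ((- \<i> / complex_of_real c) *\<^sub>O (H s o\<^sub>L U s))
        + ((\<i> * complex_of_real (E s) / complex_of_real c) * \<theta> s) *\<^sub>O U s) (at s within {0..1})"
      unfolding V_def
      by (rule bounded_bilinear.has_vector_derivative [OF bounded_bilinear_scale_op d\<theta> [OF s]
            solves_evolution_has_vector_derivative [OF U c s]])
    moreover have "(\<i> * complex_of_real c) *\<^sub>O (\<theta>
        s *\<^sub>O ((- \<i> / complex_of_real c) *\<^sub>O (H s o\<^sub>L U s))
        + ((\<i> * complex_of_real (E s) / complex_of_real c) * \<theta> s) *\<^sub>O U s) =
            (H s - E s *\<^sub>R id_blinfun) o\<^sub>L V s"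
    proof -
      have 1: "\<i> * complex_of_real c * (\<theta> s * (- \<i> / complex_of_real c)) = \<theta> s"
        "\<i> * complex_of_real c * (\<i> * complex_of_real (E s) / complex_of_real c * \<theta> s) =
            - (complex_of_real (E s) * \<theta> s)"
        using c by (simp_all add: field_simps)
      have "(\<i> * complex_of_real c) *\<^sub>O (\<theta> s *\<^sub>O ((- \<i> / complex_of_real c) *\<^sub>O (H s o\<^sub>L U s))
          + ((\<i> * complex_of_real (E s) / complex_of_real c) * \<theta> s) *\<^sub>O U s) =
          \<theta> s *\<^sub>O (H s o\<^sub>L U s) + (- (complex_of_real (E s) * \<theta> s)) *\<^sub>O U s"
        by (simp only: scale_op_simps(2) scale_op_scale_op 1)
      also have "\<dots> = (H s - E s *\<^sub>R id_blinfun) o\<^sub>L V s"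
        by (simp add: V_def compose_distribs(3,7) compose_scale_op_right [OF lin]
            scale_op_of_real [symmetric] scale_op_scale_op scale_op_simps(5) compose_scale_op_left)
      finally show ?thesis .
    qed
    ultimately show "\<exists>V'. (V has_vector_derivative V') (at s within {0..1}) \<and>
        (\<i> * complex_of_real c) *\<^sub>O V' = (H s - E s *\<^sub>R id_blinfun) o\<^sub>L V s" by blast
  qed
  moreover have "inverse_op (V s) o\<^sub>L D o\<^sub>L V s = inverse_op (U s) o\<^sub>L D o\<^sub>L U s"
    if s: "s \<in> {0..1}" and D: "complex_linear_op D" for s D
  proof -
    have inv: "is_inverse_op (U s) (inverse_op (U s))" by (rule evolution_inverse [OF U c H s])
    have lin: "complex_linear_op (U s)" "complex_linear_op (inverse_op (U s))"
      using evolution_complex_linear [OF U c H s] evolution_inverse_complex_linear [OF U c H s]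
        by simp_all
    have \<theta>: "\<theta> s \<noteq> 0" by (simp add: \<theta>_def)
    have "is_inverse_op (V s) (inverse (\<theta> s) *\<^sub>O inverse_op (U s))"
      using inv \<theta> by (simp add: is_inverse_op_def V_def compose_scale_op_left compose_scale_op_right
          lin scale_op_scale_op)
    then have "inverse_op (V s) = inverse (\<theta> s) *\<^sub>O inverse_op (U s)" by (rule inverse_op_eq)
    moreover have "complex_linear_op (inverse_op (U s) o\<^sub>L D)"
      by (intro complex_linear_op_intros lin D)
    ultimately show ?thesis
      using \<theta> by (simp add: V_def compose_scale_op_left compose_scale_op_right scale_op_scale_op)
  qed
  ultimately show ?thesis using that [of V] by blast
qed

theorem corollary2p1:
  fixes H P W :: "real \<Rightarrow> real \<Rightarrow> 'a::complex_hilbert operator"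
    and U :: "real \<Rightarrow> real \<Rightarrow> real \<Rightarrow> 'a operator"
    and \<sigma> \<sigma>' :: "real \<Rightarrow> real \<Rightarrow> complex set"
    and E :: "real \<Rightarrow> real \<Rightarrow> real"
    and t \<alpha> :: real
  assumes separable: "separable_space (euclidean :: 'a topology)"
    and selfadjoint: "\<And>s a. s \<in> {0..1} \<Longrightarrow> a \<in> {0..1} \<Longrightarrow> selfadjoint_op (H s a)"
    and regularity: "Ck_on 3 (\<lambda>(s, a). H s a) ({0..1} \<times> {0..1})"
    and gap: "gap_hypothesis H \<sigma> \<sigma>'"
    and eigenvalue: "\<And>s a. s \<in> {0..1} \<Longrightarrow> a \<in> {0..1} \<Longrightarrow> \<sigma> s a = {complex_of_real (E s a)}"
    and projector: "\<And>s a. s \<in> {0..1} \<Longrightarrow> a \<in> {0..1} \<Longrightarrow>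
      P s a = spectral_projector (H s a) (\<sigma> s a)"
    and evolution: "\<And>\<epsilon> a. \<epsilon> > 0 \<Longrightarrow> a \<in> {0..1} \<Longrightarrow>
      solves_evolution \<epsilon> (\<lambda>s. H s a) (\<lambda>s. U \<epsilon> s a)"
    and transport: "\<And>a. a \<in> {0..1} \<Longrightarrow>
      solves_evolution 1 (\<lambda>s. transport_generator P s a) (\<lambda>s. W s a)"
    and t: "t \<in> {0..1}" and \<alpha>: "\<alpha> \<in> {0..1}"
  shows "(\<lambda>\<epsilon>. norm (
            (P 0 \<alpha> o\<^sub>L charge_op \<epsilon> H (U \<epsilon>) t \<alpha> o\<^sub>L P 0 \<alpha>)
          - (P 0 \<alpha> o\<^sub>L
               (((1 / \<epsilon>) * integral {0..t} (\<lambda>s. d_alpha E s \<alpha>)) *\<^sub>R id_blinfun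
                 + \<i> *\<^sub>O (inverse_op (W t \<alpha>) o\<^sub>L d_alpha W t \<alpha>))
             o\<^sub>L P 0 \<alpha>)))
         \<in> O[at_right 0](\<lambda>\<epsilon>. \<epsilon>)"
proof -
  obtain S where split: "\<And>s a. s \<in> {0..1} \<Longrightarrow> a \<in> {0..1} \<Longrightarrow>
      spectral_splitting (H s a) (E s a) (P s a) (S s a)"
    and CH: "C1_square H" and CE: "C1_square E" and CP: "C1_square P" and CS: "C1_square S"
    and CP1: "C1_square (d_t P)" and CP2: "C1_square (d_alpha P)"
    and E2: "\<And>s a. s \<in> {0..1} \<Longrightarrow> a \<in> {0..1} \<Longrightarrow> d_alpha E s a *\<^sub>R P s a =
        P s a o\<^sub>L d_alpha H s a o\<^sub>L P s a"
    and P1: "\<And>s a. s \<in> {0..1} \<Longrightarrow> a \<in> {0..1} \<Longrightarrow> d_t P s a =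
        projector_derivative (d_t H s a) (P s a) (S s a)"
    and P2: "\<And>s a. s \<in> {0..1} \<Longrightarrow> a \<in> {0..1} \<Longrightarrow> d_alpha P s a =
        projector_derivative (d_alpha H s a) (P s a) (S s a)"
    using isolated_eigenvalue_family [OF selfadjoint regularity gap eigenvalue projector] by blast
  note Pr = spectral_splitting_projection [OF split]
  have P_lin: "complex_linear_op (P s a)" if "s \<in> {0..1}" "a \<in> {0..1}" for s a using Pr(3) that .
  have P1_lin: "complex_linear_op (d_t P s a)" if "s \<in> {0..1}" "a \<in> {0..1}" for s a
    by (rule complex_linear_derivative [OF C1_squareD(4) [OF CP that] that(1)])
        (rule P_lin [OF _ that(2)])
  have H_lin: "complex_linear_op (H s a)" if "s \<in> {0..1}" "a \<in> {0..1}" for s a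
    using selfadjoint [OF that] by (simp add: selfadjoint_op_def)
  have H2_lin: "complex_linear_op (d_alpha H s a)" if "s \<in> {0..1}" "a \<in> {0..1}" for s a
    by (rule complex_linear_derivative [OF C1_squareD(5) [OF CH that] that(2)])
        (rule H_lin [OF that(1)])
  have P2_lin: "complex_linear_op (d_alpha P s a)" if "s \<in> {0..1}" "a \<in> {0..1}" for s a
    by (rule complex_linear_derivative [OF C1_squareD(5) [OF CP that] that(2)])
        (rule P_lin [OF that(1)])
  have P1_adj: "adjoint_pair (d_t P s a) (d_t P s a)" if "s \<in> {0..1}" "a \<in> {0..1}" for s a
    by (rule adjoint_pair_derivative [OF C1_squareD(4) [OF CP that] that(1)])
        (rule Pr(2) [OF _ that(2)])
  define L where "L s a = commutator_op (d_t P s a) (P s a)" for s a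
  have K: "selfadjoint_op (\<i> *\<^sub>O L s a)" if "s \<in> {0..1}" "a \<in> {0..1}" for s a
    unfolding L_def by (rule commutator_generator_selfadjoint [OF P1_adj Pr(2) P1_lin P_lin])
        (use that in auto)
  have W: "solves_evolution 1 (\<lambda>s. \<i> *\<^sub>O L s a) (\<lambda>s. W s a)" if "a \<in> {0..1}" for a
    using transport [OF that] by (simp add: transport_generator_def L_def)
  note L1 = C1_square_compose [OF CP1 CP] and L2 = C1_square_compose [OF CP CP1]
  have CL: "C1_square L"
    using C1_square_diff(1) [OF L1(1) L2(1)] unfolding L_def commutator_op_def .
  have dL: "d_alpha L s a = ((d_t P s a o\<^sub>L d_alpha P s a) + (d_alpha (d_t P) s a o\<^sub>L P s a))
      - ((P s a o\<^sub>L d_alpha (d_t P) s a) + (d_alpha P s a o\<^sub>L d_t P s a))"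
        if "s \<in> {0..1}" "a \<in> {0..1}" for s a
    using C1_square_diff(3) [OF L1(1) L2(1) that] L1(3) [OF that] L2(3) [OF that]
    unfolding L_def commutator_op_def by simp
  have transport_integral: "inverse_op (W t \<alpha>) o\<^sub>L d_alpha W t \<alpha> =
      integral {0..t} (\<lambda>s. inverse_op (W s \<alpha>) o\<^sub>L d_alpha L s \<alpha> o\<^sub>L W s \<alpha>)"
    by (rule transport_parameter_derivative [OF CL K W t \<alpha>])
  define A where "A s = H s \<alpha> - E s \<alpha> *\<^sub>R id_blinfun" for s
  define D where "D s = d_alpha H s \<alpha> - d_alpha E s \<alpha> *\<^sub>R id_blinfun" for s
  have lineO: "continuous_on {0..1} (\<lambda>s. F s \<alpha>)"
    if "continuous_on unit_square (\<lambda>p. F (fst p) (snd p))"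
    for F :: "real \<Rightarrow> real \<Rightarrow> 'a operator"
    by (rule continuous_on_square_line(1) [OF that \<alpha>])
  have contE: "continuous_on {0..1} (\<lambda>s. E s \<alpha>)" "continuous_on {0..1} (\<lambda>s. d_alpha E s \<alpha>)"
    using continuous_on_square_line(1) [OF C1_squareD(1) [OF CE] \<alpha>]
      continuous_on_square_line(1) [OF C1_squareD(3) [OF CE] \<alpha>] by simp_all
  have contD: "continuous_on {0..1} D"
    unfolding D_def by (intro continuous_intros contE lineO C1_squareD [OF CH])
  have D_lin: "complex_linear_op (D s)" if "s \<in> {0..1}" for s
    unfolding D_def by (intro complex_linear_op_intros H2_lin that \<alpha>)
  have block: "d_t P s \<alpha> = (d_t P s \<alpha> o\<^sub>L P s \<alpha>) + (P s \<alpha> o\<^sub>L d_t P s \<alpha>)"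
    "d_alpha P s \<alpha> = (d_alpha P s \<alpha> o\<^sub>L P s \<alpha>) + (P s \<alpha> o\<^sub>L d_alpha P s \<alpha>)" if "s \<in> {0..1}" for s
    unfolding P1 [OF that \<alpha>] P2 [OF that \<alpha>]
      by (rule projector_derivative_block [OF split [OF that \<alpha>]])+
  have off: "D s o\<^sub>L P s \<alpha> = - (A s o\<^sub>L d_alpha P s \<alpha> o\<^sub>L P s \<alpha>)"
    "P s \<alpha> o\<^sub>L D s = - (P s \<alpha> o\<^sub>L d_alpha P s \<alpha> o\<^sub>L A s)" if "s \<in> {0..1}" for s
    unfolding A_def D_def P2 [OF that \<alpha>]
      by (rule off_diagonal_block [OF split [OF that \<alpha>] E2 [OF that \<alpha>]])+
  \<comment> \<open>The mixed second derivatives cancel under the compression. This is the link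
    between the transport integral and the commutator produced in
    \<open>adiabatic_integral\<close>.\<close>
  have PLP: "P s \<alpha> o\<^sub>L d_alpha L s \<alpha> o\<^sub>L P s \<alpha> =
      P s \<alpha> o\<^sub>L ((d_t P s \<alpha> o\<^sub>L d_alpha P s \<alpha>) - (d_alpha P s \<alpha> o\<^sub>L d_t P s \<alpha>)) o\<^sub>L P s \<alpha>"
        if s: "s \<in> {0..1}" for s
  proof -
    have PPX: "P s \<alpha> o\<^sub>L (P s \<alpha> o\<^sub>L X) = P s \<alpha> o\<^sub>L X" for X by (metis Pr(1) [OF s \<alpha>] compose_assoc)
    show ?thesis by (simp add: dL [OF s \<alpha>] op_simps PPX Pr(1) [OF s \<alpha>])
  qed
  have A_self: "selfadjoint_op (A s)" if "s \<in> {0..1}" for s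
    unfolding A_def by (rule selfadjoint_op_shift [OF selfadjoint [OF that \<alpha>]])
  have split_A: "A s o\<^sub>L P s \<alpha> = 0" "P s \<alpha> o\<^sub>L A s = 0" "A s o\<^sub>L S s \<alpha> = id_blinfun - P s \<alpha>"
    if "s \<in> {0..1}" for s
    using split [OF that \<alpha>] by (auto simp: A_def spectral_splitting_def)
  obtain C where C: "\<And>\<epsilon> V t. \<epsilon> > 0 \<Longrightarrow> solves_evolution \<epsilon> A V \<Longrightarrow> t \<in> {0..1} \<Longrightarrow>
      norm ((P 0 \<alpha> o\<^sub>L integral {0..t} (\<lambda>s. inverse_op (V s) o\<^sub>L D s o\<^sub>L V s) o\<^sub>L P 0 \<alpha>)
        - (\<i> * \<epsilon>) *\<^sub>O (P 0 \<alpha> o\<^sub>L integral {0..t} (\<lambda>s. inverse_op (W s \<alpha>) o\<^sub>L d_alpha L s \<alpha> o\<^sub>L W s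
            \<alpha>) o\<^sub>L P 0 \<alpha>)) \<le> C * \<epsilon>\<^sup>2"
    by (rule adiabatic_integral [of A "\<lambda>s. P s \<alpha>" "\<lambda>s. S s \<alpha>" "\<lambda>s. d_t P s \<alpha>" "\<lambda>s. d_t (d_t P) s \<alpha>"
          "\<lambda>s. d_t S s \<alpha>" "\<lambda>s. W s \<alpha>" D "\<lambda>s. d_alpha L s \<alpha>" "\<lambda>s. d_alpha P s \<alpha>" "\<lambda>s. d_t (d_alpha P)
              s \<alpha>"])
      (use A_self split_A Pr P_lin P2_lin block off PLP contD K [unfolded L_def] W [OF \<alpha>, unfolded
          L_def]
        C1_squareD [OF CP] C1_squareD [OF CP1] C1_squareD [OF CP2] C1_squareD [OF CS]
            C1_squareD [OF CL] lineO \<alpha> in auto)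
  have main: "norm (
            (P 0 \<alpha> o\<^sub>L charge_op \<epsilon> H (U \<epsilon>) t \<alpha> o\<^sub>L P 0 \<alpha>)
          - (P 0 \<alpha> o\<^sub>L
               (((1 / \<epsilon>) * integral {0..t} (\<lambda>s. d_alpha E s \<alpha>)) *\<^sub>R id_blinfun
                 + \<i> *\<^sub>O (inverse_op (W t \<alpha>) o\<^sub>L d_alpha W t \<alpha>))
             o\<^sub>L P 0 \<alpha>)) \<le> C * \<epsilon>" if \<epsilon>: "\<epsilon> > 0" for \<epsilon>
  proof -
    have \<epsilon>': "\<epsilon> \<noteq> 0" using \<epsilon> by simp
    note U = evolution [OF \<epsilon> \<alpha>]
    have H_self: "selfadjoint_op (H s \<alpha>)" if "s \<in> {0..1}" for s by (rule selfadjoint [OF that \<alpha>])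
    obtain V where V: "solves_evolution \<epsilon> A V"
      and conj: "\<And>s D. s \<in> {0..1} \<Longrightarrow> complex_linear_op D \<Longrightarrow>
        inverse_op (V s) o\<^sub>L D o\<^sub>L V s = inverse_op (U \<epsilon> s \<alpha>) o\<^sub>L D o\<^sub>L U \<epsilon> s \<alpha>"
      unfolding A_def using evolution_phase_shift [OF U \<epsilon>' H_self contE(1)] by blast
    define F where "F = integral {0..t} (\<lambda>s. inverse_op (V s) o\<^sub>L D s o\<^sub>L V s)"
    define G where "G = inverse_op (W t \<alpha>) o\<^sub>L d_alpha W t \<alpha>"
    define \<kappa> where "\<kappa> = integral {0..t} (\<lambda>s. d_alpha E s \<alpha>)"
    have sub: "{0..t} \<subseteq> {0..1}" using t by auto
    have intD: "(\<lambda>s. inverse_op (V s) o\<^sub>L D s o\<^sub>L V s) integrable_on {0..t}"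
      by (intro integrable_continuous_interval continuous_intros)
        (use evolution_continuous [OF V \<epsilon>' A_self] contD sub in \<open>auto intro: continuous_on_subset\<close>)
    have intE: "(\<lambda>s. d_alpha E s \<alpha>) integrable_on {0..t}"
      by (intro integrable_continuous_interval continuous_on_subset [OF contE(2) sub])
    \<comment> \<open>\<open>d_alpha H\<close> is \<open>D\<close> plus the scalar
      \<open>d_alpha E\<close>. Conjugation leaves the scalar alone, so its integral \<kappa> is the
      dynamical contribution.\<close>
    have "integral {0..t} (\<lambda>s. inverse_op (U \<epsilon> s \<alpha>) o\<^sub>L d_alpha H s \<alpha> o\<^sub>L U \<epsilon> s \<alpha>) =
        integral {0..t} (\<lambda>s. (inverse_op (V s) o\<^sub>L D s o\<^sub>L V s) + d_alpha E s \<alpha> *\<^sub>R id_blinfun)"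
    proof (rule integral_cong)
      fix s assume "s \<in> {0..t}"
      then have s: "s \<in> {0..1}" using sub by auto
      have "is_inverse_op (U \<epsilon> s \<alpha>) (inverse_op (U \<epsilon> s \<alpha>))"
        by (rule evolution_inverse [OF U \<epsilon>' H_self s])
      then show "inverse_op (U \<epsilon> s \<alpha>) o\<^sub>L d_alpha H s \<alpha> o\<^sub>L U \<epsilon> s \<alpha> =
          (inverse_op (V s) o\<^sub>L D s o\<^sub>L V s) + d_alpha E s \<alpha> *\<^sub>R id_blinfun"
        unfolding conj [OF s D_lin [OF s]] by (simp add: D_def op_simps is_inverse_op_def)
    qed
    also have "\<dots> = F + \<kappa> *\<^sub>R id_blinfun"
      unfolding F_def \<kappa>_def
      using integral_linear [OF intE bounded_linear_scaleR_left]
        integrable_linear [OF intE bounded_linear_scaleR_left]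
      by (subst integral_add [OF intD]) (simp_all add: o_def)
    finally have charge: "charge_op \<epsilon> H (U \<epsilon>) t \<alpha> = (1 / \<epsilon>) *\<^sub>R (F + \<kappa> *\<^sub>R id_blinfun)"
      by (simp add: charge_op_def)
    have P0_lin: "complex_linear_op (P 0 \<alpha>)" by (rule P_lin [OF _ \<alpha>]) simp
    have "(1 / \<epsilon>) *\<^sub>R ((\<i> * \<epsilon>) *\<^sub>O X) = \<i> *\<^sub>O X" for X :: "'a operator"
      using \<epsilon>' by (simp add: scale_op_of_real [symmetric] scale_op_scale_op)
    then have "(P 0 \<alpha> o\<^sub>L charge_op \<epsilon> H (U \<epsilon>) t \<alpha> o\<^sub>L P 0 \<alpha>)
          - (P 0 \<alpha> o\<^sub>L (((1 / \<epsilon>) * \<kappa>) *\<^sub>R id_blinfun + \<i> *\<^sub>O G) o\<^sub>L P 0 \<alpha>) =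
        (1 / \<epsilon>) *\<^sub>R ((P 0 \<alpha> o\<^sub>L F o\<^sub>L P 0 \<alpha>) - (\<i> * \<epsilon>) *\<^sub>O (P 0 \<alpha> o\<^sub>L G o\<^sub>L P 0 \<alpha>))"
      unfolding charge
      by (simp only: scaleR_diff_right) (simp add: op_simps compose_scale_op_right [OF P0_lin]
          scaleR_add_right)
    then have "norm ((P 0 \<alpha> o\<^sub>L charge_op \<epsilon> H (U \<epsilon>) t \<alpha> o\<^sub>L P 0 \<alpha>)
          - (P 0 \<alpha> o\<^sub>L (((1 / \<epsilon>) * \<kappa>) *\<^sub>R id_blinfun + \<i> *\<^sub>O G) o\<^sub>L P 0 \<alpha>)) =
        (1 / \<epsilon>) * norm ((P 0 \<alpha> o\<^sub>L F o\<^sub>L P 0 \<alpha>) - (\<i> * \<epsilon>) *\<^sub>O (P 0 \<alpha> o\<^sub>L G o\<^sub>L P 0 \<alpha>))"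
      using \<epsilon> by simp
    also have "\<dots> \<le> (1 / \<epsilon>) * (C * \<epsilon>\<^sup>2)"
      using C [OF \<epsilon> V t] \<epsilon> unfolding F_def G_def transport_integral by (intro mult_left_mono) auto
    also have "\<dots> = C * \<epsilon>" using \<epsilon> by (simp add: power2_eq_square)
    finally show ?thesis by (simp only: G_def \<kappa>_def)
  qed
  show ?thesis
  proof (rule bigoI [of _ C])
    show "\<forall>\<^sub>F \<epsilon> in at_right 0. norm (norm (
            (P 0 \<alpha> o\<^sub>L charge_op \<epsilon> H (U \<epsilon>) t \<alpha> o\<^sub>L P 0 \<alpha>)
          - (P 0 \<alpha> o\<^sub>L
               (((1 / \<epsilon>) * integral {0..t} (\<lambda>s. d_alpha E s \<alpha>)) *\<^sub>R id_blinfun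
                 + \<i> *\<^sub>O (inverse_op (W t \<alpha>) o\<^sub>L d_alpha W t \<alpha>))
             o\<^sub>L P 0 \<alpha>))) \<le> C * norm \<epsilon>"
      using eventually_at_right_less [of 0] by eventually_elim (use main in auto)
  qed
qed

end
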